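(* Let $n\ge 1$, $q=2^n-1$, and let $k=(k_0,\dots,k_q)$ and $m=(m_0,\dots,m_q)$ be tuples of natural numbers with $k_i\le m_i$ for all $i$. For $k$-indices $I,J$, let $g_{I,J}=(\overline{g}_{I,J},g^*_{I,J})$ be the transition morphism from $(\widetilde U_{J,I},\mathcal O_J|_{\widetilde U_{J,I}})$ to $(\widetilde U_{I,J},\mathcal O_I|_{\widetilde U_{I,J}})$ determined by $D_I\big((M_IA_J)^{-1}A_J\big)=D_I(A_I)$, as defined in the context. Then for all $k$-indices $I,J,S$: 1. $g^*_{I,I}=\mathrm{id}$; 2. $g^*_{J,I}\circ g^*_{I,J}=\mathrm{id}$ (on $\mathcal O_I|_{\widetilde U_{I,J}}$); 3. $g^*_{S,I}\circ g^*_{J,S}\circ g^*_{I,J}=\mathrm{id}$ (on the restriction of $\mathcal O_I$ to $\widetilde U_{I,J}\cap\widetilde U_{I,S}$).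
   Context: Grading. On $\mathbb Z_2^n$ put $\langle a,b\rangle=\sum_i a_ib_i \bmod 2$. Order $\mathbb Z_2^n$ totally so that elements with $\langle\gamma,\gamma\rangle=0$ (even) precede those with $\langle\gamma,\gamma\rangle=1$ (odd), and lexicographically within the even and within the odd elements; write $\gamma_0<\gamma_1<\dots<\gamma_q$, $q=2^n-1$ (so $\gamma_0=0$). A $\mathbb Z_2^n$-graded ring is $\mathbb Z_2^n$-commutative if $ab=(-1)^{\langle\deg a,\deg b\rangle}ba$ for homogeneous $a,b$. Superdomains. For $\beta=(\beta_0,\dots,\beta_q)$, the $\mathbb Z_2^n$-superdomain $\mathbb R^{\beta}$ is the space $\mathbb R^{\beta_0}$ with the sheaf $C^\infty_{\mathbb R^{\beta_0}}(-)[[\xi_i^j : 1\le i\le q,\ 1\le j\le \beta_i]]$ of $\mathbb Z_2^n$-commutative algebras of formal power series, where $\xi_i^j$ has degree $\gamma_i$ and $\xi_i^j\xi_k^l=(-1)^{\langle\gamma_i,\gamma_k\rangle}\xi_k^l\xi_i^j$. Evaluation of $\sum f_L\xi^L$ at a point $x$ is $f_\emptyset(x)$. Morphisms of $\mathbb Z_2^n$-ringed spaces are pairs (continuous map, degree-preserving morphism of sheaves of algebras), local on stalks; a morphism from a $\mathbb Z_2^n$-supermanifold into an open part of a superdomain is determined by the pullbacks of the coordinates. Supermatrices. A $k\times m$ (weight zero) $\mathbb Z_2^n$-supermatrix over a $\mathbb Z_2^n$-commutative algebra is a matrix with $(q+1)\times(q+1)$ blocks $B_{ij}$, where $B_{ij}$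 is of size $k_i\times m_j$ with entries homogeneous of degree $\gamma_i+\gamma_j$. Charts. A $k$-index is $I=(I_0,\dots,I_q)$ with $I_i\subset\{1,\dots,m_i\}$ of cardinality $k_i$, listed in increasing order. For a $k\times m$ supermatrix $A$, $M_IA$ is the $k\times k$ supermatrix formed by the columns of $A$ whose position in the $i$-th column block belongs to $I_i$ ($i=0,\dots,q$), and $D_I(A)$ is the matrix left after deleting these columns. Put $\beta_l=\sum_{\gamma_i+\gamma_j=\gamma_l}k_i(m_j-k_j)$. For every $k$-index $I$ let $U_I=(\overline U_I,\mathcal O_I)$ be a copy of $\mathbb R^{\beta}$, labelled by the $k\times m$ supermatrix $A_I$ such that $M_IA_I$ is the identity and the remaining entries $D_I(A_I)$ are exactly the $\beta_0+\dots+\beta_q$ coordinates of $U_I$, each used once, placed (from top to bottom and left to right) in blocks of matching degree. Transition maps. $\widetilde U_{I,J}\subset\overline U_I$ is the open set of points at which $M_JA_I$ is invertible. The morphism $g_{I,J}:(\widetilde U_{J,I},\mathcal O_J|_{\widetilde U_{J,I}})\to(\widetilde U_{I,J},\mathcal O_I|_{\widetilde U_{I,J}})$ is the one whose pullback $g^*_{I,J}$ sends each coordinate of $U_I$, i.e. each entry of $D_I(A_I)$, to the corresponding entry of $D_I\big((M_IA_J)^{-1}A_J\big)$. *)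

theory Defs
  imports
    "HOL-Analysis.Analysis"
    "HOL-Algebra.Ring"
    "HOL-Library.Poly_Mapping"
    "HOL-Library.Z2"
begin

section \<open>The grading group\<close>

text \<open>Elements of \<open>\<int>\<^sub>2\<^sup>n\<close> are lists of length \<open>n\<close> over the two-element field.  All
  enumerations inside a block (rows, columns, coordinates) start at \<open>0\<close>.\<close>

definition pairing :: "bit list \<Rightarrow> bit list \<Rightarrow> bit" where
  "pairing a b = (\<Sum>i<length a. a ! i * b ! i)"

definition gadd :: "bit list \<Rightarrow> bit list \<Rightarrow> bit list" where
  "gadd a b = map2 (+) a b"

text \<open>\<open>product_lists\<close> enumerates lexicographically (leftmost entry most significant).\<close>

definition gammas :: "nat \<Rightarrow> bit list list" where
  "gammas n = (let V = product_lists (replicate n [0, 1]) in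
     filter (\<lambda>a. pairing a a = 0) V @ filter (\<lambda>a. pairing a a = 1) V)"

definition gam :: "nat \<Rightarrow> nat \<Rightarrow> bit list" where
  "gam n i = gammas n ! i"

definition bsign :: "bit \<Rightarrow> real" where
  "bsign e = (if e = 0 then 1 else - 1)"


section \<open>Smooth functions on open subsets of Euclidean space\<close>

text \<open>\<open>\<real>\<^sup>N\<close> is the library's \<open>Euclidean_space N\<close>: the functions \<open>nat \<Rightarrow> real\<close> that vanish
  from \<open>N\<close> on.  The dimensions below depend on terms, so it cannot be a type.\<close>

definition partial_deriv :: "nat \<Rightarrow> ((nat \<Rightarrow> real) \<Rightarrow> real) \<Rightarrow> (nat \<Rightarrow> real) \<Rightarrow> real" where
  "partial_deriv i f x = deriv (\<lambda>t. f (x(i := t))) (x i)"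

fun C_k_on :: "nat \<Rightarrow> nat \<Rightarrow> (nat \<Rightarrow> real) set \<Rightarrow> ((nat \<Rightarrow> real) \<Rightarrow> real) \<Rightarrow> bool" where
  "C_k_on N 0 U f \<longleftrightarrow>
     continuous_map (subtopology (Euclidean_space N) U) euclideanreal f"
| "C_k_on N (Suc r) U f \<longleftrightarrow>
     continuous_map (subtopology (Euclidean_space N) U) euclideanreal f \<and>
     (\<forall>i<N. (\<forall>x\<in>U. (\<lambda>t. f (x(i := t))) field_differentiable at (x i)) \<and>
            C_k_on N r U (partial_deriv i f))"

definition smooth_on :: "nat \<Rightarrow> (nat \<Rightarrow> real) set \<Rightarrow> ((nat \<Rightarrow> real) \<Rightarrow> real) \<Rightarrow> bool" where
  "smooth_on N U f \<longleftrightarrow> (\<forall>r. C_k_on N r U f)"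


section \<open>Superdomains\<close>

text \<open>The generator \<open>\<xi>\<^sub>l\<^sup>j\<close> is the pair \<open>(l, j)\<close>.  A multi-index \<open>L\<close> stands for the monomial
  \<open>\<xi>\<^sup>L\<close>, the product of the powers \<open>\<xi>\<^sub>a\<^sup>(\<^sup>L\<^sup>a\<^sup>)\<close> in increasing lexicographic order of the generators
  \<open>a\<close>.  Odd generators square to zero, so their exponents are at most \<open>1\<close>; even generators
  of nonzero degree are not nilpotent.\<close>

type_synonym mindex = "(nat \<times> nat, nat) poly_mapping"
type_synonym section_fn = "mindex \<Rightarrow> (nat \<Rightarrow> real) \<Rightarrow> real"

definition gens :: "nat \<Rightarrow> (nat \<Rightarrow> nat) \<Rightarrow> (nat \<times> nat) set" where
  "gens n \<beta> = {(l, j). 1 \<le> l \<and> l < 2 ^ n \<and> j < \<beta> l}"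

definition admissible :: "nat \<Rightarrow> (nat \<Rightarrow> nat) \<Rightarrow> mindex \<Rightarrow> bool" where
  "admissible n \<beta> L \<longleftrightarrow> Poly_Mapping.keys L \<subseteq> gens n \<beta> \<and>
     (\<forall>a \<in> gens n \<beta>. pairing (gam n (fst a)) (gam n (fst a)) = 1 \<longrightarrow> Poly_Mapping.lookup L a \<le> 1)"

definition mdeg :: "nat \<Rightarrow> mindex \<Rightarrow> bit list" where
  "mdeg n L = map (\<lambda>i. \<Sum>a\<in>Poly_Mapping.keys L. of_nat (Poly_Mapping.lookup L a) * gam n (fst a) ! i) [0..<n]"

text \<open>\<open>\<xi>\<^sup>M \<xi>\<^sup>N = koszul M N \<xi>\<^sup>M\<^sup>+\<^sup>N\<close>: each factor \<open>\<xi>\<^sub>b\<close> of \<open>\<xi>\<^sup>N\<close> is moved to the left past the factors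
  \<open>\<xi>\<^sub>a\<close> of \<open>\<xi>\<^sup>M\<close> with \<open>b < a\<close>.\<close>

definition koszul :: "nat \<Rightarrow> mindex \<Rightarrow> mindex \<Rightarrow> real" where
  "koszul n M N = bsign (\<Sum>a\<in>Poly_Mapping.keys M.
     \<Sum>b | b \<in> Poly_Mapping.keys N \<and> (b, a) \<in> less_than <*lex*> less_than.
       of_nat (Poly_Mapping.lookup M a * Poly_Mapping.lookup N b) * pairing (gam n (fst a)) (gam n (fst b)))"

text \<open>The algebra of sections of \<open>C\<^sup>\<infinity>[[\<xi>]]\<close> over \<open>U\<close>.  The series \<open>\<Sum> f\<^sub>L \<xi>\<^sup>L\<close> is its coefficient family;
  coefficients are extended by \<open>0\<close> outside \<open>U\<close>, so that equality of sections is
  equality of terms.\<close>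

definition sect :: "nat \<Rightarrow> (nat \<Rightarrow> nat) \<Rightarrow> (nat \<Rightarrow> real) set \<Rightarrow> section_fn ring" where
  "sect n \<beta> U = \<lparr>
     carrier = {f. (\<forall>L. admissible n \<beta> L \<longrightarrow> smooth_on (\<beta> 0) U (f L)) \<and>
                   (\<forall>L x. \<not> admissible n \<beta> L \<or> x \<notin> U \<longrightarrow> f L x = 0)},
     mult = (\<lambda>f g L x. if admissible n \<beta> L
               then \<Sum>(M, N) | M + N = L. koszul n M N * f M x * g N x else 0),
     one = (\<lambda>L x. if L = 0 \<and> x \<in> U then 1 else 0),
     zero = (\<lambda>L x. 0),
     add = (\<lambda>f g L x. f L x + g L x)\<rparr>"

definition sscale :: "real \<Rightarrow> section_fn \<Rightarrow> section_fn" where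
  "sscale c f = (\<lambda>L x. c * f L x)"

definition srestrict :: "(nat \<Rightarrow> real) set \<Rightarrow> section_fn \<Rightarrow> section_fn" where
  "srestrict V f = (\<lambda>L x. if x \<in> V then f L x else 0)"

definition homogeneous :: "nat \<Rightarrow> bit list \<Rightarrow> section_fn \<Rightarrow> bool" where
  "homogeneous n d f \<longleftrightarrow> (\<forall>L x. f L x \<noteq> 0 \<longrightarrow> mdeg n L = d)"

definition sval :: "section_fn \<Rightarrow> (nat \<Rightarrow> real) \<Rightarrow> real" where
  "sval f x = f 0 x"

text \<open>The coordinates of the open subdomain \<open>U\<close>: for \<open>l = 0\<close> the base coordinates.\<close>

definition coord :: "(nat \<Rightarrow> real) set \<Rightarrow> nat \<Rightarrow> nat \<Rightarrow> section_fn" where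
  "coord U l j = (\<lambda>L x.
     if x \<notin> U then 0
     else if l = 0 then (if L = 0 then x j else 0)
     else (if L = Poly_Mapping.single (l, j) 1 then 1 else 0))"


section \<open>Morphisms between open subdomains\<close>

text \<open>A morphism is a pair of a base map and of the family of pullbacks, indexed by the open subsets
  of the target.  In the last condition, a germ at \<open>y\<close> is a unit of the stalk iff it has
  a representative that is a unit; a homomorphism of local rings maps the
  maximal ideal into the maximal ideal iff it maps nonunits to nonunits.\<close>

type_synonym morph = "((nat \<Rightarrow> real) \<Rightarrow> nat \<Rightarrow> real) \<times> ((nat \<Rightarrow> real) set \<Rightarrow> section_fn \<Rightarrow> section_fn)"

abbreviation base :: "morph \<Rightarrow> (nat \<Rightarrow> real) \<Rightarrow> nat \<Rightarrow> real" where "base \<equiv> fst"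
abbreviation pull :: "morph \<Rightarrow> (nat \<Rightarrow> real) set \<Rightarrow> section_fn \<Rightarrow> section_fn" where "pull \<equiv> snd"

definition preim :: "morph \<Rightarrow> (nat \<Rightarrow> real) set \<Rightarrow> (nat \<Rightarrow> real) set \<Rightarrow> (nat \<Rightarrow> real) set" where
  "preim g U W = {x \<in> U. base g x \<in> W}"

definition unit_germ ::
    "nat \<Rightarrow> (nat \<Rightarrow> nat) \<Rightarrow> (nat \<Rightarrow> real) set \<Rightarrow> (nat \<Rightarrow> real) \<Rightarrow> section_fn \<Rightarrow> bool" where
  "unit_germ n \<beta> U y f \<longleftrightarrow>
     (\<exists>V. openin (Euclidean_space (\<beta> 0)) V \<and> y \<in> V \<and> V \<subseteq> U \<and> srestrict V f \<in> Units (sect n \<beta> V))"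

definition morphism ::
    "nat \<Rightarrow> (nat \<Rightarrow> nat) \<Rightarrow> (nat \<Rightarrow> real) set \<Rightarrow> (nat \<Rightarrow> nat) \<Rightarrow> (nat \<Rightarrow> real) set \<Rightarrow> morph \<Rightarrow> bool" where
  "morphism n \<beta> U \<beta>' V g \<longleftrightarrow>
     continuous_map (subtopology (Euclidean_space (\<beta> 0)) U)
                    (subtopology (Euclidean_space (\<beta>' 0)) V) (base g) \<and>
     (\<forall>W. openin (Euclidean_space (\<beta>' 0)) W \<and> W \<subseteq> V \<longrightarrow>
        pull g W \<in> ring_hom (sect n \<beta>' W) (sect n \<beta> (preim g U W)) \<and>
        (\<forall>c. \<forall>f \<in> carrier (sect n \<beta>' W). pull g W (sscale c f) = sscale c (pull g W f)) \<and>
        (\<forall>d. \<forall>f \<in> carrier (sect n \<beta>' W). homogeneous n d f \<longrightarrow> homogeneous n d (pull g W f)) \<and>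
        (\<forall>W' f. openin (Euclidean_space (\<beta>' 0)) W' \<and> W' \<subseteq> W \<and> f \<in> carrier (sect n \<beta>' W) \<longrightarrow>
           pull g W' (srestrict W' f) = srestrict (preim g U W') (pull g W f)) \<and>
        (\<forall>x \<in> preim g U W. \<forall>f \<in> carrier (sect n \<beta>' W).
           unit_germ n \<beta> (preim g U W) x (pull g W f) \<longrightarrow> unit_germ n \<beta>' W (base g x) f))"


section \<open>Block matrices\<close>

text \<open>Rows and columns are indexed by pairs (block, position inside the block).\<close>

type_synonym 'a bmat = "nat \<times> nat \<Rightarrow> nat \<times> nat \<Rightarrow> 'a"

definition block_ix :: "nat \<Rightarrow> (nat \<Rightarrow> nat) \<Rightarrow> (nat \<times> nat) set" where
  "block_ix n k = {(i, a). i < 2 ^ n \<and> a < k i}"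

definition bmult :: "('a, 'b) ring_scheme \<Rightarrow> (nat \<times> nat) set \<Rightarrow> 'a bmat \<Rightarrow> 'a bmat \<Rightarrow> 'a bmat" where
  "bmult R K A B = (\<lambda>p q. finsum R (\<lambda>r. A p r \<otimes>\<^bsub>R\<^esub> B r q) K)"

definition bone :: "('a, 'b) ring_scheme \<Rightarrow> 'a bmat" where
  "bone R = (\<lambda>p q. if p = q then \<one>\<^bsub>R\<^esub> else \<zero>\<^bsub>R\<^esub>)"

definition is_binv :: "('a, 'b) ring_scheme \<Rightarrow> (nat \<times> nat) set \<Rightarrow> 'a bmat \<Rightarrow> 'a bmat \<Rightarrow> bool" where
  "is_binv R K A X \<longleftrightarrow> (\<forall>p\<in>K. \<forall>q\<in>K. X p q \<in> carrier R \<and>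
     bmult R K X A p q = bone R p q \<and> bmult R K A X p q = bone R p q)"

definition binv :: "('a, 'b) ring_scheme \<Rightarrow> (nat \<times> nat) set \<Rightarrow> 'a bmat \<Rightarrow> 'a bmat" where
  "binv R K A = (SOME X. is_binv R K A X)"

definition real_ring :: "real ring" where
  "real_ring = \<lparr>carrier = UNIV, mult = (*), one = 1, zero = 0, add = (+)\<rparr>"


section \<open>Charts\<close>

definition k_index :: "nat \<Rightarrow> (nat \<Rightarrow> nat) \<Rightarrow> (nat \<Rightarrow> nat) \<Rightarrow> (nat \<Rightarrow> nat set) \<Rightarrow> bool" where
  "k_index n k m I \<longleftrightarrow> (\<forall>i < 2 ^ n. I i \<subseteq> {..<m i} \<and> card (I i) = k i) \<and> (\<forall>i \<ge> 2 ^ n. I i = {})"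

definition sel_cols :: "(nat \<Rightarrow> nat set) \<Rightarrow> 'a bmat \<Rightarrow> 'a bmat" where
  "sel_cols I A = (\<lambda>p (j, c). A p (j, sorted_list_of_set (I j) ! c))"

definition del_cols :: "(nat \<Rightarrow> nat) \<Rightarrow> (nat \<Rightarrow> nat set) \<Rightarrow> 'a bmat \<Rightarrow> 'a bmat" where
  "del_cols m I A = (\<lambda>p (j, c). A p (j, sorted_list_of_set ({..<m j} - I j) ! c))"

definition beta :: "nat \<Rightarrow> (nat \<Rightarrow> nat) \<Rightarrow> (nat \<Rightarrow> nat) \<Rightarrow> nat \<Rightarrow> nat" where
  "beta n k m l =
     (\<Sum>(i, j) | i < 2 ^ n \<and> j < 2 ^ n \<and> gadd (gam n i) (gam n j) = gam n l. k i * (m j - k j))"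

text \<open>The positions of a \<open>k \<times> (m - k)\<close> matrix in blocks of degree \<open>\<gamma>\<^sub>l\<close> receive the coordinates
  number \<open>0, 1, \<dots>, \<beta>\<^sub>l - 1\<close> of degree \<open>\<gamma>\<^sub>l\<close> row by row, each row from left to right.\<close>

definition positions ::
    "nat \<Rightarrow> (nat \<Rightarrow> nat) \<Rightarrow> (nat \<Rightarrow> nat) \<Rightarrow> nat \<Rightarrow> ((nat \<times> nat) \<times> (nat \<times> nat)) set" where
  "positions n k m l = {(p, q). p \<in> block_ix n k \<and> q \<in> block_ix n (\<lambda>j. m j - k j) \<and>
     gadd (gam n (fst p)) (gam n (fst q)) = gam n l}"

definition coord_matrix ::
    "nat \<Rightarrow> (nat \<Rightarrow> nat) \<Rightarrow> (nat \<Rightarrow> nat) \<Rightarrow> (nat \<Rightarrow> real) set \<Rightarrow> section_fn bmat" where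
  "coord_matrix n k m U = (\<lambda>p q.
     let l = (THE l. l < 2 ^ n \<and> gam n l = gadd (gam n (fst p)) (gam n (fst q)))
     in coord U l (card {z \<in> positions n k m l.
          (z, (p, q)) \<in> (less_than <*lex*> less_than) <*lex*> (less_than <*lex*> less_than)}))"

definition rank_in :: "nat set \<Rightarrow> nat \<Rightarrow> nat" where
  "rank_in S b = card {x \<in> S. x < b}"

text \<open>The matrix \<open>A\<^sub>I\<close>, with its coordinates restricted to \<open>U\<close>.\<close>

definition chart_matrix ::
    "nat \<Rightarrow> (nat \<Rightarrow> nat) \<Rightarrow> (nat \<Rightarrow> nat) \<Rightarrow> (nat \<Rightarrow> nat set) \<Rightarrow> (nat \<Rightarrow> real) set \<Rightarrow> section_fn bmat" where
  "chart_matrix n k m I U = (\<lambda>p (j, b).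
     if b \<in> I j then bone (sect n (beta n k m) U) p (j, rank_in (I j) b)
     else coord_matrix n k m U p (j, rank_in ({..<m j} - I j) b))"

lemma nth_sorted_rank:
  assumes "finite S" "c < card S"
  shows "sorted_list_of_set S ! c \<in> S" "rank_in S (sorted_list_of_set S ! c) = c"
proof -
  let ?l = "sorted_list_of_set S"
  have len: "length ?l = card S" and st: "set ?l = S" and sm: "sorted_wrt (<) ?l"
    using assms by auto
  show "?l ! c \<in> S" using len st assms nth_mem by metis
  have "{x \<in> S. x < ?l ! c} = (!) ?l ` {..<c}"
  proof (intro Set.set_eqI iffI)
    fix x assume "x \<in> {x \<in> S. x < ?l ! c}"
    then obtain i where i: "i < card S" "x = ?l ! i" "?l ! i < ?l ! c"
      using st len by (metis (mono_tags, lifting) in_set_conv_nth mem_Collect_eq)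
    have "i < c"
    proof (rule ccontr)
      assume "\<not> i < c"
      then have "?l ! c \<le> ?l ! i"
        using sorted_nth_mono[of ?l c i] i(1) len by simp
      then show False using i(3) by simp
    qed
    then show "x \<in> (!) ?l ` {..<c}" using i by auto
  next
    fix x assume "x \<in> (!) ?l ` {..<c}"
    then show "x \<in> {x \<in> S. x < ?l ! c}"
    proof -
      obtain i where i: "i < c" "x = ?l ! i" using \<open>x \<in> _\<close> by auto
      then have "?l ! i < ?l ! c" "?l ! i \<in> S"
        using sorted_wrt_nth_less[OF sm i(1)] len st assms nth_mem[of i ?l] by auto
      then show "x \<in> {x \<in> S. x < ?l ! c}" using i(2) by simp
    qed
  qed
  moreover have "inj_on ((!) ?l) {..<c}"
    using len assms by (auto intro!: inj_on_nth)
  ultimately show "rank_in S (?l ! c) = c"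
    by (simp add: rank_in_def card_image)
qed

lemma sel_cols_chart_matrix:
  assumes "k_index n k m I" "q \<in> block_ix n k"
  shows "sel_cols I (chart_matrix n k m I U) p q = bone (sect n (beta n k m) U) p q"
  using assms nth_sorted_rank[of "I (fst q)" "snd q"]
  by (auto simp: sel_cols_def chart_matrix_def k_index_def block_ix_def finite_subset)

lemma del_cols_chart_matrix:
  assumes "k_index n k m I" "q \<in> block_ix n (\<lambda>j. m j - k j)"
  shows "del_cols m I (chart_matrix n k m I U) p q = coord_matrix n k m U p q"
proof -
  obtain j c where q: "q = (j, c)" by force
  have I: "I j \<subseteq> {..<m j}" "card (I j) = k j" and c: "c < m j - k j"
    using assms q by (auto simp: k_index_def block_ix_def)
  then have "c < card ({..<m j} - I j)"
    by (simp add: card_Diff_subset finite_subset)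
  from nth_sorted_rank[OF _ this] show ?thesis
    by (simp add: q del_cols_def chart_matrix_def)
qed


section \<open>Transition maps\<close>

text \<open>\<open>overlap n k m I J\<close> is the open set of points of the chart of \<open>I\<close> where \<open>M\<^sub>J A\<^sub>I\<close> is invertible,
  that is, where the real matrix of values is.\<close>

definition overlap ::
    "nat \<Rightarrow> (nat \<Rightarrow> nat) \<Rightarrow> (nat \<Rightarrow> nat) \<Rightarrow> (nat \<Rightarrow> nat set) \<Rightarrow> (nat \<Rightarrow> nat set) \<Rightarrow> (nat \<Rightarrow> real) set" where
  "overlap n k m I J = {x \<in> topspace (Euclidean_space (beta n k m 0)).
     \<exists>X. is_binv real_ring (block_ix n k)
       (\<lambda>p q. sval (sel_cols J (chart_matrix n k m I (topspace (Euclidean_space (beta n k m 0)))) p q) x) X}"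

text \<open>\<open>g\<^sub>I\<^sub>J\<close> goes from the chart of \<open>J\<close> to the chart of \<open>I\<close>.\<close>

definition transition_morphism ::
    "nat \<Rightarrow> (nat \<Rightarrow> nat) \<Rightarrow> (nat \<Rightarrow> nat) \<Rightarrow> (nat \<Rightarrow> nat set) \<Rightarrow> (nat \<Rightarrow> nat set) \<Rightarrow> morph \<Rightarrow> bool" where
  "transition_morphism n k m I J g \<longleftrightarrow>
     (let \<beta> = beta n k m; U = overlap n k m J I; V = overlap n k m I J;
          R = sect n \<beta> U; K = block_ix n k;
          A\<^sub>J = chart_matrix n k m J U; A\<^sub>I = chart_matrix n k m I V
      in morphism n \<beta> U \<beta> V g \<and>
         (\<forall>p \<in> K. \<forall>q \<in> block_ix n (\<lambda>j. m j - k j).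
            pull g V (del_cols m I A\<^sub>I p q) =
            del_cols m I (bmult R K (binv R K (sel_cols I A\<^sub>J)) A\<^sub>J) p q))"

end

theory Submission
  imports Defs "Jordan_Normal_Form.Determinant"
begin

text \<open>
  Write \<open>A\<^sub>I\<close> for the matrix of coordinates of the chart \<open>I\<close>.  Since \<open>g\<^sub>I\<^sub>J\<^sup>*\<close> maps \<open>A\<^sub>I\<close> to a left multiple of \<open>A\<^sub>J\<close>, a
  cyclic composite \<open>h\<close> of such pullbacks satisfies \<open>h(A\<^sub>I) = C A\<^sub>I\<close> for some square matrix \<open>C\<close>.  The columns of \<open>A\<^sub>I\<close>
  in \<open>I\<close> form the identity matrix, which \<open>h\<close> preserves, so \<open>C = 1\<close> and \<open>h\<close> fixes all coordinates.

  A morphism of a domain into itself that fixes the coordinates is the identity: locality on stalks gives this for the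
  base map.  For a section \<open>f\<close> and a point \<open>c\<close>, Hadamard's lemma gives
  \<open>f = f(c) + \<Sum>\<^sub>i (x\<^sub>i - c\<^sub>i) g\<^sub>i + \<Sum>\<^sub>a \<xi>\<^sub>a h\<^sub>a\<close> near \<open>c\<close>.  Comparing the coefficients of \<open>\<xi>\<^sup>L\<close> at \<open>c\<close> of \<open>f\<close> and of its
  pullback, the second sum vanishes and the third one involves only coefficients of \<open>h\<^sub>a\<close> of smaller degree, so one
  concludes by induction on \<open>|L|\<close>.

  For \<open>(M\<^sub>I A\<^sub>J)\<^sup>-\<^sup>1\<close> to exist, a matrix of sections must be invertible as soon as its values are; the inverse is built
  by recursion on \<open>|L|\<close> from the smooth inverse of the matrix of values, which Cramer's rule provides.
\<close>

section \<open>Smooth functions\<close>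

text \<open>Even generators of nonzero degree are not nilpotent, so sections are genuine power
  series, which no finite Taylor expansion exhausts. Coefficients are therefore compared one
  multi-index at a time: the coefficient of a product at \<open>L\<close> involves only the finitely
  many splittings of \<open>L\<close>. Matrices of sections have entries that need not commute, so
  determinants serve only for the matrices of values; over the sections a right inverse is built,
  and it is two-sided because it has a right inverse itself. The three claims become one statement
  about an endomorphism of a single domain. For the threefold composite such a domain exists only
  after shrinking to triple overlaps, and one has to know that the preimage of a triple overlap
  under a transition map is again a triple overlap.\<close>

lemma Euclidean_space_eq_top_of_set: "Euclidean_space N = top_of_set {x. \<forall>i\<ge>N. x i = 0}"
  by (simp add: Euclidean_space_def euclidean_product_topology)

lemma openin_Euclidean_space_zero:
  assumes "openin (Euclidean_space N) U" "x \<in> U" "i \<ge> N"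
  shows "x i = 0"
  using openin_subset[OF assms(1)] assms(2,3) by (auto simp: topspace_Euclidean_space)

lemma subtopology_Euclidean_space_openin:
  assumes "openin (Euclidean_space N) U"
  shows "subtopology (Euclidean_space N) U = top_of_set U"
proof -
  have "{x. \<forall>i\<ge>N. x i = 0} \<inter> U = U"
    using openin_subset[OF assms] by (auto simp: topspace_Euclidean_space)
  then show ?thesis
    by (simp add: Euclidean_space_eq_top_of_set subtopology_subtopology)
qed

lemma continuous_on_fun_upd_const: "continuous_on S (\<lambda>t. (x :: 'a \<Rightarrow> 'b::topological_space)(i := t))"
proof (rule continuous_on_coordinatewise_then_product)
  fix j show "continuous_on S (\<lambda>t. (x(i := t)) j)"
    by (cases "j = i") auto
qed

text \<open>\<open>Euclidean_space N\<close> constrains only the coordinates from \<open>N\<close>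
  on, so a small change of a coordinate \<open>i < N\<close> cannot leave an open set. This makes
  partial derivatives local.\<close>

lemma eventually_fun_upd_mem:
  assumes "openin (Euclidean_space N) U" "x \<in> U" "i < N"
  shows "\<forall>\<^sub>F t in nhds (x i). x(i := t) \<in> U"
proof -
  obtain T where T: "open T" "U = {x. \<forall>i\<ge>N. x i = 0} \<inter> T"
    using assms(1) by (auto simp: Euclidean_space_eq_top_of_set openin_open)
  have "open ((\<lambda>t. x(i := t)) -` T)"
    by (rule open_vimage[OF T(1) continuous_on_fun_upd_const])
  moreover have "x i \<in> (\<lambda>t. x(i := t)) -` T"
    using assms(2) T by simp
  moreover have "x(i := t) \<in> U" if "t \<in> (\<lambda>t. x(i := t)) -` T" for t
    using that assms(2,3) T(2) by auto
  ultimately show ?thesis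
    unfolding eventually_nhds by blast
qed

lemma eventually_fun_upd_eq:
  assumes "openin (Euclidean_space N) U" "\<And>x. x \<in> U \<Longrightarrow> f x = g x" "x \<in> U" "i < N"
  shows "\<forall>\<^sub>F t in nhds (x i). f (x(i := t)) = g (x(i := t))"
  using eventually_fun_upd_mem[OF assms(1,3,4)] by eventually_elim (simp add: assms(2))

lemma partial_deriv_cong:
  assumes "openin (Euclidean_space N) U" "\<And>x. x \<in> U \<Longrightarrow> f x = g x" "x \<in> U" "i < N"
  shows "partial_deriv i f x = partial_deriv i g x"
  unfolding partial_deriv_def by (rule deriv_cong_ev[OF eventually_fun_upd_eq[OF assms] refl])

text \<open>Derivatives at a point of an open set see only nearby values. Sections are extended by 0
  outside their domain, so they usually agree with a smooth formula on \<open>U\<close>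
  only.\<close>

lemma C_k_on_cong_aux:
  assumes "openin (Euclidean_space N) U" "\<And>x. x \<in> U \<Longrightarrow> f x = g x" "C_k_on N r U f"
  shows "C_k_on N r U g"
  using assms(2,3)
proof (induction r arbitrary: f g)
  case 0
  then show ?case
    by (auto simp: subtopology_Euclidean_space_openin[OF assms(1)] cong: continuous_on_cong)
next
  case (Suc r)
  have "(\<lambda>t. g (x(i := t))) field_differentiable at (x i)" if x: "x \<in> U" "i < N" for x i
  proof -
    obtain D where "((\<lambda>t. f (x(i := t))) has_field_derivative D) (at (x i))"
      using Suc.prems(2) x unfolding C_k_on.simps field_differentiable_def by blast
    then have "((\<lambda>t. g (x(i := t))) has_field_derivative D) (at (x i))"
      using DERIV_cong_ev[OF refl eventually_fun_upd_eq[OF assms(1) _ x, of f g] refl] Suc.prems(1) by blast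
    then show ?thesis
      unfolding field_differentiable_def by blast
  qed
  moreover have "C_k_on N r U (partial_deriv i g)" if "i < N" for i
    using Suc.IH[of "partial_deriv i f" "partial_deriv i g"] Suc.prems(2)
      partial_deriv_cong[OF assms(1) Suc.prems(1) _ that] that by simp
  moreover have "continuous_map (subtopology (Euclidean_space N) U) euclideanreal g"
    using Suc.prems by (auto simp: subtopology_Euclidean_space_openin[OF assms(1)] cong: continuous_on_cong)
  ultimately show ?case
    by simp
qed

text \<open>The candidates \<open>D i\<close> have to be derivatives at points of \<open>U\<close>
  only. The closure proofs below name them explicitly instead of computing
  \<open>partial_deriv\<close> of a compound function.\<close>

lemma C_k_on_SucI:
  assumes "openin (Euclidean_space N) U" "continuous_on U f"
    and "\<And>i x. i < N \<Longrightarrow> x \<in> U \<Longrightarrow> ((\<lambda>t. f (x(i := t))) has_field_derivative D i x) (at (x i))"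
    and "\<And>i. i < N \<Longrightarrow> C_k_on N r U (D i)"
  shows "C_k_on N (Suc r) U f"
proof -
  have "partial_deriv i f x = D i x" if "i < N" "x \<in> U" for i x
    unfolding partial_deriv_def by (rule DERIV_imp_deriv[OF assms(3)[OF that]])
  then have "C_k_on N r U (partial_deriv i f)" if "i < N" for i
    using C_k_on_cong_aux[OF assms(1) _ assms(4)[OF that]] that by simp
  then show ?thesis
    using assms(2,3) by (auto simp: subtopology_Euclidean_space_openin[OF assms(1)] field_differentiable_def)
qed

lemma C_k_on_Suc_deriv:
  assumes "C_k_on N (Suc r) U f" "i < N" "x \<in> U"
  shows "((\<lambda>t. f (x(i := t))) has_field_derivative partial_deriv i f x) (at (x i))"
  using assms by (auto simp: partial_deriv_def field_differentiable_derivI)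

lemma C_k_on_Suc_partial: "C_k_on N (Suc r) U f \<Longrightarrow> i < N \<Longrightarrow> C_k_on N r U (partial_deriv i f)"
  by simp

lemma C_k_on_continuous_on:
  assumes "openin (Euclidean_space N) U" "C_k_on N r U f"
  shows "continuous_on U f"
  using assms(2) by (cases r) (auto simp: subtopology_Euclidean_space_openin[OF assms(1)])

lemma C_k_on_0I: "openin (Euclidean_space N) U \<Longrightarrow> continuous_on U f \<Longrightarrow> C_k_on N 0 U f"
  by (simp add: subtopology_Euclidean_space_openin)

lemma C_k_on_lower: "C_k_on N (Suc r) U f \<Longrightarrow> C_k_on N r U f"
proof (induction r arbitrary: f)
  case (Suc r)
  have "C_k_on N r U (partial_deriv i f)" if "i < N" for i
    using Suc.IH Suc.prems that by (metis C_k_on.simps(2))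
  then show ?case
    using Suc.prems by simp
qed auto

lemma C_k_on_subset:
  assumes "V \<subseteq> U" "C_k_on N r U f"
  shows "C_k_on N r V f"
  using assms(2)
proof (induction r arbitrary: f)
  case 0
  then show ?case
    using assms(1) by (auto intro: continuous_map_from_subtopology_mono)
next
  case (Suc r)
  then show ?case
    using assms(1) by (auto intro: continuous_map_from_subtopology_mono)
qed

declare C_k_on.simps [simp del]

context
  fixes N :: nat and U :: "(nat \<Rightarrow> real) set"
  assumes U: "openin (Euclidean_space N) U"
begin

lemma C_k_on_const: "C_k_on N r U (\<lambda>x. c)"
proof (induction r arbitrary: c)
  case (Suc r)
  show ?case
    by (rule C_k_on_SucI[OF U, where D = "\<lambda>i x. 0"]) (auto intro: Suc)
qed (rule C_k_on_0I[OF U], simp)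

lemma C_k_on_coord: "C_k_on N r U (\<lambda>x. x j)"
proof (cases r)
  case 0
  then show ?thesis
    by (auto intro!: C_k_on_0I[OF U] continuous_on_subset[OF continuous_on_product_coordinates])
next
  case (Suc s)
  show ?thesis
    unfolding Suc
    by (rule C_k_on_SucI[OF U, where D = "\<lambda>i x. if i = j then 1 else 0"])
       (auto intro: C_k_on_const continuous_on_subset[OF continuous_on_product_coordinates])
qed

lemma C_k_on_add: "C_k_on N r U f \<Longrightarrow> C_k_on N r U g \<Longrightarrow> C_k_on N r U (\<lambda>x. f x + g x)"
proof (induction r arbitrary: f g)
  case 0
  then show ?case
    by (intro C_k_on_0I[OF U] continuous_on_add) (auto dest: C_k_on_continuous_on[OF U])
next
  case (Suc r)
  show ?case
  proof (rule C_k_on_SucI[OF U, where D = "\<lambda>i x. partial_deriv i f x + partial_deriv i g x"])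
    show "continuous_on U (\<lambda>x. f x + g x)"
      using Suc.prems by (intro continuous_on_add) (auto dest: C_k_on_continuous_on[OF U])
  next
    fix i x assume "i < N" "x \<in> U"
    then show "((\<lambda>t. f (x(i := t)) + g (x(i := t))) has_field_derivative
        partial_deriv i f x + partial_deriv i g x) (at (x i))"
      using Suc.prems by (intro DERIV_add C_k_on_Suc_deriv)
  next
    fix i assume "i < N"
    then show "C_k_on N r U (\<lambda>x. partial_deriv i f x + partial_deriv i g x)"
      using Suc.prems by (intro Suc.IH C_k_on_Suc_partial)
  qed
qed

lemma C_k_on_mult: "C_k_on N r U f \<Longrightarrow> C_k_on N r U g \<Longrightarrow> C_k_on N r U (\<lambda>x. f x * g x)"
proof (induction r arbitrary: f g)
  case 0
  then show ?case
    by (intro C_k_on_0I[OF U] continuous_on_mult) (auto dest: C_k_on_continuous_on[OF U])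
next
  case (Suc r)
  show ?case
  proof (rule C_k_on_SucI[OF U, where D = "\<lambda>i x. partial_deriv i f x * g x + partial_deriv i g x * f x"])
    show "continuous_on U (\<lambda>x. f x * g x)"
      using Suc.prems by (intro continuous_on_mult) (auto dest: C_k_on_continuous_on[OF U])
  next
    fix i x assume ix: "i < N" "x \<in> U"
    show "((\<lambda>t. f (x(i := t)) * g (x(i := t))) has_field_derivative
        partial_deriv i f x * g x + partial_deriv i g x * f x) (at (x i))"
      using DERIV_mult[OF C_k_on_Suc_deriv[OF Suc.prems(1) ix] C_k_on_Suc_deriv[OF Suc.prems(2) ix]]
      by (simp only: fun_upd_triv)
  next
    fix i assume "i < N"
    then show "C_k_on N r U (\<lambda>x. partial_deriv i f x * g x + partial_deriv i g x * f x)"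
      using Suc.prems by (intro C_k_on_add Suc.IH C_k_on_Suc_partial C_k_on_lower[of N r])
  qed
qed

lemma C_k_on_inverse:
  assumes "\<And>x. x \<in> U \<Longrightarrow> f x \<noteq> 0"
  shows "C_k_on N r U f \<Longrightarrow> C_k_on N r U (\<lambda>x. inverse (f x))"
proof (induction r)
  case 0
  then show ?case
    using assms by (intro C_k_on_0I[OF U] continuous_on_inverse) (auto dest: C_k_on_continuous_on[OF U])
next
  case (Suc r)
  \<comment> \<open>The derivative is written with \<open>inverse (f x)\<close> itself, so the
    induction hypothesis at order \<open>r\<close> covers both of these factors.\<close>
  show ?case
  proof (rule C_k_on_SucI[OF U, where
        D = "\<lambda>i x. (- 1) * (inverse (f x) * partial_deriv i f x * inverse (f x))"])
    show "continuous_on U (\<lambda>x. inverse (f x))"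
      using Suc.prems assms by (intro continuous_on_inverse) (auto dest: C_k_on_continuous_on[OF U])
  next
    fix i x assume "i < N" "x \<in> U"
    then show "((\<lambda>t. inverse (f (x(i := t)))) has_field_derivative
        (- 1) * (inverse (f x) * partial_deriv i f x * inverse (f x))) (at (x i))"
      using DERIV_inverse'[OF C_k_on_Suc_deriv[OF Suc.prems]] assms by (simp add: fun_upd_def)
  next
    fix i assume "i < N"
    then show "C_k_on N r U (\<lambda>x. (- 1) * (inverse (f x) * partial_deriv i f x * inverse (f x)))"
      using Suc.prems
      by (intro C_k_on_mult C_k_on_const Suc.IH C_k_on_Suc_partial C_k_on_lower[of N r])
  qed
qed

lemma smooth_on_cong: "(\<And>x. x \<in> U \<Longrightarrow> f x = g x) \<Longrightarrow> smooth_on N U f \<longleftrightarrow> smooth_on N U g"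
  using C_k_on_cong_aux[OF U] unfolding smooth_on_def by metis

lemma smooth_on_const [intro, simp]: "smooth_on N U (\<lambda>x. c)"
  by (simp add: smooth_on_def C_k_on_const)

lemma smooth_on_coord: "smooth_on N U (\<lambda>x. x j)"
  by (simp add: smooth_on_def C_k_on_coord)

lemma smooth_on_add: "smooth_on N U f \<Longrightarrow> smooth_on N U g \<Longrightarrow> smooth_on N U (\<lambda>x. f x + g x)"
  by (simp add: smooth_on_def C_k_on_add)

lemma smooth_on_mult: "smooth_on N U f \<Longrightarrow> smooth_on N U g \<Longrightarrow> smooth_on N U (\<lambda>x. f x * g x)"
  by (simp add: smooth_on_def C_k_on_mult)

lemma smooth_on_diff: "smooth_on N U f \<Longrightarrow> smooth_on N U g \<Longrightarrow> smooth_on N U (\<lambda>x. f x - g x)"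
  using smooth_on_add[of f "\<lambda>x. (- 1) * g x"] smooth_on_mult[of "\<lambda>x. - 1" g] by simp

lemma smooth_on_inverse:
  "smooth_on N U f \<Longrightarrow> (\<And>x. x \<in> U \<Longrightarrow> f x \<noteq> 0) \<Longrightarrow> smooth_on N U (\<lambda>x. inverse (f x))"
  by (simp add: smooth_on_def C_k_on_inverse)

lemma smooth_on_sum: "(\<And>a. a \<in> A \<Longrightarrow> smooth_on N U (f a)) \<Longrightarrow> smooth_on N U (\<lambda>x. \<Sum>a\<in>A. f a x)"
  by (induction A rule: infinite_finite_induct) (auto intro: smooth_on_add)

lemma smooth_on_continuous_on: "smooth_on N U f \<Longrightarrow> continuous_on U f"
  using C_k_on_continuous_on[OF U] unfolding smooth_on_def by blast

lemma smooth_on_partial_deriv: "smooth_on N U f \<Longrightarrow> i < N \<Longrightarrow> smooth_on N U (partial_deriv i f)"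
  unfolding smooth_on_def using C_k_on_Suc_partial by blast

lemma smooth_on_has_partial_deriv:
  "smooth_on N U f \<Longrightarrow> i < N \<Longrightarrow> x \<in> U \<Longrightarrow>
    ((\<lambda>t. f (x(i := t))) has_field_derivative partial_deriv i f x) (at (x i))"
  unfolding smooth_on_def using C_k_on_Suc_deriv by blast

text \<open>Differentiation under the integral sign. A partial derivative in \<open>x i\<close>
  brings out a factor \<open>a t i\<close>, which the weight \<open>w\<close> absorbs; so this
  family of integrals is closed under differentiation and the induction on the order goes through.
  The scaling depends on the coordinate, so that single coordinates can be frozen at
  \<open>c\<close>.\<close>

lemma smooth_on_integral_scaled:
  fixes a :: "real \<Rightarrow> nat \<Rightarrow> real" and w :: "real \<Rightarrow> real" and c :: "nat \<Rightarrow> real"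
  assumes a: "\<And>j. continuous_on {0..1} (\<lambda>t. a t j)" and w: "continuous_on {0..1} w"
    and star: "\<And>t x. 0 \<le> t \<Longrightarrow> t \<le> 1 \<Longrightarrow> x \<in> U \<Longrightarrow> (\<lambda>j. c j + a t j * (x j - c j)) \<in> U"
    and h: "smooth_on N U h"
  shows "smooth_on N U (\<lambda>x. integral {0..1} (\<lambda>t. w t * h (\<lambda>j. c j + a t j * (x j - c j))))"
proof -
  have cont: "continuous_on (U \<times> {0..1}) (\<lambda>(x, t). w t * h (\<lambda>j. c j + a t j * (x j - c j)))"
    if w: "continuous_on {0..1} w" and h: "continuous_on U h" for w :: "real \<Rightarrow> real" and h
  proof -
    have "continuous_on (U \<times> {0..1}) (\<lambda>z. (\<lambda>j. c j + a (snd z) j * (fst z j - c j)))"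
    proof (rule continuous_on_coordinatewise_then_product)
      fix j
      show "continuous_on (U \<times> {0..1}) (\<lambda>z. c j + a (snd z) j * (fst z j - c j))"
        by (intro continuous_intros continuous_on_compose2[OF a]
              continuous_on_product_then_coordinatewise) auto
    qed
    then have "continuous_on (U \<times> {0..1}) (\<lambda>z. h (\<lambda>j. c j + a (snd z) j * (fst z j - c j)))"
      by (rule continuous_on_compose2[OF h]) (auto intro: star)
    then show ?thesis
      unfolding case_prod_beta
      by (intro continuous_intros continuous_on_compose2[OF w]) auto
  qed
  have contI: "continuous_on U (\<lambda>x. integral {0..1} (\<lambda>t. w t * h (\<lambda>j. c j + a t j * (x j - c j))))"
    if "continuous_on {0..1} w" and "continuous_on U h" for w :: "real \<Rightarrow> real" and h
    using integral_continuous_on_param[of U 0 "1::real"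
        "\<lambda>x t. w t * h (\<lambda>j. c j + a t j * (x j - c j))"] cont[OF that] by simp
  have "C_k_on N r U (\<lambda>x. integral {0..1} (\<lambda>t. w t * h (\<lambda>j. c j + a t j * (x j - c j))))" for r
    using w h
  proof (induction r arbitrary: w h)
    case 0
    then show ?case
      by (intro C_k_on_0I[OF U] contI smooth_on_continuous_on)
  next
    case (Suc r)
    show ?case
    proof (rule C_k_on_SucI[OF U contI, where D = "\<lambda>i x. integral {0..1}
        (\<lambda>t. w t * a t i * partial_deriv i h (\<lambda>j. c j + a t j * (x j - c j)))"])
      fix i assume i: "i < N"
      have wa: "continuous_on {0..1} (\<lambda>t. w t * a t i)"
        by (intro continuous_intros a Suc.prems)
      have h': "smooth_on N U (partial_deriv i h)"
        by (rule smooth_on_partial_deriv[OF Suc.prems(2) i])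
      show "C_k_on N r U (\<lambda>x. integral {0..1}
          (\<lambda>t. w t * a t i * partial_deriv i h (\<lambda>j. c j + a t j * (x j - c j))))"
        by (rule Suc.IH[OF wa h'])
      fix x assume x: "x \<in> U"
      \<comment> \<open>The Leibniz rule is applied over a convex set of parameters, here an
        interval on which \<open>x(i := u)\<close> stays in \<open>U\<close>.\<close>
      obtain e where e: "e > 0" "\<And>u. u \<in> ball (x i) e \<Longrightarrow> x(i := u) \<in> U"
        using eventually_fun_upd_mem[OF U x i] by (auto simp: eventually_nhds_metric dist_commute)
      have upd: "continuous_on (ball (x i) e \<times> {0..1}) (\<lambda>z. (x(i := fst z), snd z))"
        by (intro continuous_on_Pair continuous_on_compose2[OF continuous_on_fun_upd_const]
              continuous_intros) auto
      have "((\<lambda>u. integral (cbox 0 1) (\<lambda>t. w t * h (\<lambda>j. c j + a t j * ((x(i := u)) j - c j))))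
          has_field_derivative
          integral (cbox 0 1) (\<lambda>t. w t * a t i * partial_deriv i h (\<lambda>j. c j + a t j * ((x(i := x i)) j - c j))))
          (at (x i) within ball (x i) e)"
      proof (rule leibniz_rule_field_derivative)
        fix u t :: real assume u: "u \<in> ball (x i) e" and t: "t \<in> cbox 0 1"
        define y where "y = (\<lambda>j. c j + a t j * ((x(i := u)) j - c j))"
        have y: "y \<in> U"
          unfolding y_def using star[OF _ _ e(2)[OF u], of t] t by simp
        \<comment> \<open>Moving \<open>x i\<close> moves only the coordinate \<open>i\<close> of
          \<open>y\<close>, at speed \<open>a t i\<close>, so the chain rule in one variable
          suffices.\<close>
        have upd_y: "(\<lambda>j. c j + a t j * ((x(i := v)) j - c j)) = y(i := c i + a t i * (v - c i))" for v
          by (auto simp: fun_eq_iff y_def)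
        have y_i: "y i = c i + a t i * (u - c i)"
          by (simp add: y_def)
        have "((\<lambda>v. c i + a t i * (v - c i)) has_field_derivative a t i) (at u)"
          by (auto intro!: derivative_eq_intros)
        moreover have "((\<lambda>s. h (y(i := s))) has_field_derivative partial_deriv i h y)
            (at (c i + a t i * (u - c i)))"
          using smooth_on_has_partial_deriv[OF Suc.prems(2) i y] by (simp only: y_i)
        ultimately have "((\<lambda>v. h (y(i := c i + a t i * (v - c i)))) has_field_derivative
            partial_deriv i h y * a t i) (at u)"
          by (rule DERIV_chain2[rotated])
        then have "((\<lambda>v. w t * h (\<lambda>j. c j + a t j * ((x(i := v)) j - c j))) has_field_derivative
            w t * a t i * partial_deriv i h y) (at u)"
          unfolding upd_y by (auto intro!: derivative_eq_intros)
        then show "((\<lambda>v. w t * h (\<lambda>j. c j + a t j * ((x(i := v)) j - c j))) has_field_derivative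
            w t * a t i * partial_deriv i h (\<lambda>j. c j + a t j * ((x(i := u)) j - c j)))
            (at u within ball (x i) e)"
          unfolding y_def by (rule has_field_derivative_at_within)
      next
        fix u assume u: "u \<in> ball (x i) e"
        have "continuous_on {0..1} (\<lambda>t. (\<lambda>(x, t). w t * h (\<lambda>j. c j + a t j * (x j - c j))) (x(i := u), t))"
          by (rule continuous_on_compose2[OF cont[OF Suc.prems(1) smooth_on_continuous_on[OF Suc.prems(2)]]])
             (use e(2)[OF u] in \<open>auto intro!: continuous_intros\<close>)
        then show "(\<lambda>t. w t * h (\<lambda>j. c j + a t j * ((x(i := u)) j - c j))) integrable_on cbox 0 1"
          by (intro integrable_continuous) simp
      next
        show "continuous_on (ball (x i) e \<times> cbox 0 1)
            (\<lambda>(u, t). w t * a t i * partial_deriv i h (\<lambda>j. c j + a t j * ((x(i := u)) j - c j)))"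
        proof -
          have "(\<lambda>z. (x(i := fst z), snd z)) ` (ball (x i) e \<times> {0..1}) \<subseteq> U \<times> {0..1}"
            using e(2) by auto
          then show ?thesis
            using continuous_on_compose2[OF cont[OF wa smooth_on_continuous_on[OF h']] upd]
            by (simp add: case_prod_beta)
        qed
      qed (use e in auto)
      then show "((\<lambda>u. integral {0..1} (\<lambda>t. w t * h (\<lambda>j. c j + a t j * ((x(i := u)) j - c j))))
          has_field_derivative
          integral {0..1} (\<lambda>t. w t * a t i * partial_deriv i h (\<lambda>j. c j + a t j * (x j - c j)))) (at (x i))"
        using e(1) by (simp add: at_within_ball)
    qed (use Suc.prems smooth_on_continuous_on in auto)
  qed
  then show ?thesis
    by (simp add: smooth_on_def)
qed

end

lemma smooth_on_subset: "V \<subseteq> U \<Longrightarrow> smooth_on N U f \<Longrightarrow> smooth_on N V f"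
  unfolding smooth_on_def using C_k_on_subset by blast

section \<open>Cubes and Hadamard's lemma\<close>

definition cube :: "nat \<Rightarrow> (nat \<Rightarrow> real) \<Rightarrow> real \<Rightarrow> (nat \<Rightarrow> real) set" where
  "cube N c e = {x. (\<forall>i<N. \<bar>x i - c i\<bar> < e) \<and> (\<forall>i\<ge>N. x i = 0)}"

lemma openin_cube: "openin (Euclidean_space N) (cube N c e)"
proof -
  have "open {x :: nat \<Rightarrow> real. \<forall>i\<in>{..<N}. x i \<in> ball (c i) e}"
    by (rule product_topology_basis') auto
  moreover have "cube N c e = {x. \<forall>i\<ge>N. x i = 0} \<inter> {x. \<forall>i\<in>{..<N}. x i \<in> ball (c i) e}"
    by (auto simp: cube_def dist_real_def abs_minus_commute)
  ultimately show ?thesis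
    unfolding Euclidean_space_eq_top_of_set openin_open by blast
qed

lemma cube_subset_openin:
  assumes "openin (Euclidean_space N) W" "c \<in> W"
  obtains e where "e > 0" "cube N c e \<subseteq> W"
proof -
  obtain T where T: "open T" "W = {x. \<forall>i\<ge>N. x i = 0} \<inter> T"
    using assms(1) by (auto simp: Euclidean_space_eq_top_of_set openin_open)
  have "openin (product_topology (\<lambda>i. euclidean) UNIV) T"
    using T(1) by (simp add: euclidean_product_topology)
  then have "\<forall>x\<in>T. \<exists>X. finite {i. X i \<noteq> UNIV} \<and> (\<forall>i. open (X i)) \<and> x \<in> Pi\<^sub>E UNIV X \<and> Pi\<^sub>E UNIV X \<subseteq> T"
    by (simp add: openin_product_topology_alt)
  moreover have "c \<in> T"
    using assms(2) T(2) by simp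
  ultimately obtain X where X: "\<And>i. open (X i)" "c \<in> Pi\<^sub>E UNIV X" "Pi\<^sub>E UNIV X \<subseteq> T"
    by blast
  have "\<exists>d>0. ball (c i) d \<subseteq> X i" for i
    using X(1)[of i] X(2) by (auto simp: open_contains_ball)
  then obtain d where d: "\<And>i. d i > 0" "\<And>i. ball (c i) (d i) \<subseteq> X i"
    by metis
  define e where "e = Min (insert 1 (d ` {..<N}))"
  have "e > 0"
    using d(1) by (simp add: e_def)
  moreover have "cube N c e \<subseteq> W"
  proof
    fix x assume x: "x \<in> cube N c e"
    have "x i \<in> X i" for i
    proof (cases "i < N")
      case True
      then have "e \<le> d i"
        by (simp add: e_def)
      then show ?thesis
        using x d(2)[of i] True by (force simp: cube_def dist_real_def abs_minus_commute)
    next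
      case False
      then have "x i = c i"
        using x openin_Euclidean_space_zero[OF assms] by (auto simp: cube_def)
      then show ?thesis
        using X(2) by auto
    qed
    then show "x \<in> W"
      using x X(3) T(2) by (auto simp: cube_def)
  qed
  ultimately show ?thesis
    using that by blast
qed

text \<open>Each coordinate may approach the centre at its own rate; this independence is what the
  telescoping over coordinates in Hadamard's lemma uses.\<close>

lemma cube_scale:
  assumes "x \<in> cube N c e" "c \<in> cube N c e" "\<And>j. 0 \<le> a j \<and> a j \<le> 1"
  shows "(\<lambda>j. c j + a j * (x j - c j)) \<in> cube N c e"
proof -
  have "\<bar>a j * (x j - c j)\<bar> \<le> \<bar>x j - c j\<bar>" for j
    using assms(3)[of j] by (simp add: abs_mult mult_left_le_one_le)
  then show ?thesis
    using assms(1,2) by (auto simp: cube_def intro: le_less_trans)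
qed

text \<open>The difference \<open>f x - f c\<close> is telescoped along a path moving one coordinate
  at a time, so every step is the fundamental theorem of calculus in one variable; a straight
  segment would call for the chain rule in several variables. The quotients \<open>g i\<close> are
  smooth because they are integrals of the form treated above.\<close>

lemma Hadamard_lemma:
  assumes c: "c \<in> cube N c e" and f: "smooth_on N (cube N c e) f"
  obtains g where "\<And>i. i < N \<Longrightarrow> smooth_on N (cube N c e) (g i)"
    and "\<And>x. x \<in> cube N c e \<Longrightarrow> f x = f c + (\<Sum>i<N. (x i - c i) * g i x)"
proof -
  let ?B = "cube N c e"
  define F where "F i = (\<lambda>x. f (\<lambda>j. if j < i then c j else x j))" for i :: nat
  \<comment> \<open>Freezing the first \<open>i\<close> coordinates is the case of an integrand
    constant in \<open>t\<close> with scaling factors 0 and 1, so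
    \<open>smooth_on_integral_scaled\<close> replaces a rule for compositions.\<close>
  have smF: "smooth_on N ?B (F i)" for i
  proof -
    let ?a = "\<lambda>t j. if j < i then 0 else 1 :: real"
    have "smooth_on N ?B (\<lambda>x. integral {0..1} (\<lambda>t::real. 1 * f (\<lambda>j. c j + ?a t j * (x j - c j))))"
      by (rule smooth_on_integral_scaled[OF openin_cube _ _ _ f]) (auto intro: cube_scale[OF _ c])
    moreover have "(\<lambda>j. c j + ?a t j * (x j - c j)) = (\<lambda>j. if j < i then c j else x j)" for x t
      by auto
    ultimately show ?thesis
      by (simp add: F_def)
  qed
  \<comment> \<open>\<open>s i t x\<close> moves the coordinate \<open>i\<close> from
    \<open>c i\<close> to \<open>x i\<close>. As \<open>F i\<close> ignores the coordinates below
    \<open>i\<close>, its value at \<open>t = 0\<close> is \<open>F (Suc i) x\<close>, which makes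
    the steps telescope.\<close>
  define s where "s i t x = (\<lambda>j. c j + (if j = i then t else 1) * (x j - c j))" for i :: nat and t and x :: "nat \<Rightarrow> real"
  define g where "g i x = integral {0..1} (\<lambda>t. 1 * partial_deriv i (F i) (s i t x))" for i x
  have "smooth_on N ?B (g i)" if "i < N" for i
    unfolding g_def s_def
  proof (rule smooth_on_integral_scaled[OF openin_cube _ _ _ smooth_on_partial_deriv[OF openin_cube smF that]])
    show "continuous_on {0..1} (\<lambda>t::real. if j = i then t else 1)" for j
      by (cases "j = i") auto
  qed (auto intro: cube_scale[OF _ c])
  moreover have "f x = f c + (\<Sum>i<N. (x i - c i) * g i x)" if x: "x \<in> ?B" for x
  proof -
    have step: "F i x - F (Suc i) x = (x i - c i) * g i x" if i: "i < N" for i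
    proof -
      have "((\<lambda>t. partial_deriv i (F i) (s i t x) * (x i - c i)) has_integral
          F i (s i 1 x) - F i (s i 0 x)) {0..1}"
      proof (rule fundamental_theorem_of_calculus)
        fix t :: real assume t: "t \<in> {0..1}"
        have y: "s i t x \<in> ?B"
          unfolding s_def using t by (intro cube_scale[OF x c]) auto
        have upd: "s i u x = (s i t x)(i := c i + u * (x i - c i))" for u
          by (auto simp: s_def fun_eq_iff)
        have "((\<lambda>u. c i + u * (x i - c i)) has_field_derivative (x i - c i)) (at t)"
          by (auto intro!: derivative_eq_intros)
        then have "((\<lambda>u. F i ((s i t x)(i := c i + u * (x i - c i)))) has_field_derivative
            partial_deriv i (F i) (s i t x) * (x i - c i)) (at t)"
          using DERIV_chain2[of "\<lambda>v. F i ((s i t x)(i := v))" _ "\<lambda>u. c i + u * (x i - c i)" t "x i - c i" UNIV]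
            smooth_on_has_partial_deriv[OF openin_cube smF i y] by (simp add: s_def)
        then have "((\<lambda>u. F i (s i u x)) has_field_derivative
            partial_deriv i (F i) (s i t x) * (x i - c i)) (at t)"
          by (simp flip: upd)
        then show "((\<lambda>u. F i (s i u x)) has_vector_derivative
            partial_deriv i (F i) (s i t x) * (x i - c i)) (at t within {0..1})"
          by (simp add: has_real_derivative_iff_has_vector_derivative has_vector_derivative_at_within)
      qed simp
      moreover have "F i (s i 1 x) = F i x"
        by (simp add: s_def)
      moreover have "F i (s i 0 x) = F (Suc i) x"
        unfolding F_def s_def by (rule arg_cong[of _ _ f]) (auto simp: fun_eq_iff less_Suc_eq)
      ultimately have "integral {0..1} (\<lambda>t. partial_deriv i (F i) (s i t x) * (x i - c i)) = F i x - F (Suc i) x"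
        by (simp only: integral_unique)
      then show ?thesis
        by (simp add: g_def mult.commute[of "x i - c i"])
    qed
    have "F 0 x - F N x = (\<Sum>i<N. F i x - F (Suc i) x)"
      by (induction N) auto
    also have "\<dots> = (\<Sum>i<N. (x i - c i) * g i x)"
      by (intro sum.cong) (auto simp: step)
    finally have "F 0 x - F N x = (\<Sum>i<N. (x i - c i) * g i x)" .
    moreover have "F N x = f c"
      unfolding F_def using x c by (intro arg_cong[of _ _ f]) (auto simp: cube_def fun_eq_iff)
    ultimately show ?thesis
      by (simp add: F_def)
  qed
  ultimately show ?thesis
    using that by blast
qed

section \<open>Multi-indices and the Koszul sign\<close>

text \<open>Every \<open>M\<close> is bounded by \<open>L\<close>, hence supported in the finite
  support of \<open>L\<close>, and it determines \<open>N\<close>. A sum over an infinite set is 0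
  by convention, so the products in \<open>sect\<close> have their intended meaning because of
  this.\<close>

lemma finite_antidiagonal: "finite {(M, N). M + N = (L :: 'a \<Rightarrow>\<^sub>0 nat)}"
proof -
  let ?F = "{f. \<forall>a. (a \<in> Poly_Mapping.keys L \<longrightarrow> f a \<in> (\<Union>b\<in>Poly_Mapping.keys L. {..Poly_Mapping.lookup L b})) \<and>
    (a \<notin> Poly_Mapping.keys L \<longrightarrow> f a = 0)}"
  have fin: "finite ?F"
    by (rule finite_set_of_finite_funs) auto
  have mem: "Poly_Mapping.lookup M \<in> ?F" if "M + N = L" for M N
  proof -
    have le: "Poly_Mapping.lookup M a \<le> Poly_Mapping.lookup L a" for a
      using that by (metis le_add1 lookup_add)
    have "Poly_Mapping.lookup M a = 0" if "a \<notin> Poly_Mapping.keys L" for a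
      using le[of a] that by (simp add: in_keys_iff)
    moreover have "Poly_Mapping.lookup M a \<in> (\<Union>b\<in>Poly_Mapping.keys L. {..Poly_Mapping.lookup L b})"
      if "a \<in> Poly_Mapping.keys L" for a
      using le[of a] that by blast
    ultimately show ?thesis
      by simp
  qed
  have "Poly_Mapping.lookup ` {M. \<exists>N. M + N = L} \<subseteq> ?F"
    by (rule image_subsetI, elim CollectE exE) (rule mem)
  then have "finite (Poly_Mapping.lookup ` {M. \<exists>N. M + N = L})"
    using fin by (rule finite_subset)
  then have "finite {M. \<exists>N. M + N = L}"
    by (rule finite_imageD) (simp add: inj_on_def)
  moreover have "{(M, N). M + N = L} \<subseteq> (\<lambda>M. (M, L - M)) ` {M. \<exists>N. M + N = L}"
    by auto
  ultimately show ?thesis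
    by (meson finite_imageI finite_subset)
qed

lemma keys_add_nat: "Poly_Mapping.keys (M + N) = Poly_Mapping.keys M \<union> Poly_Mapping.keys (N :: 'a \<Rightarrow>\<^sub>0 nat)"
  by (auto simp: in_keys_iff lookup_add)

definition total_deg :: "('a \<Rightarrow>\<^sub>0 nat) \<Rightarrow> nat" where
  "total_deg L = (\<Sum>a\<in>Poly_Mapping.keys L. Poly_Mapping.lookup L a)"

lemma total_deg_add: "total_deg (M + N) = total_deg M + total_deg N"
  unfolding total_deg_def by (rule setsum_keys_plus_distrib) auto

lemma total_deg_0: "total_deg 0 = 0"
  by (simp add: total_deg_def)

lemma total_deg_eq_0_iff: "total_deg L = 0 \<longleftrightarrow> L = 0"
  by (auto simp: total_deg_def in_keys_iff poly_mapping_eqI)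

lemma total_deg_summand_less: "M + N = L \<Longrightarrow> M \<noteq> 0 \<Longrightarrow> total_deg N < total_deg L"
  using total_deg_add[of M N] total_deg_eq_0_iff[of M] by auto

lemma bsign_add: "bsign (a + b) = bsign a * bsign b"
  by (cases a; cases b) (auto simp: bsign_def)

lemma bsign_square: "bsign a * bsign a = 1"
  by (simp add: bsign_def)

definition koszul_term :: "nat \<Rightarrow> mindex \<Rightarrow> mindex \<Rightarrow> nat \<times> nat \<Rightarrow> nat \<times> nat \<Rightarrow> bit" where
  "koszul_term n M N a b = (if (b, a) \<in> less_than <*lex*> less_than
     then of_nat (Poly_Mapping.lookup M a * Poly_Mapping.lookup N b) * pairing (gam n (fst a)) (gam n (fst b)) else 0)"

text \<open>The ranges of summation in \<open>koszul\<close> vary with \<open>M\<close>,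
  \<open>N\<close> and the outer index. Extending the summand by 0 to a common rectangle lets the
  exponents of different monomials be compared term by term.\<close>

lemma koszul_eq_superset:
  assumes "finite A" "finite B" "Poly_Mapping.keys M \<subseteq> A" "Poly_Mapping.keys N \<subseteq> B"
  shows "koszul n M N = bsign (\<Sum>a\<in>A. \<Sum>b\<in>B. koszul_term n M N a b)"
proof -
  have "(\<Sum>b | b \<in> Poly_Mapping.keys N \<and> (b, a) \<in> less_than <*lex*> less_than.
      of_nat (Poly_Mapping.lookup M a * Poly_Mapping.lookup N b) * pairing (gam n (fst a)) (gam n (fst b)))
    = (\<Sum>b\<in>B. koszul_term n M N a b)" for a
  proof (rule sum.mono_neutral_cong_left)
    show "\<forall>b\<in>B - {b \<in> Poly_Mapping.keys N. (b, a) \<in> less_than <*lex*> less_than}. koszul_term n M N a b = 0"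
      by (auto simp: koszul_term_def in_keys_iff intro!: gr0I)
  qed (use assms in \<open>auto simp: koszul_term_def\<close>)
  then have "koszul n M N = bsign (\<Sum>a\<in>Poly_Mapping.keys M. \<Sum>b\<in>B. koszul_term n M N a b)"
    by (simp add: koszul_def)
  also have "(\<Sum>a\<in>Poly_Mapping.keys M. \<Sum>b\<in>B. koszul_term n M N a b) = (\<Sum>a\<in>A. \<Sum>b\<in>B. koszul_term n M N a b)"
    by (rule sum.mono_neutral_left) (use assms in \<open>auto simp: koszul_term_def in_keys_iff intro!: sum.neutral\<close>)
  finally show ?thesis .
qed

text \<open>The exponent is biadditive, so the sign is a bicharacter on multi-indices; together with
  \<open>koszul_add_right\<close> this is the property of the sign behind associativity.\<close>

lemma koszul_add_left: "koszul n (M + M') N = koszul n M N * koszul n M' N"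
proof -
  let ?A = "Poly_Mapping.keys (M + M')" and ?B = "Poly_Mapping.keys N"
  have "koszul_term n (M + M') N a b = koszul_term n M N a b + koszul_term n M' N a b" for a b
    unfolding koszul_term_def
    by (cases "(b, a) \<in> less_than <*lex*> less_than")
       (simp_all only: if_True if_False lookup_add distrib_right of_nat_add add_0)
  moreover have "koszul n X N = bsign (\<Sum>a\<in>?A. \<Sum>b\<in>?B. koszul_term n X N a b)"
    if "Poly_Mapping.keys X \<subseteq> ?A" for X
    using that by (intro koszul_eq_superset) auto
  moreover have "Poly_Mapping.keys M \<subseteq> ?A" "Poly_Mapping.keys M' \<subseteq> ?A"
    by (auto simp: keys_add_nat)
  ultimately show ?thesis
    by (simp only: sum.distrib bsign_add subset_refl)
qed

lemma koszul_add_right: "koszul n M (N + N') = koszul n M N * koszul n M N'"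
proof -
  let ?A = "Poly_Mapping.keys M" and ?B = "Poly_Mapping.keys (N + N')"
  have "koszul_term n M (N + N') a b = koszul_term n M N a b + koszul_term n M N' a b" for a b
    unfolding koszul_term_def
    by (cases "(b, a) \<in> less_than <*lex*> less_than")
       (simp_all only: if_True if_False lookup_add distrib_left distrib_right of_nat_add add_0)
  moreover have "koszul n M X = bsign (\<Sum>a\<in>?A. \<Sum>b\<in>?B. koszul_term n M X a b)"
    if "Poly_Mapping.keys X \<subseteq> ?B" for X
    using that by (intro koszul_eq_superset) auto
  moreover have "Poly_Mapping.keys N \<subseteq> ?B" "Poly_Mapping.keys N' \<subseteq> ?B"
    by (auto simp: keys_add_nat)
  ultimately show ?thesis
    by (simp only: sum.distrib bsign_add subset_refl)
qed

lemma koszul_0 [simp]: "koszul n 0 N = 1" "koszul n M 0 = 1"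
  by (simp_all add: koszul_def bsign_def)

lemma koszul_square: "koszul n M N * koszul n M N = 1"
  by (simp add: koszul_def bsign_square)

lemma finite_gens: "finite (gens n \<beta>)"
proof -
  have "gens n \<beta> \<subseteq> (SIGMA l:{..<2 ^ n}. {..<\<beta> l})"
    by (auto simp: gens_def)
  then show ?thesis
    by (rule finite_subset) auto
qed

text \<open>The non-admissible monomials thus span an ideal, and cutting products down to admissible
  multi-indices is harmless: nothing discarded in an inner product could contribute to the outer
  one.\<close>

lemma admissible_add: "admissible n \<beta> (M + N) \<Longrightarrow> admissible n \<beta> M \<and> admissible n \<beta> N"
  unfolding admissible_def keys_add_nat by (auto simp: lookup_add)

lemma admissible_antidiagonal:
  assumes "admissible n \<beta> L" "z \<in> {(M, N). M + N = L}"
  shows "admissible n \<beta> (fst z)" "admissible n \<beta> (snd z)"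
  using assms admissible_add[of n \<beta> "fst z" "snd z"] by (simp_all add: case_prod_beta)

lemma admissible_0 [simp]: "admissible n \<beta> 0"
  by (simp add: admissible_def)

lemma admissible_single: "admissible n \<beta> (Poly_Mapping.single a 1) \<longleftrightarrow> a \<in> gens n \<beta>"
  by (auto simp: admissible_def lookup_single when_def)

section \<open>The ring of sections\<close>

lemma sect_mem_iff:
  "f \<in> carrier (sect n \<beta> U) \<longleftrightarrow> (\<forall>L. admissible n \<beta> L \<longrightarrow> smooth_on (\<beta> 0) U (f L)) \<and>
     (\<forall>L x. \<not> admissible n \<beta> L \<or> x \<notin> U \<longrightarrow> f L x = 0)"
  by (simp add: sect_def)

lemma sect_memI:
  assumes "\<And>L. admissible n \<beta> L \<Longrightarrow> smooth_on (\<beta> 0) U (f L)"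
    and "\<And>L x. \<not> admissible n \<beta> L \<Longrightarrow> f L x = 0" "\<And>L x. x \<notin> U \<Longrightarrow> f L x = 0"
  shows "f \<in> carrier (sect n \<beta> U)"
  using assms by (auto simp: sect_mem_iff)

lemma sect_add: "f \<oplus>\<^bsub>sect n \<beta> U\<^esub> g = (\<lambda>L x. f L x + g L x)"
  by (simp add: sect_def)

lemma sect_zero: "\<zero>\<^bsub>sect n \<beta> U\<^esub> = (\<lambda>L x. 0)"
  by (simp add: sect_def)

lemma sect_one: "\<one>\<^bsub>sect n \<beta> U\<^esub> = (\<lambda>L x. if L = 0 \<and> x \<in> U then 1 else 0)"
  by (simp add: sect_def)

lemma sect_mult: "f \<otimes>\<^bsub>sect n \<beta> U\<^esub> g = (\<lambda>L x. if admissible n \<beta> L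
     then \<Sum>(M, N) | M + N = L. koszul n M N * f M x * g N x else 0)"
  by (simp add: sect_def)

text \<open>The multi-index 0 splits only as 0 + 0, so evaluation at a point is
  multiplicative.\<close>

lemma sect_mult_0: "(f \<otimes>\<^bsub>sect n \<beta> U\<^esub> g) 0 x = f 0 x * g 0 x"
proof -
  have "{(M, N). M + N = (0 :: mindex)} = {(0, 0)}"
    by (auto simp: total_deg_eq_0_iff[symmetric] total_deg_add total_deg_0 dest: arg_cong[of _ _ total_deg])
  then show ?thesis
    by (simp add: sect_mult)
qed

context
  fixes n :: nat and \<beta> :: "nat \<Rightarrow> nat" and U :: "(nat \<Rightarrow> real) set"
  assumes U: "openin (Euclidean_space (\<beta> 0)) U"
begin

lemma sect_add_closed:
  assumes "f \<in> carrier (sect n \<beta> U)" "g \<in> carrier (sect n \<beta> U)"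
  shows "f \<oplus>\<^bsub>sect n \<beta> U\<^esub> g \<in> carrier (sect n \<beta> U)"
  using assms by (auto simp: sect_add sect_mem_iff intro: smooth_on_add[OF U])

lemma sect_mult_closed:
  assumes "f \<in> carrier (sect n \<beta> U)" "g \<in> carrier (sect n \<beta> U)"
  shows "f \<otimes>\<^bsub>sect n \<beta> U\<^esub> g \<in> carrier (sect n \<beta> U)"
proof (rule sect_memI)
  fix L assume L: "admissible n \<beta> L"
  have "smooth_on (\<beta> 0) U (\<lambda>x. \<Sum>z\<in>{(M, N). M + N = L}. koszul n (fst z) (snd z) * f (fst z) x * g (snd z) x)"
    using assms admissible_antidiagonal[OF L]
    by (intro smooth_on_sum[OF U] smooth_on_mult[OF U] smooth_on_const[OF U]) (simp_all add: sect_mem_iff)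
  then show "smooth_on (\<beta> 0) U ((f \<otimes>\<^bsub>sect n \<beta> U\<^esub> g) L)"
    using L by (simp add: sect_mult case_prod_beta)
qed (use assms in \<open>auto simp: sect_mult sect_mem_iff case_prod_beta intro!: sum.neutral\<close>)

lemma sect_scale_closed:
  assumes "f \<in> carrier (sect n \<beta> U)"
  shows "sscale c f \<in> carrier (sect n \<beta> U)"
  using assms by (auto simp: sscale_def sect_mem_iff intro!: smooth_on_mult[OF U] smooth_on_const[OF U])

lemma sect_one_closed: "\<one>\<^bsub>sect n \<beta> U\<^esub> \<in> carrier (sect n \<beta> U)"
proof (rule sect_memI)
  fix L
  show "smooth_on (\<beta> 0) U (\<one>\<^bsub>sect n \<beta> U\<^esub> L)"
    using smooth_on_cong[OF U, of "\<one>\<^bsub>sect n \<beta> U\<^esub> L" "\<lambda>x. if L = 0 then 1 else 0"]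
    by (auto simp: sect_one U)
qed (auto simp: sect_one)

lemma sect_zero_closed: "\<zero>\<^bsub>sect n \<beta> U\<^esub> \<in> carrier (sect n \<beta> U)"
  by (auto simp: sect_zero sect_mem_iff U)

text \<open>Both sides run over the triples of multi-indices with sum \<open>L\<close>. By the
  bicharacter property each triple carries on either side the product of the signs of its three
  ordered pairs.\<close>

lemma sect_mult_assoc:
  "(f \<otimes>\<^bsub>sect n \<beta> U\<^esub> g) \<otimes>\<^bsub>sect n \<beta> U\<^esub> h = f \<otimes>\<^bsub>sect n \<beta> U\<^esub> (g \<otimes>\<^bsub>sect n \<beta> U\<^esub> h)"
proof (intro ext)
  fix L x
  let ?D = "\<lambda>L. {(M, N). M + N = (L :: mindex)}"
  show "((f \<otimes>\<^bsub>sect n \<beta> U\<^esub> g) \<otimes>\<^bsub>sect n \<beta> U\<^esub> h) L x = (f \<otimes>\<^bsub>sect n \<beta> U\<^esub> (g \<otimes>\<^bsub>sect n \<beta> U\<^esub> h)) L x"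
  proof (cases "admissible n \<beta> L")
    case L: True
    have "((f \<otimes>\<^bsub>sect n \<beta> U\<^esub> g) \<otimes>\<^bsub>sect n \<beta> U\<^esub> h) L x
      = (\<Sum>z\<in>?D L. \<Sum>w\<in>?D (fst z). koszul n (fst z) (snd z) *
          (koszul n (fst w) (snd w) * f (fst w) x * g (snd w) x) * h (snd z) x)"
      using L admissible_antidiagonal[OF L]
      by (simp add: sect_mult case_prod_beta sum_distrib_left sum_distrib_right)
    also have "\<dots> = (\<Sum>(z, w)\<in>Sigma (?D L) (\<lambda>z. ?D (fst z)). koszul n (fst z) (snd z) *
          (koszul n (fst w) (snd w) * f (fst w) x * g (snd w) x) * h (snd z) x)"
      by (rule sum.Sigma) (auto intro: finite_antidiagonal)
    also have "\<dots> = (\<Sum>(z, w)\<in>Sigma (?D L) (\<lambda>z. ?D (snd z)). koszul n (fst z) (snd z) *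
          f (fst z) x * (koszul n (fst w) (snd w) * g (fst w) x * h (snd w) x))"
      by (rule sum.reindex_bij_witness[where
            i = "\<lambda>(z, w). ((fst z + fst w, snd w), (fst z, fst w))" and
            j = "\<lambda>(z, w). ((fst w, snd w + snd z), (snd w, snd z))"])
         (auto simp: add.assoc koszul_add_left koszul_add_right)
    also have "\<dots> = (\<Sum>z\<in>?D L. \<Sum>w\<in>?D (snd z). koszul n (fst z) (snd z) *
          f (fst z) x * (koszul n (fst w) (snd w) * g (fst w) x * h (snd w) x))"
      by (rule sum.Sigma[symmetric]) (auto intro: finite_antidiagonal)
    also have "\<dots> = (f \<otimes>\<^bsub>sect n \<beta> U\<^esub> (g \<otimes>\<^bsub>sect n \<beta> U\<^esub> h)) L x"
      using L admissible_antidiagonal[OF L]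
      by (simp add: sect_mult case_prod_beta sum_distrib_left sum_distrib_right)
    finally show ?thesis .
  qed (simp add: sect_mult)
qed

lemma sect_one_mult:
  assumes "f \<in> carrier (sect n \<beta> U)"
  shows "\<one>\<^bsub>sect n \<beta> U\<^esub> \<otimes>\<^bsub>sect n \<beta> U\<^esub> f = f" "f \<otimes>\<^bsub>sect n \<beta> U\<^esub> \<one>\<^bsub>sect n \<beta> U\<^esub> = f"
proof -
  have "(\<Sum>(M, N) | M + N = L. koszul n M N * \<one>\<^bsub>sect n \<beta> U\<^esub> M x * f N x) = f L x" for L x
  proof -
    have "(\<Sum>(M, N) | M + N = L. koszul n M N * \<one>\<^bsub>sect n \<beta> U\<^esub> M x * f N x)
      = (\<Sum>(M, N) \<in> {(0, L)}. koszul n M N * \<one>\<^bsub>sect n \<beta> U\<^esub> M x * f N x)"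
      by (rule sum.mono_neutral_right) (auto simp: sect_one finite_antidiagonal split: if_splits)
    then show ?thesis
      using assms by (auto simp: sect_one sect_mem_iff)
  qed
  then show "\<one>\<^bsub>sect n \<beta> U\<^esub> \<otimes>\<^bsub>sect n \<beta> U\<^esub> f = f"
    using assms by (auto simp: sect_mult sect_mem_iff fun_eq_iff)
  have "(\<Sum>(M, N) | M + N = L. koszul n M N * f M x * \<one>\<^bsub>sect n \<beta> U\<^esub> N x) = f L x" for L x
  proof -
    have "(\<Sum>(M, N) | M + N = L. koszul n M N * f M x * \<one>\<^bsub>sect n \<beta> U\<^esub> N x)
      = (\<Sum>(M, N) \<in> {(L, 0)}. koszul n M N * f M x * \<one>\<^bsub>sect n \<beta> U\<^esub> N x)"
      by (rule sum.mono_neutral_right) (auto simp: sect_one finite_antidiagonal split: if_splits)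
    then show ?thesis
      using assms by (auto simp: sect_one sect_mem_iff)
  qed
  then show "f \<otimes>\<^bsub>sect n \<beta> U\<^esub> \<one>\<^bsub>sect n \<beta> U\<^esub> = f"
    using assms by (auto simp: sect_mult sect_mem_iff fun_eq_iff)
qed

lemma ring_sect: "ring (sect n \<beta> U)"
proof (rule ringI)
  show "abelian_group (sect n \<beta> U)"
  proof (rule abelian_groupI)
    fix f assume f: "f \<in> carrier (sect n \<beta> U)"
    have "sscale (- 1) f \<oplus>\<^bsub>sect n \<beta> U\<^esub> f = \<zero>\<^bsub>sect n \<beta> U\<^esub>"
      by (simp add: sect_add sect_zero sscale_def)
    then show "\<exists>g\<in>carrier (sect n \<beta> U). g \<oplus>\<^bsub>sect n \<beta> U\<^esub> f = \<zero>\<^bsub>sect n \<beta> U\<^esub>"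
      using sect_scale_closed[OF f] by blast
  qed (simp_all add: sect_add_closed sect_zero_closed, simp_all add: sect_add sect_zero add_ac)
  show "monoid (sect n \<beta> U)"
    by (rule monoidI) (simp_all add: sect_mult_closed sect_one_closed sect_mult_assoc sect_one_mult)
qed (auto simp: sect_add sect_mult fun_eq_iff case_prod_beta algebra_simps sum.distrib)

lemma sect_finsum:
  assumes "finite K" "f \<in> K \<rightarrow> carrier (sect n \<beta> U)"
  shows "finsum (sect n \<beta> U) f K = (\<lambda>L x. \<Sum>r\<in>K. f r L x)"
proof -
  interpret ring "sect n \<beta> U"
    by (rule ring_sect)
  show ?thesis
    using assms by (induction K rule: finite_induct) (auto simp: sect_zero sect_add Pi_def)
qed

end

section \<open>Block matrices\<close>

lemma finite_block_ix: "finite (block_ix n k)"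
proof -
  have "block_ix n k \<subseteq> (SIGMA i:{..<2 ^ n}. {..<k i})"
    by (auto simp: block_ix_def)
  then show ?thesis
    by (rule finite_subset) auto
qed

context ring
begin

lemma finsum_swap:
  assumes "finite A" "finite B" "\<And>a b. a \<in> A \<Longrightarrow> b \<in> B \<Longrightarrow> f a b \<in> carrier R"
  shows "(\<Oplus>a\<in>A. \<Oplus>b\<in>B. f a b) = (\<Oplus>b\<in>B. \<Oplus>a\<in>A. f a b)"
  using assms(1,3)
proof (induction A rule: finite_induct)
  case empty
  then show ?case
    by simp
next
  case (insert a A)
  have "(\<Oplus>b\<in>B. \<Oplus>a\<in>insert a A. f a b) = (\<Oplus>b\<in>B. f a b \<oplus> (\<Oplus>a\<in>A. f a b))"
    using insert by (intro finsum_cong') (auto simp: Pi_def)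
  also have "\<dots> = (\<Oplus>b\<in>B. f a b) \<oplus> (\<Oplus>b\<in>B. \<Oplus>a\<in>A. f a b)"
    using insert by (intro finsum_addf) (auto simp: Pi_def)
  finally show ?case
    using insert by (auto simp: Pi_def)
qed

lemma bmult_closed:
  assumes "\<And>r. r \<in> K \<Longrightarrow> A p r \<in> carrier R" "\<And>r. r \<in> K \<Longrightarrow> B r q \<in> carrier R"
  shows "bmult R K A B p q \<in> carrier R"
  using assms by (auto simp: bmult_def)

lemma bmult_assoc:
  assumes "finite K" "finite K'"
    and "\<And>r. r \<in> K \<Longrightarrow> A p r \<in> carrier R"
    and "\<And>r s. r \<in> K \<Longrightarrow> s \<in> K' \<Longrightarrow> B r s \<in> carrier R"
    and "\<And>s. s \<in> K' \<Longrightarrow> C s q \<in> carrier R"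
  shows "bmult R K' (bmult R K A B) C p q = bmult R K A (bmult R K' B C) p q"
proof -
  have "bmult R K' (bmult R K A B) C p q = (\<Oplus>s\<in>K'. \<Oplus>r\<in>K. A p r \<otimes> (B r s \<otimes> C s q))"
    unfolding bmult_def using assms
    by (intro finsum_cong') (auto simp: finsum_ldistr m_assoc Pi_def cong: finsum_cong)
  also have "\<dots> = (\<Oplus>r\<in>K. \<Oplus>s\<in>K'. A p r \<otimes> (B r s \<otimes> C s q))"
    using assms by (intro finsum_swap) auto
  also have "\<dots> = bmult R K A (bmult R K' B C) p q"
    unfolding bmult_def using assms
    by (intro finsum_cong') (auto simp: finsum_rdistr Pi_def cong: finsum_cong)
  finally show ?thesis .
qed

lemma bone_closed [simp]: "bone R p q \<in> carrier R"
  by (simp add: bone_def)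

lemma bmult_one_left:
  assumes "finite K" "p \<in> K" "\<And>r. r \<in> K \<Longrightarrow> B r q \<in> carrier R"
  shows "bmult R K (bone R) B p q = B p q"
proof -
  have "bmult R K (bone R) B p q = (\<Oplus>r\<in>K. if p = r then B r q else \<zero>)"
    unfolding bmult_def bone_def using assms by (intro finsum_cong') auto
  then show ?thesis
    using finsum_singleton[OF assms(2,1)] assms(3) by (simp add: Pi_def)
qed

lemma bmult_one_right:
  assumes "finite K" "q \<in> K" "\<And>r. r \<in> K \<Longrightarrow> A p r \<in> carrier R"
  shows "bmult R K A (bone R) p q = A p q"
proof -
  have "bmult R K A (bone R) p q = (\<Oplus>r\<in>K. if q = r then A p r else \<zero>)"
    unfolding bmult_def bone_def using assms by (intro finsum_cong') auto
  then show ?thesis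
    using finsum_singleton[OF assms(2,1)] assms(3) by (simp add: Pi_def)
qed

lemma bmult_cong:
  assumes "\<And>r. r \<in> K \<Longrightarrow> A p r = A' p r" "\<And>r. r \<in> K \<Longrightarrow> B r q = B' r q"
    and "\<And>r. r \<in> K \<Longrightarrow> A' p r \<in> carrier R" "\<And>r. r \<in> K \<Longrightarrow> B' r q \<in> carrier R"
  shows "bmult R K A B p q = bmult R K A' B' p q"
  unfolding bmult_def using assms by (intro finsum_cong') auto

text \<open>Over a non-commutative ring a right inverse \<open>X\<close> of \<open>A\<close> need
  not be a left inverse. If \<open>X\<close> has a right inverse \<open>Y\<close> as well, then
  \<open>A = A (X Y) = (A X) Y = Y\<close>, and \<open>X Y = 1\<close> reads
  \<open>X A = 1\<close>.\<close>

lemma is_binv_if_right_inverses: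
  assumes K: "finite K"
    and cl: "\<And>p q. p \<in> K \<Longrightarrow> q \<in> K \<Longrightarrow> A p q \<in> carrier R"
      "\<And>p q. p \<in> K \<Longrightarrow> q \<in> K \<Longrightarrow> X p q \<in> carrier R"
      "\<And>p q. p \<in> K \<Longrightarrow> q \<in> K \<Longrightarrow> Y p q \<in> carrier R"
    and AX: "\<And>p q. p \<in> K \<Longrightarrow> q \<in> K \<Longrightarrow> bmult R K A X p q = bone R p q"
    and XY: "\<And>p q. p \<in> K \<Longrightarrow> q \<in> K \<Longrightarrow> bmult R K X Y p q = bone R p q"
  shows "is_binv R K A X"
proof -
  have AY: "A p q = Y p q" if "p \<in> K" "q \<in> K" for p q
  proof -
    have "A p q = bmult R K A (bone R) p q"
      using bmult_one_right[OF K that(2)] cl that by simp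
    also have "\<dots> = bmult R K A (bmult R K X Y) p q"
      by (rule bmult_cong) (use that cl XY in \<open>auto intro: bmult_closed\<close>)
    also have "\<dots> = bmult R K (bmult R K A X) Y p q"
      by (rule bmult_assoc[symmetric]) (use that cl K in auto)
    also have "\<dots> = bmult R K (bone R) Y p q"
      by (rule bmult_cong) (use that cl AX in auto)
    also have "\<dots> = Y p q"
      using bmult_one_left[OF K that(1)] cl that by simp
    finally show ?thesis .
  qed
  have "bmult R K X A p q = bone R p q" if "p \<in> K" "q \<in> K" for p q
    using bmult_cong[of K X p X A q Y] AY XY cl that by simp
  then show ?thesis
    using AX cl by (simp add: is_binv_def)
qed

end

lemma ring_hom_finsum:
  assumes "ring R" "ring S" "h \<in> Ring.ring_hom R S" "finite K" "f \<in> K \<rightarrow> carrier R"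
  shows "h (finsum R f K) = finsum S (\<lambda>r. h (f r)) K"
proof -
  interpret R: ring R
    by (rule assms(1))
  interpret S: ring S
    by (rule assms(2))
  show ?thesis
    using assms(4,5)
  proof (induction K rule: finite_induct)
    case empty
    then show ?case
      using ring_hom_zero[OF assms(3,1,2)] by simp
  next
    case (insert r K)
    then have "h (f r \<oplus>\<^bsub>R\<^esub> finsum R f K) = h (f r) \<oplus>\<^bsub>S\<^esub> h (finsum R f K)"
      by (intro ring_hom_add[OF assms(3)]) auto
    moreover have "(\<lambda>r. h (f r)) \<in> K \<rightarrow> carrier S" "h (f r) \<in> carrier S"
      using insert.prems ring_hom_closed[OF assms(3)] by auto
    ultimately show ?case
      using insert by auto
  qed
qed

lemma ring_hom_bmult:
  assumes "ring R" "ring S" "h \<in> Ring.ring_hom R S" "finite K"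
    and "\<And>r. r \<in> K \<Longrightarrow> A p r \<in> carrier R" "\<And>r. r \<in> K \<Longrightarrow> B r q \<in> carrier R"
  shows "h (bmult R K A B p q) = bmult S K (\<lambda>p q. h (A p q)) (\<lambda>p q. h (B p q)) p q"
proof -
  interpret R: ring R
    by (rule assms(1))
  interpret S: ring S
    by (rule assms(2))
  have "h (bmult R K A B p q) = finsum S (\<lambda>r. h (A p r \<otimes>\<^bsub>R\<^esub> B r q)) K"
    unfolding bmult_def by (rule ring_hom_finsum) (use assms in auto)
  also have "\<dots> = bmult S K (\<lambda>p q. h (A p q)) (\<lambda>p q. h (B p q)) p q"
    unfolding bmult_def
    by (rule S.finsum_cong') (use assms in \<open>auto simp: ring_hom_mult intro!: ring_hom_closed[OF assms(3)]\<close>)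
  finally show ?thesis .
qed

lemma ring_hom_bone:
  assumes "ring R" "ring S" "h \<in> Ring.ring_hom R S"
  shows "h (bone R p q) = bone S p q"
  using ring_hom_zero[OF assms(3,1,2)] ring_hom_one[OF assms(3)] by (simp add: bone_def)

section \<open>Smooth families of matrices\<close>

lemma smooth_on_prod:
  assumes "openin (Euclidean_space N) U" "\<And>a. a \<in> A \<Longrightarrow> smooth_on N U (f a)"
  shows "smooth_on N U (\<lambda>x. \<Prod>a\<in>A. f a x)"
  using assms(2)
  by (induction A rule: infinite_finite_induct) (auto intro: smooth_on_mult[OF assms(1)] smooth_on_const[OF assms(1)])

lemma smooth_on_det:
  assumes "openin (Euclidean_space N) U" "\<And>x. M x \<in> carrier_mat d d"
    and "\<And>i j. i < d \<Longrightarrow> j < d \<Longrightarrow> smooth_on N U (\<lambda>x. M x $$ (i, j))"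
  shows "smooth_on N U (\<lambda>x. Determinant.det (M x))"
proof -
  have "p i < d" if "p permutes {0..<d}" "i < d" for p i
    using permutes_in_image[OF that(1), of i] that(2) by simp
  then show ?thesis
    unfolding det_def'[OF assms(2)]
    by (intro smooth_on_sum[OF assms(1)] smooth_on_mult[OF assms(1)] smooth_on_prod[OF assms(1)]
          smooth_on_const[OF assms(1)] assms(3)) auto
qed

lemma smooth_on_adj_mat:
  assumes U: "openin (Euclidean_space N) U" and M: "\<And>x. M x \<in> carrier_mat d d"
    and sm: "\<And>i j. i < d \<Longrightarrow> j < d \<Longrightarrow> smooth_on N U (\<lambda>x. M x $$ (i, j))"
    and ij: "i < d" "j < d"
  shows "smooth_on N U (\<lambda>x. adj_mat (M x) $$ (i, j))"
proof -
  have dims: "dim_row (M x) = d" "dim_col (M x) = d" for x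
    using M[of x] by auto
  have "smooth_on N U (\<lambda>x. (- 1) ^ (j + i) * Determinant.det (mat_delete (M x) j i))"
  proof (intro smooth_on_mult[OF U] smooth_on_const[OF U] smooth_on_det[OF U, where d = "d - 1"])
    show "mat_delete (M x) j i \<in> carrier_mat (d - 1) (d - 1)" for x
      by (rule mat_delete_carrier[OF M])
    fix a b assume "a < d - 1" "b < d - 1"
    then show "smooth_on N U (\<lambda>x. mat_delete (M x) j i $$ (a, b))"
      by (auto simp: mat_delete_def dims intro!: sm)
  qed
  then show ?thesis
    using ij by (simp add: adj_mat_def cofactor_def dims)
qed

lemma ring_real_ring: "ring real_ring"
proof (rule ringI)
  show "abelian_group real_ring"
  proof (rule abelian_groupI)
    show "\<exists>y\<in>carrier real_ring. y \<oplus>\<^bsub>real_ring\<^esub> x = \<zero>\<^bsub>real_ring\<^esub>" for x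
      by (auto simp: real_ring_def intro: exI[of _ "- x"])
  qed (auto simp: real_ring_def)
qed (auto simp: real_ring_def algebra_simps intro!: monoidI)

lemma finsum_real_ring: "finite K \<Longrightarrow> finsum real_ring f K = sum f K"
proof (induction K rule: finite_induct)
  interpret ring real_ring
    by (rule ring_real_ring)
  show "finsum real_ring f {} = sum f {}"
    by (simp add: real_ring_def[of] del: finsum_empty) (simp add: real_ring_def finsum_empty[unfolded real_ring_def])
  fix r K assume "finite K" "r \<notin> K" "finsum real_ring f K = sum f K"
  then show "finsum real_ring f (insert r K) = sum f (insert r K)"
    by (subst finsum_insert) (auto simp: real_ring_def)
qed

lemma is_binv_real_ring_iff:
  assumes "finite K"
  shows "is_binv real_ring K A X \<longleftrightarrow> (\<forall>p\<in>K. \<forall>q\<in>K.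
    (\<Sum>r\<in>K. A p r * X r q) = (if p = q then 1 else 0) \<and> (\<Sum>r\<in>K. X p r * A r q) = (if p = q then 1 else 0))"
proof -
  have "bmult real_ring K A B p q = (\<Sum>r\<in>K. A p r * B r q)" for A B p q
    using finsum_real_ring[OF assms] by (simp add: bmult_def real_ring_def)
  moreover have "bone real_ring p q = (if p = q then 1 else 0)" for p q :: "nat \<times> nat"
    by (simp add: bone_def real_ring_def)
  moreover have "carrier real_ring = UNIV"
    by (simp add: real_ring_def)
  ultimately show ?thesis
    unfolding is_binv_def by auto
qed

lemma openin_smooth_nonzero:
  assumes U: "openin (Euclidean_space N) U" and f: "smooth_on N U f"
  shows "openin (Euclidean_space N) {x \<in> U. f x \<noteq> 0}"
proof -
  have "openin (top_of_set U) (U \<inter> f -` (- {0}))"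
    using smooth_on_continuous_on[OF U f] by (rule continuous_openin_preimage_gen) auto
  then have "openin (Euclidean_space N) (U \<inter> f -` (- {0}))"
    using openin_trans_full[OF _ U] subtopology_Euclidean_space_openin[OF U] by metis
  moreover have "U \<inter> f -` (- {0}) = {x \<in> U. f x \<noteq> 0}"
    by auto
  ultimately show ?thesis
    by simp
qed

text \<open>Real entries commute, so invertibility is the open condition that the determinant
  \<open>dt x\<close> does not vanish. Cofactors are polynomials in the entries, hence
  \<open>adj x p q * inverse (dt x)\<close> is smooth. The enumeration \<open>e\<close> of
  \<open>K\<close> turns a block matrix into an ordinary square one.\<close>

lemma smooth_invertible_matrices:
  fixes A :: "(nat \<Rightarrow> real) \<Rightarrow> real bmat"
  assumes U: "openin (Euclidean_space N) U" and K: "finite K"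
    and sm: "\<And>p q. p \<in> K \<Longrightarrow> q \<in> K \<Longrightarrow> smooth_on N U (\<lambda>x. A x p q)"
  shows "openin (Euclidean_space N) {x \<in> U. \<exists>X. is_binv real_ring K (A x) X}"
    and "(\<And>x. x \<in> U \<Longrightarrow> \<exists>X. is_binv real_ring K (A x) X) \<Longrightarrow>
      \<exists>B. (\<forall>p\<in>K. \<forall>q\<in>K. smooth_on N U (\<lambda>x. B x p q)) \<and> (\<forall>x\<in>U. is_binv real_ring K (A x) (B x))"
proof -
  let ?d = "card K"
  obtain e where e: "bij_betw e {0..<?d} K"
    using ex_bij_betw_nat_finite[OF K] by blast
  define e' where "e' = the_inv_into {0..<?d} e"
  have e': "e' p < ?d" "e (e' p) = p" if "p \<in> K" for p
    using that bij_betwE[OF bij_betw_the_inv_into[OF e]] f_the_inv_into_f_bij_betw[OF e]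
    by (auto simp: e'_def)
  have ee: "e' (e i) = i" "e i \<in> K" if "i < ?d" for i
    using that e by (auto simp: e'_def bij_betw_def the_inv_into_f_f)
  have inj_e': "e' p = e' q \<longleftrightarrow> p = q" if "p \<in> K" "q \<in> K" for p q
    using e'(2) that by metis
  define M where "M X = mat ?d ?d (\<lambda>(i, j). X (e i) (e j))" for X :: "real bmat"
  have M: "M X \<in> carrier_mat ?d ?d" for X
    by (simp add: M_def)
  have M_index: "M X $$ (e' p, e' q) = X p q" if "p \<in> K" "q \<in> K" for X p q
    using e' that by (simp add: M_def)
  have prod: "(X * Y) $$ (e' p, e' q) = (\<Sum>r\<in>K. X $$ (e' p, e' r) * Y $$ (e' r, e' q))"
    if "X \<in> carrier_mat ?d ?d" "Y \<in> carrier_mat ?d ?d" "p \<in> K" "q \<in> K" for X Y :: "real mat" and p q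
  proof -
    have "(X * Y) $$ (e' p, e' q) = (\<Sum>i\<in>{0..<?d}. X $$ (e' p, i) * Y $$ (i, e' q))"
      using that e'(1) by (simp add: scalar_prod_def)
    also have "\<dots> = (\<Sum>i\<in>{0..<?d}. X $$ (e' p, e' (e i)) * Y $$ (e' (e i), e' q))"
      by (rule sum.cong) (auto simp: ee)
    also have "\<dots> = (\<Sum>r\<in>K. X $$ (e' p, e' r) * Y $$ (e' r, e' q))"
      by (rule sum.reindex_bij_betw[OF e])
    finally show ?thesis .
  qed
  define dt where "dt x = Determinant.det (M (A x))" for x
  define adj where "adj x p q = adj_mat (M (A x)) $$ (e' p, e' q)" for x p q
  note adj = adj_mat[OF M]
  have adj_right: "(\<Sum>r\<in>K. A x p r * adj x r q) = (if p = q then dt x else 0)" if "p \<in> K" "q \<in> K" for x p q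
  proof -
    have "(\<Sum>r\<in>K. A x p r * adj x r q) = (M (A x) * adj_mat (M (A x))) $$ (e' p, e' q)"
      using prod[OF M adj(1) that, of "A x" "A x"] that by (simp add: M_index adj_def)
    then show ?thesis
      using that e' by (simp add: adj(2) dt_def inj_e')
  qed
  have adj_left: "(\<Sum>r\<in>K. adj x p r * A x r q) = (if p = q then dt x else 0)" if "p \<in> K" "q \<in> K" for x p q
  proof -
    have "(\<Sum>r\<in>K. adj x p r * A x r q) = (adj_mat (M (A x)) * M (A x)) $$ (e' p, e' q)"
      using prod[OF adj(1) M that, of "A x" "A x"] that by (simp add: M_index adj_def)
    then show ?thesis
      using that e' by (simp add: adj(3) dt_def inj_e')
  qed
  have sm_M: "smooth_on N U (\<lambda>x. M (A x) $$ (i, j))" if "i < ?d" "j < ?d" for i j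
    using that sm[OF ee(2) ee(2)] by (simp add: M_def)
  have sm_dt: "smooth_on N U dt"
    unfolding dt_def by (rule smooth_on_det[OF U M sm_M])
  have sm_adj: "smooth_on N U (\<lambda>x. adj x p q)" if "p \<in> K" "q \<in> K" for p q
    unfolding adj_def using e' that by (intro smooth_on_adj_mat[OF U M sm_M])
  have nz: "dt x \<noteq> 0" if "is_binv real_ring K (A x) X" for x X
  proof -
    have AX: "(\<Sum>r\<in>K. A x p r * X r q) = (if p = q then 1 else 0)" if "p \<in> K" "q \<in> K" for p q
      using that \<open>is_binv real_ring K (A x) X\<close> by (simp add: is_binv_real_ring_iff[OF K])
    have "M (A x) * M X = 1\<^sub>m ?d"
    proof (rule eq_matI)
      fix i j assume "i < dim_row (1\<^sub>m ?d :: real mat)" "j < dim_col (1\<^sub>m ?d :: real mat)"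
      then have ij: "i < ?d" "j < ?d"
        by auto
      have "(M (A x) * M X) $$ (e' (e i), e' (e j)) = (\<Sum>r\<in>K. A x (e i) r * X r (e j))"
        unfolding prod[OF M M ee(2)[OF ij(1)] ee(2)[OF ij(2)]]
        using ij by (intro sum.cong) (simp_all add: M_index ee(2))
      then have "(M (A x) * M X) $$ (i, j) = (if e i = e j then 1 else 0)"
        using AX[OF ee(2) ee(2)] ij by (simp add: ee(1))
      moreover have "e i = e j \<longleftrightarrow> i = j"
        using ee(1) ij by metis
      ultimately show "(M (A x) * M X) $$ (i, j) = 1\<^sub>m ?d $$ (i, j)"
        using ij by simp
    qed (use M in auto)
    then have "dt x * Determinant.det (M X) = 1"
      using det_mult[OF M M, of "A x" X] by (simp add: dt_def)
    then show ?thesis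
      by auto
  qed
  define B where "B x p q = adj x p q * inverse (dt x)" for x p q
  have B: "is_binv real_ring K (A x) (B x)" if "dt x \<noteq> 0" for x
  proof -
    have "(\<Sum>r\<in>K. A x p r * B x r q) = (\<Sum>r\<in>K. A x p r * adj x r q) * inverse (dt x)"
      and "(\<Sum>r\<in>K. B x p r * A x r q) = (\<Sum>r\<in>K. adj x p r * A x r q) * inverse (dt x)" for p q
      by (simp_all add: B_def sum_distrib_left mult_ac)
    then show ?thesis
      using that by (simp add: is_binv_real_ring_iff[OF K] adj_left adj_right)
  qed
  have "{x \<in> U. \<exists>X. is_binv real_ring K (A x) X} = {x \<in> U. dt x \<noteq> 0}"
    using B nz by blast
  then show "openin (Euclidean_space N) {x \<in> U. \<exists>X. is_binv real_ring K (A x) X}"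
    using openin_smooth_nonzero[OF U sm_dt] by simp
  assume "\<And>x. x \<in> U \<Longrightarrow> \<exists>X. is_binv real_ring K (A x) X"
  then have "dt x \<noteq> 0" if "x \<in> U" for x
    using nz that by blast
  then show "\<exists>B. (\<forall>p\<in>K. \<forall>q\<in>K. smooth_on N U (\<lambda>x. B x p q)) \<and> (\<forall>x\<in>U. is_binv real_ring K (A x) (B x))"
    using B sm_dt sm_adj
    by (intro exI[of _ B]) (auto simp: B_def intro!: smooth_on_mult[OF U] smooth_on_inverse[OF U])
qed

section \<open>Invertible matrices of sections\<close>

context
  fixes n :: nat and \<beta> :: "nat \<Rightarrow> nat" and U :: "(nat \<Rightarrow> real) set" and K :: "(nat \<times> nat) set"
    and A :: "section_fn bmat" and B :: "(nat \<Rightarrow> real) \<Rightarrow> real bmat"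
begin

text \<open>The coefficient at \<open>L\<close> of the equation \<open>A X = 1\<close> reads
  \<open>A_0 X_L = \<delta> - T\<close>, where \<open>T\<close> collects the splittings
  \<open>M + N = L\<close> with \<open>M \<noteq> 0\<close>; the sign of the splitting
  \<open>(0, L)\<close> is 1. \<open>T\<close> involves only \<open>X_N\<close> of smaller total
  degree, and multiplying by \<open>B\<close>, a right inverse of the matrix \<open>A_0\<close> of
  values, gives a solution \<open>X_L\<close>. The guard makes the result vanish wherever a section
  must.\<close>

function right_inverse :: "mindex \<Rightarrow> nat \<times> nat \<Rightarrow> nat \<times> nat \<Rightarrow> (nat \<Rightarrow> real) \<Rightarrow> real" where
  "right_inverse L p q x = (if admissible n \<beta> L \<and> x \<in> U then
     (\<Sum>r\<in>K. B x p r * ((if L = 0 \<and> r = q then 1 else 0) -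
       (\<Sum>z\<in>{(M, N). M + N = L \<and> M \<noteq> 0}. koszul n (fst z) (snd z) *
         (\<Sum>s\<in>K. A r s (fst z) x * right_inverse (snd z) s q x)))) else 0)"
  by pat_completeness auto
termination
  by (relation "Wellfounded.measure (\<lambda>(L, p, q, x). total_deg L)") (auto intro: total_deg_summand_less)

declare right_inverse.simps [simp del]

context
  assumes U: "openin (Euclidean_space (\<beta> 0)) U" and K: "finite K"
    and A: "\<And>p q. p \<in> K \<Longrightarrow> q \<in> K \<Longrightarrow> A p q \<in> carrier (sect n \<beta> U)"
    and B: "\<And>p q. p \<in> K \<Longrightarrow> q \<in> K \<Longrightarrow> smooth_on (\<beta> 0) U (\<lambda>x. B x p q)"
    and AB: "\<And>p q x. p \<in> K \<Longrightarrow> q \<in> K \<Longrightarrow> x \<in> U \<Longrightarrow> (\<Sum>r\<in>K. A p r 0 x * B x r q) = (if p = q then 1 else 0)"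
begin

lemma right_inverse_smooth:
  assumes "admissible n \<beta> L" "p \<in> K" "q \<in> K"
  shows "smooth_on (\<beta> 0) U (right_inverse L p q)"
  using assms
proof (induction "total_deg L" arbitrary: L p rule: less_induct)
  case less
  have "smooth_on (\<beta> 0) U (right_inverse (snd z) s q)" "smooth_on (\<beta> 0) U (A r s (fst z))"
    if "z \<in> {(M, N). M + N = L \<and> M \<noteq> 0}" "r \<in> K" "s \<in> K" for z r s
  proof -
    have z: "z \<in> {(M, N). M + N = L}" "total_deg (snd z) < total_deg L"
      using that by (auto intro: total_deg_summand_less)
    note adm = admissible_antidiagonal[OF less.prems(1) z(1)]
    show "smooth_on (\<beta> 0) U (right_inverse (snd z) s q)"
      by (rule less.hyps[OF z(2) adm(2) that(3) less.prems(3)])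
    show "smooth_on (\<beta> 0) U (A r s (fst z))"
      using A[OF that(2,3)] adm(1) by (simp add: sect_mem_iff)
  qed
  then have "smooth_on (\<beta> 0) U (\<lambda>x. (\<Sum>r\<in>K. B x p r * ((if L = 0 \<and> r = q then 1 else 0) -
       (\<Sum>z\<in>{(M, N). M + N = L \<and> M \<noteq> 0}. koszul n (fst z) (snd z) *
         (\<Sum>s\<in>K. A r s (fst z) x * right_inverse (snd z) s q x)))))"
    using less.prems by (intro smooth_on_sum[OF U] smooth_on_mult[OF U] smooth_on_diff[OF U] smooth_on_const[OF U] B)
  then show ?case
    by (rule smooth_on_cong[OF U, THEN iffD1, rotated]) (subst (2) right_inverse.simps, use less.prems in simp)
qed

lemma right_inverse_closed:
  assumes "p \<in> K" "q \<in> K"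
  shows "(\<lambda>L. right_inverse L p q) \<in> carrier (sect n \<beta> U)"
proof (rule sect_memI)
  show "right_inverse L p q x = 0" if "\<not> admissible n \<beta> L" for L x
    using that by (subst right_inverse.simps) simp
  show "right_inverse L p q x = 0" if "x \<notin> U" for L x
    using that by (subst right_inverse.simps) simp
qed (use assms in \<open>simp add: right_inverse_smooth\<close>)

text \<open>The inner sum is empty for \<open>L = 0\<close>. Knowing that the values of the right
  inverse are those of \<open>B\<close> allows the same recursion to be run on the right
  inverse.\<close>

lemma right_inverse_0:
  assumes "p \<in> K" "q \<in> K" "x \<in> U"
  shows "right_inverse 0 p q x = B x p q"
proof -
  have "M = 0" if "M + N = (0 :: mindex)" for M N
    using that total_deg_add[of M N] by (simp add: total_deg_eq_0_iff total_deg_0)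
  then have empty: "{(M, N). M + N = (0 :: mindex) \<and> M \<noteq> 0} = {}"
    by blast
  then show ?thesis
    using assms K by (subst right_inverse.simps, unfold empty) (simp add: if_distrib[of "\<lambda>t. _ * t"] cong: if_cong)
qed

lemma bmult_right_inverse:
  assumes p: "p \<in> K" and q: "q \<in> K"
  shows "bmult (sect n \<beta> U) K A (\<lambda>p q L. right_inverse L p q) p q = bone (sect n \<beta> U) p q"
proof (intro ext)
  interpret ring "sect n \<beta> U"
    by (rule ring_sect[of \<beta>, OF U])
  fix L :: mindex and x
  let ?D = "{(M, N). M + N = L}"
  let ?X = "\<lambda>p q L. right_inverse L p q"
  have prod: "bmult (sect n \<beta> U) K A ?X p q L x
      = (\<Sum>r\<in>K. (A p r \<otimes>\<^bsub>sect n \<beta> U\<^esub> ?X r q) L x)"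
    unfolding bmult_def using p q A right_inverse_closed
    by (subst sect_finsum[where \<beta> = \<beta>, OF U K]) auto
  show "bmult (sect n \<beta> U) K A ?X p q L x = bone (sect n \<beta> U) p q L x"
  proof (cases "admissible n \<beta> L \<and> x \<in> U")
    case True
    define T where "T r = (\<Sum>z\<in>{(M, N). M + N = L \<and> M \<noteq> 0}. koszul n (fst z) (snd z) *
         (\<Sum>s\<in>K. A r s (fst z) x * right_inverse (snd z) s q x))" for r
    define \<delta> :: "nat \<times> nat \<Rightarrow> real" where "\<delta> r = (if L = 0 \<and> r = q then 1 else 0)" for r
    have X: "right_inverse L s q x = (\<Sum>r\<in>K. B x s r * (\<delta> r - T r))" for s
      unfolding T_def \<delta>_def using True by (subst right_inverse.simps) simp
    have "bmult (sect n \<beta> U) K A ?X p q L x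
        = (\<Sum>s\<in>K. \<Sum>z\<in>?D. koszul n (fst z) (snd z) * (A p s (fst z) x * right_inverse (snd z) s q x))"
      unfolding prod using True by (simp add: sect_mult case_prod_beta mult.assoc)
    also have "\<dots> = (\<Sum>z\<in>?D. koszul n (fst z) (snd z) * (\<Sum>s\<in>K. A p s (fst z) x * right_inverse (snd z) s q x))"
      by (subst sum.swap) (simp add: sum_distrib_left)
    \<comment> \<open>The summand with \<open>M = 0\<close> contains the coefficient chosen by the
      recursion, the others form \<open>T p\<close>. Through \<open>A_0 B = 1\<close> the former
      becomes \<open>\<delta> p - T p\<close>, so \<open>T p\<close> cancels.\<close>
    also have "?D = insert (0, L) {(M, N). M + N = L \<and> M \<noteq> 0}"
      by auto
    also have "(\<Sum>z\<in>\<dots>. koszul n (fst z) (snd z) * (\<Sum>s\<in>K. A p s (fst z) x * right_inverse (snd z) s q x))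
        = (\<Sum>s\<in>K. A p s 0 x * right_inverse L s q x) + T p"
    proof (subst sum.insert)
      show "finite {(M, N). M + N = L \<and> M \<noteq> 0}"
        by (rule finite_subset[OF _ finite_antidiagonal[of L]]) auto
    qed (auto simp: T_def)
    also have "(\<Sum>s\<in>K. A p s 0 x * right_inverse L s q x) = (\<Sum>s\<in>K. \<Sum>r\<in>K. A p s 0 x * B x s r * (\<delta> r - T r))"
      by (simp add: X sum_distrib_left mult.assoc)
    also have "\<dots> = (\<Sum>r\<in>K. \<Sum>s\<in>K. A p s 0 x * B x s r * (\<delta> r - T r))"
      by (rule sum.swap)
    also have "\<dots> = (\<Sum>r\<in>K. (if p = r then 1 else 0) * (\<delta> r - T r))"
      using True p by (intro sum.cong refl) (simp add: AB flip: sum_distrib_right)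
    also have "\<dots> = \<delta> p - T p"
      using K p by (simp add: if_distrib[of "\<lambda>t. t * _"] cong: if_cong)
    finally show ?thesis
      using True by (simp add: bone_def sect_one sect_zero \<delta>_def)
  next
    case False
    have "bmult (sect n \<beta> U) K A ?X p q \<in> carrier (sect n \<beta> U)"
      by (rule bmult_closed) (use A right_inverse_closed p q in auto)
    moreover have "bone (sect n \<beta> U) p q \<in> carrier (sect n \<beta> U)"
      by simp
    ultimately show ?thesis
      using False by (auto simp: sect_mem_iff)
  qed
qed

end

end

declare right_inverse.simps [simp del]

text \<open>The recursion is run twice: on \<open>A\<close>, whose values have the right inverse
  \<open>B\<close>, giving \<open>X\<close>; and on \<open>X\<close>, whose values \<open>B\<close>
  have the right inverse \<open>A0\<close>, giving \<open>Y\<close>. Then \<open>X\<close> is a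
  two-sided inverse of \<open>A\<close>.\<close>

lemma sect_matrix_invertible:
  assumes U: "openin (Euclidean_space (\<beta> 0)) U" and K: "finite K"
    and A: "\<And>p q. p \<in> K \<Longrightarrow> q \<in> K \<Longrightarrow> A p q \<in> carrier (sect n \<beta> U)"
    and inv: "\<And>x. x \<in> U \<Longrightarrow> \<exists>X. is_binv real_ring K (\<lambda>p q. sval (A p q) x) X"
  shows "\<exists>X. is_binv (sect n \<beta> U) K A X"
proof -
  interpret ring "sect n \<beta> U"
    by (rule ring_sect[of \<beta>, OF U])
  define A0 where "A0 x p q = A p q 0 x" for x p q
  have A0: "smooth_on (\<beta> 0) U (\<lambda>x. A0 x p q)" if "p \<in> K" "q \<in> K" for p q
    using A[OF that] by (simp add: A0_def sect_mem_iff)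
  have "A0 x = (\<lambda>p q. sval (A p q) x)" for x
    by (simp add: fun_eq_iff A0_def sval_def)
  then have inv0: "\<exists>X. is_binv real_ring K (A0 x) X" if "x \<in> U" for x
    using inv[OF that] by simp
  have "\<exists>B. (\<forall>p\<in>K. \<forall>q\<in>K. smooth_on (\<beta> 0) U (\<lambda>x. B x p q)) \<and> (\<forall>x\<in>U. is_binv real_ring K (A0 x) (B x))"
    by (rule smooth_invertible_matrices(2)[OF U K]) (simp_all add: A0 inv0)
  then obtain B where B': "\<forall>p\<in>K. \<forall>q\<in>K. smooth_on (\<beta> 0) U (\<lambda>x. B x p q)"
      "\<forall>x\<in>U. is_binv real_ring K (A0 x) (B x)"
    by (elim exE conjE)
  have B: "smooth_on (\<beta> 0) U (\<lambda>x. B x p q)" if "p \<in> K" "q \<in> K" for p q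
    using B'(1) that by simp
  have B_inv: "is_binv real_ring K (A0 x) (B x)" if "x \<in> U" for x
    using B'(2) that by simp
  have AB: "(\<Sum>r\<in>K. A p r 0 x * B x r q) = (if p = q then 1 else 0)"
    and BA: "(\<Sum>r\<in>K. B x p r * A0 x r q) = (if p = q then 1 else 0)"
    if "p \<in> K" "q \<in> K" "x \<in> U" for p q x
    using that B_inv[OF that(3)] by (simp_all add: is_binv_real_ring_iff[OF K] A0_def)
  define X where "X p q = (\<lambda>L. right_inverse n \<beta> U K A B L p q)" for p q
  have X: "X p q \<in> carrier (sect n \<beta> U)" if "p \<in> K" "q \<in> K" for p q
    unfolding X_def by (rule right_inverse_closed[OF U K A B AB that])
  have X0: "X p q 0 x = B x p q" if "p \<in> K" "q \<in> K" "x \<in> U" for p q x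
    unfolding X_def by (rule right_inverse_0[OF U K A B AB that])
  have AX: "bmult (sect n \<beta> U) K A X p q = bone (sect n \<beta> U) p q" if "p \<in> K" "q \<in> K" for p q
    unfolding X_def by (rule bmult_right_inverse[OF U K A B AB that])
  have XA0: "(\<Sum>r\<in>K. X p r 0 x * A0 x r q) = (if p = q then 1 else 0)" if "p \<in> K" "q \<in> K" "x \<in> U" for p q x
    using BA[OF that] X0 that by simp
  define Y where "Y p q = (\<lambda>L. right_inverse n \<beta> U K X A0 L p q)" for p q
  have Y: "Y p q \<in> carrier (sect n \<beta> U)" if "p \<in> K" "q \<in> K" for p q
    unfolding Y_def by (rule right_inverse_closed[OF U K X A0 XA0 that])
  have XY: "bmult (sect n \<beta> U) K X Y p q = bone (sect n \<beta> U) p q" if "p \<in> K" "q \<in> K" for p q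
    unfolding Y_def by (rule bmult_right_inverse[OF U K X A0 XA0 that])
  show ?thesis
    using is_binv_if_right_inverses[OF K A X Y AX XY] by blast
qed

section \<open>Units and unit germs\<close>

lemma sect_Units_iff:
  assumes U: "openin (Euclidean_space (\<beta> 0)) U" and f: "f \<in> carrier (sect n \<beta> U)"
  shows "f \<in> Units (sect n \<beta> U) \<longleftrightarrow> (\<forall>x\<in>U. f 0 x \<noteq> 0)"
proof
  assume "f \<in> Units (sect n \<beta> U)"
  then obtain g where "f \<otimes>\<^bsub>sect n \<beta> U\<^esub> g = \<one>\<^bsub>sect n \<beta> U\<^esub>"
    by (auto simp: Units_def)
  then have "f 0 x * g 0 x = \<one>\<^bsub>sect n \<beta> U\<^esub> 0 x" for x
    by (metis sect_mult_0)
  then show "\<forall>x\<in>U. f 0 x \<noteq> 0"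
    by (metis mult_zero_left sect_one zero_neq_one)
next
  interpret ring "sect n \<beta> U"
    by (rule ring_sect[of \<beta>, OF U])
  assume nz: "\<forall>x\<in>U. f 0 x \<noteq> 0"
  let ?o = "(0, 0) :: nat \<times> nat"
  \<comment> \<open>A section is a one-by-one matrix, so its inverse comes from the result on
    matrices.\<close>
  have "\<exists>X. is_binv (sect n \<beta> U) {?o} (\<lambda>p q. f) X"
  proof (rule sect_matrix_invertible[where \<beta> = \<beta>, OF U])
    fix x assume "x \<in> U"
    then show "\<exists>X. is_binv real_ring {?o} (\<lambda>p q. sval f x) X"
      using nz by (intro exI[of _ "\<lambda>p q. inverse (f 0 x)"]) (simp add: is_binv_real_ring_iff sval_def)
  qed (use f in auto)
  then obtain X where X: "X ?o ?o \<in> carrier (sect n \<beta> U)"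
      "bmult (sect n \<beta> U) {?o} (\<lambda>p q. f) X ?o ?o = \<one>\<^bsub>sect n \<beta> U\<^esub>"
      "bmult (sect n \<beta> U) {?o} X (\<lambda>p q. f) ?o ?o = \<one>\<^bsub>sect n \<beta> U\<^esub>"
    by (auto simp: is_binv_def bone_def)
  then have "f \<otimes>\<^bsub>sect n \<beta> U\<^esub> X ?o ?o = \<one>\<^bsub>sect n \<beta> U\<^esub>" "X ?o ?o \<otimes>\<^bsub>sect n \<beta> U\<^esub> f = \<one>\<^bsub>sect n \<beta> U\<^esub>"
    using f by (simp_all add: bmult_def)
  then show "f \<in> Units (sect n \<beta> U)"
    using f X(1) by (auto simp: Units_def)
qed

lemma srestrict_closed:
  assumes "f \<in> carrier (sect n \<beta> U)" "V \<subseteq> U" "openin (Euclidean_space (\<beta> 0)) V"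
  shows "srestrict V f \<in> carrier (sect n \<beta> V)"
proof (rule sect_memI)
  fix L assume "admissible n \<beta> L"
  then have "smooth_on (\<beta> 0) V (f L)"
    using assms smooth_on_subset by (auto simp: sect_mem_iff)
  then show "smooth_on (\<beta> 0) V (srestrict V f L)"
    using smooth_on_cong[OF assms(3), of "srestrict V f L" "f L"] by (simp add: srestrict_def)
qed (use assms(1) in \<open>auto simp: srestrict_def sect_mem_iff\<close>)

text \<open>The germs with value 0 form the maximal ideal of the stalk: where the value is nonzero,
  the nonvanishing locus is an open neighbourhood on which \<open>f\<close> is a unit. This
  translates the stalk condition in \<open>morphism\<close> into a condition on values.\<close>

lemma unit_germ_iff:
  assumes U: "openin (Euclidean_space (\<beta> 0)) U" and f: "f \<in> carrier (sect n \<beta> U)" and x: "x \<in> U"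
  shows "unit_germ n \<beta> U x f \<longleftrightarrow> f 0 x \<noteq> 0"
proof
  assume "unit_germ n \<beta> U x f"
  then obtain V where V: "openin (Euclidean_space (\<beta> 0)) V" "x \<in> V" "V \<subseteq> U" "srestrict V f \<in> Units (sect n \<beta> V)"
    by (auto simp: unit_germ_def)
  then have "srestrict V f 0 x \<noteq> 0"
    using sect_Units_iff[of \<beta>, OF V(1) srestrict_closed[OF f V(3,1)]] by blast
  then show "f 0 x \<noteq> 0"
    using V(2) by (simp add: srestrict_def)
next
  assume nz: "f 0 x \<noteq> 0"
  define V where "V = {y \<in> U. f 0 y \<noteq> 0}"
  have V: "openin (Euclidean_space (\<beta> 0)) V"
    unfolding V_def by (rule openin_smooth_nonzero[OF U]) (use f in \<open>simp add: sect_mem_iff\<close>)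
  have VU: "V \<subseteq> U"
    by (auto simp: V_def)
  have "srestrict V f \<in> Units (sect n \<beta> V)"
    using sect_Units_iff[of \<beta>, OF V srestrict_closed[OF f VU V]] by (auto simp: V_def srestrict_def)
  then show "unit_germ n \<beta> U x f"
    unfolding unit_germ_def using V VU x nz by (auto simp: V_def)
qed

section \<open>Morphisms of superdomains\<close>

lemma morphismD:
  assumes "morphism n \<beta> U \<beta>' V g" "openin (Euclidean_space (\<beta>' 0)) W" "W \<subseteq> V"
  shows "pull g W \<in> Ring.ring_hom (sect n \<beta>' W) (sect n \<beta> (preim g U W))"
    and "f \<in> carrier (sect n \<beta>' W) \<Longrightarrow> pull g W (sscale c f) = sscale c (pull g W f)"
    and "f \<in> carrier (sect n \<beta>' W) \<Longrightarrow> homogeneous n d f \<Longrightarrow> homogeneous n d (pull g W f)"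
    and "openin (Euclidean_space (\<beta>' 0)) W' \<Longrightarrow> W' \<subseteq> W \<Longrightarrow> f \<in> carrier (sect n \<beta>' W) \<Longrightarrow>
           pull g W' (srestrict W' f) = srestrict (preim g U W') (pull g W f)"
    and "x \<in> preim g U W \<Longrightarrow> f \<in> carrier (sect n \<beta>' W) \<Longrightarrow>
           unit_germ n \<beta> (preim g U W) x (pull g W f) \<Longrightarrow> unit_germ n \<beta>' W (base g x) f"
proof -
  note all = assms(1)[unfolded morphism_def, THEN conjunct2, THEN spec[of _ W], THEN mp, OF conjI[OF assms(2,3)]]
  note c1 = all[THEN conjunct1] and r1 = all[THEN conjunct2]
  note c2 = r1[THEN conjunct1] and r2 = r1[THEN conjunct2]
  note c3 = r2[THEN conjunct1] and r3 = r2[THEN conjunct2]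
  note c4 = r3[THEN conjunct1] and c5 = r3[THEN conjunct2]
  show "pull g W \<in> Ring.ring_hom (sect n \<beta>' W) (sect n \<beta> (preim g U W))"
    by (rule c1)
  show "f \<in> carrier (sect n \<beta>' W) \<Longrightarrow> pull g W (sscale c f) = sscale c (pull g W f)"
    by (rule c2[rule_format])
  show "f \<in> carrier (sect n \<beta>' W) \<Longrightarrow> homogeneous n d f \<Longrightarrow> homogeneous n d (pull g W f)"
    by (rule c3[rule_format])
  show "openin (Euclidean_space (\<beta>' 0)) W' \<Longrightarrow> W' \<subseteq> W \<Longrightarrow> f \<in> carrier (sect n \<beta>' W) \<Longrightarrow>
      pull g W' (srestrict W' f) = srestrict (preim g U W') (pull g W f)"
    by (rule c4[rule_format]) simp
  show "x \<in> preim g U W \<Longrightarrow> f \<in> carrier (sect n \<beta>' W) \<Longrightarrow>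
      unit_germ n \<beta> (preim g U W) x (pull g W f) \<Longrightarrow> unit_germ n \<beta>' W (base g x) f"
    by (rule c5[rule_format])
qed

lemma morphism_base_mem:
  assumes "morphism n \<beta> U \<beta>' V g" "openin (Euclidean_space (\<beta> 0)) U" "x \<in> U"
  shows "base g x \<in> V"
proof -
  have "continuous_map (subtopology (Euclidean_space (\<beta> 0)) U) (subtopology (Euclidean_space (\<beta>' 0)) V) (base g)"
    using assms(1) by (simp add: morphism_def)
  moreover have "x \<in> topspace (subtopology (Euclidean_space (\<beta> 0)) U)"
    using assms(2,3) openin_subset by fastforce
  ultimately have "base g x \<in> topspace (subtopology (Euclidean_space (\<beta>' 0)) V)"
    by (auto simp: continuous_map_def)
  then show ?thesis
    by simp
qed

lemma openin_preim:
  assumes "morphism n \<beta> U \<beta>' V g" "openin (Euclidean_space (\<beta> 0)) U"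
    and "openin (Euclidean_space (\<beta>' 0)) W" "W \<subseteq> V"
  shows "openin (Euclidean_space (\<beta> 0)) (preim g U W)"
proof -
  have "continuous_map (subtopology (Euclidean_space (\<beta> 0)) U) (subtopology (Euclidean_space (\<beta>' 0)) V) (base g)"
    using assms(1) by (simp add: morphism_def)
  moreover have "openin (subtopology (Euclidean_space (\<beta>' 0)) V) W"
    using assms(3,4) by (metis inf.absorb1 openin_subtopology)
  ultimately have "openin (subtopology (Euclidean_space (\<beta> 0)) U)
      {x \<in> topspace (subtopology (Euclidean_space (\<beta> 0)) U). base g x \<in> W}"
    by (rule openin_continuous_map_preimage)
  moreover have "topspace (subtopology (Euclidean_space (\<beta> 0)) U) = U"
    using openin_subset[OF assms(2)] by auto
  ultimately have "openin (subtopology (Euclidean_space (\<beta> 0)) U) (preim g U W)"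
    by (simp only: preim_def)
  then show ?thesis
    using openin_trans_full assms(2) by blast
qed

section \<open>Restriction and composition of morphisms\<close>

lemma morphism_restrict:
  assumes g: "morphism n \<beta> U \<beta>' V g" and V': "V' \<subseteq> V"
  shows "morphism n \<beta> (preim g U V') \<beta>' V' g"
proof -
  have sub: "preim g (preim g U V') W = preim g U W" if "W \<subseteq> V'" for W
    using that by (auto simp: preim_def)
  have "continuous_map (subtopology (Euclidean_space (\<beta> 0)) U) (subtopology (Euclidean_space (\<beta>' 0)) V) (base g)"
    using g by (simp add: morphism_def)
  then have "continuous_map (subtopology (Euclidean_space (\<beta> 0)) (preim g U V')) (Euclidean_space (\<beta>' 0)) (base g)"
    by (auto simp: preim_def continuous_map_in_subtopology intro: continuous_map_from_subtopology_mono)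
  then have "continuous_map (subtopology (Euclidean_space (\<beta> 0)) (preim g U V'))
      (subtopology (Euclidean_space (\<beta>' 0)) V') (base g)"
    by (auto simp: continuous_map_in_subtopology preim_def)
  moreover have "W \<subseteq> V" if "W \<subseteq> V'" for W
    using that V' by simp
  ultimately show ?thesis
    unfolding morphism_def
    by (intro conjI allI impI ballI) (elim conjE, simp add: sub morphismD[OF g] | assumption)+
qed

text \<open>Base maps are total functions, so the intermediate domain \<open>U\<close> is a
  parameter: the preimage under \<open>g\<close> is taken in it, and \<open>pull h\<close> is
  indexed by that preimage.\<close>

definition comp_morph :: "(nat \<Rightarrow> real) set \<Rightarrow> morph \<Rightarrow> morph \<Rightarrow> morph" where
  "comp_morph U g h = (\<lambda>x. base g (base h x), \<lambda>W f. pull h (preim g U W) (pull g W f))"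

lemma preim_comp_morph:
  assumes "morphism n \<beta> T \<beta>' U h" "openin (Euclidean_space (\<beta> 0)) T"
  shows "preim (comp_morph U g h) T W = preim h T (preim g U W)"
  using morphism_base_mem[OF assms] by (auto simp: preim_def comp_morph_def)

lemma morphism_comp:
  assumes h: "morphism n \<beta> T \<beta>' U h" and g: "morphism n \<beta>' U \<beta>'' V g"
    and T: "openin (Euclidean_space (\<beta> 0)) T" and U: "openin (Euclidean_space (\<beta>' 0)) U"
  shows "morphism n \<beta> T \<beta>'' V (comp_morph U g h)"
proof -
  have cont: "continuous_map (subtopology (Euclidean_space (\<beta> 0)) T) (subtopology (Euclidean_space (\<beta>'' 0)) V)
      (base (comp_morph U g h))"
    using g h continuous_map_compose[of _ _ "base h" _ "base g"]
    by (auto simp: morphism_def comp_morph_def comp_def)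
  note pre = preim_comp_morph[OF h T, of g]
  show ?thesis
    unfolding morphism_def pre
  proof (intro conjI allI impI ballI cont)
    fix W assume "openin (Euclidean_space (\<beta>'' 0)) W \<and> W \<subseteq> V"
    then have W: "openin (Euclidean_space (\<beta>'' 0)) W" "W \<subseteq> V"
      by auto
    let ?W' = "preim g U W"
    have W': "openin (Euclidean_space (\<beta>' 0)) ?W'" "?W' \<subseteq> U"
      using openin_preim[OF g U W] by (auto simp: preim_def)
    note g' = morphismD[OF g W] and h' = morphismD[OF h W']
    have cl: "pull g W f \<in> carrier (sect n \<beta>' ?W')" if "f \<in> carrier (sect n \<beta>'' W)" for f
      using ring_hom_closed[OF g'(1) that] .
    show "pull (comp_morph U g h) W \<in> Ring.ring_hom (sect n \<beta>'' W) (sect n \<beta> (preim h T ?W'))"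
      using ring_hom_trans[OF g'(1) h'(1)] by (simp add: comp_morph_def comp_def)
    fix f assume f: "f \<in> carrier (sect n \<beta>'' W)"
    show "pull (comp_morph U g h) W (sscale c f) = sscale c (pull (comp_morph U g h) W f)" for c
      using g'(2) h'(2) f cl by (simp add: comp_morph_def)
    show "homogeneous n d (pull (comp_morph U g h) W f)" if "homogeneous n d f" for d
      using g'(3) h'(3) f cl that by (simp add: comp_morph_def)
    fix x assume x: "x \<in> preim h T ?W'"
    then show "unit_germ n \<beta>'' W (base (comp_morph U g h) x) f"
      if "unit_germ n \<beta> (preim h T ?W') x (pull (comp_morph U g h) W f)"
      using g'(5)[OF _ f] h'(5)[OF x cl[OF f]] that by (auto simp: comp_morph_def preim_def)
  next
    fix W W' f
    assume "openin (Euclidean_space (\<beta>'' 0)) W \<and> W \<subseteq> V"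
      and "openin (Euclidean_space (\<beta>'' 0)) W' \<and> W' \<subseteq> W \<and> f \<in> carrier (sect n \<beta>'' W)"
    then have W: "openin (Euclidean_space (\<beta>'' 0)) W" "W \<subseteq> V"
      and W': "openin (Euclidean_space (\<beta>'' 0)) W'" "W' \<subseteq> W" "W' \<subseteq> V" and f: "f \<in> carrier (sect n \<beta>'' W)"
      by auto
    have pW: "openin (Euclidean_space (\<beta>' 0)) (preim g U W)" "preim g U W \<subseteq> U"
      and pW': "openin (Euclidean_space (\<beta>' 0)) (preim g U W')" "preim g U W' \<subseteq> preim g U W"
      using openin_preim[OF g U] W W' by (auto simp: preim_def)
    show "pull (comp_morph U g h) W' (srestrict W' f)
        = srestrict (preim h T (preim g U W')) (pull (comp_morph U g h) W f)"
      using morphismD(4)[OF g W W'(1,2) f]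
        morphismD(4)[OF h pW pW' ring_hom_closed[OF morphismD(1)[OF g W] f]]
      by (simp add: comp_morph_def)
  qed
qed

text \<open>Locality on stalks makes the pullback compatible with evaluation at points: a section with nonzero
  value at a point is a unit near it, so \<open>f - f(g x)\<close> must pull back to a section vanishing at \<open>x\<close>.\<close>

lemma sval_pull:
  assumes g: "morphism n \<beta> U \<beta>' V g" and U: "openin (Euclidean_space (\<beta> 0)) U"
    and W: "openin (Euclidean_space (\<beta>' 0)) W" "W \<subseteq> V"
    and f: "f \<in> carrier (sect n \<beta>' W)" and x: "x \<in> preim g U W"
  shows "sval (pull g W f) x = sval f (base g x)"
proof -
  let ?R = "sect n \<beta>' W" and ?S = "sect n \<beta> (preim g U W)"
  let ?c = "f 0 (base g x)"
  have pU: "openin (Euclidean_space (\<beta> 0)) (preim g U W)"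
    by (rule openin_preim[OF g U W])
  have W': "base g x \<in> W"
    using x by (simp add: preim_def)
  note hom = morphismD(1)[OF g W]
  have one: "\<one>\<^bsub>?R\<^esub> \<in> carrier ?R" "sscale (- ?c) \<one>\<^bsub>?R\<^esub> \<in> carrier ?R"
    using sect_one_closed[of \<beta>', OF W(1)] sect_scale_closed[of \<beta>', OF W(1)] by blast+
  let ?f = "f \<oplus>\<^bsub>?R\<^esub> sscale (- ?c) \<one>\<^bsub>?R\<^esub>"
  have f': "?f \<in> carrier ?R"
    using sect_add_closed[of \<beta>', OF W(1) f one(2)] .
  have "?f 0 (base g x) = 0"
    using W' by (simp add: sect_add sscale_def sect_one)
  then have "\<not> unit_germ n \<beta>' W (base g x) ?f"
    using unit_germ_iff[of \<beta>', OF W(1) f' W'] by simp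
  then have "pull g W ?f 0 x = 0"
    using morphismD(5)[OF g W x f'] unit_germ_iff[of \<beta>, OF pU ring_hom_closed[OF hom f'] x] by blast
  moreover have "pull g W ?f = pull g W f \<oplus>\<^bsub>?S\<^esub> sscale (- ?c) \<one>\<^bsub>?S\<^esub>"
    using ring_hom_add[OF hom f one(2)] morphismD(2)[OF g W one(1)] ring_hom_one[OF hom] by simp
  ultimately show ?thesis
    using x by (simp add: sect_add sscale_def sect_one sval_def)
qed

section \<open>Morphisms fixing the coordinates\<close>

lemma coord_closed:
  assumes U: "openin (Euclidean_space (\<beta> 0)) U" and l: "l < 2 ^ n" "j < \<beta> l"
  shows "coord U l j \<in> carrier (sect n \<beta> U)"
proof (rule sect_memI)
  fix L
  show "smooth_on (\<beta> 0) U (coord U l j L)"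
  proof (cases "l = 0 \<and> L = 0")
    case True
    then show ?thesis
      using smooth_on_cong[OF U, of "coord U l j L" "\<lambda>x. x j"] smooth_on_coord[OF U]
      by (simp add: coord_def)
  next
    case False
    then show ?thesis
      by (intro smooth_on_cong[OF U, THEN iffD2, OF _ smooth_on_const[OF U,
              of "if l \<noteq> 0 \<and> L = Poly_Mapping.single (l, j) 1 then 1 else 0"]])
         (auto simp: coord_def)
  qed
next
  fix L x assume "\<not> admissible n \<beta> L"
  moreover have "admissible n \<beta> (Poly_Mapping.single (l, j) 1)" if "l \<noteq> 0"
    using l that by (simp add: admissible_single gens_def del: One_nat_def)
  ultimately show "coord U l j L x = 0"
    by (auto simp: coord_def)
qed (simp add: coord_def)

lemma srestrict_coord: "W \<subseteq> U \<Longrightarrow> srestrict W (coord U l j) = coord W l j"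
  by (auto simp: srestrict_def coord_def fun_eq_iff)

lemma sect_mult_concentrated:
  assumes "u \<in> carrier (sect n \<beta> U)" "\<And>M. M \<noteq> 0 \<Longrightarrow> y M x = 0"
  shows "(y \<otimes>\<^bsub>sect n \<beta> U\<^esub> u) L x = y 0 x * u L x"
proof (cases "admissible n \<beta> L")
  case True
  have y0: "M = 0" if "y M x \<noteq> 0" for M
    using assms(2) that by blast
  have "(\<Sum>(M, N) | M + N = L. koszul n M N * y M x * u N x) = (\<Sum>(M, N)\<in>{(0, L)}. koszul n M N * y M x * u N x)"
    using y0 by (intro sum.mono_neutral_right) (auto simp: finite_antidiagonal)
  then show ?thesis
    using True by (simp add: sect_mult)
qed (use assms(1) in \<open>auto simp: sect_mult sect_mem_iff\<close>)

text \<open>Multiplication by a generator shifts multi-indices by one step, so the coefficient at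
  \<open>L\<close> sees at most one coefficient of \<open>u\<close>, of smaller total degree. The
  induction comparing a section with its pullback rests on this drop.\<close>

lemma sect_mult_generator:
  assumes "l \<noteq> 0"
  shows "(coord U l j \<otimes>\<^bsub>sect n \<beta> U\<^esub> u) L x =
    (if admissible n \<beta> L \<and> x \<in> U \<and> (l, j) \<in> Poly_Mapping.keys L
     then koszul n (Poly_Mapping.single (l, j) 1) (L - Poly_Mapping.single (l, j) 1) * u (L - Poly_Mapping.single (l, j) 1) x
     else 0)"
proof (cases "admissible n \<beta> L \<and> x \<in> U \<and> (l, j) \<in> Poly_Mapping.keys L")
  case True
  let ?s = "Poly_Mapping.single (l, j) 1 :: mindex"
  have L: "?s + (L - ?s) = L"
    using True by (intro poly_mapping_eqI) (auto simp: lookup_add lookup_minus lookup_single when_def in_keys_iff)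
  have "(\<Sum>(M, N) | M + N = L. koszul n M N * coord U l j M x * u N x)
      = (\<Sum>(M, N)\<in>{(?s, L - ?s)}. koszul n M N * coord U l j M x * u N x)"
    by (rule sum.mono_neutral_right) (use L assms in \<open>auto simp: coord_def finite_antidiagonal split: if_splits\<close>)
  then show ?thesis
    using True assms by (simp add: sect_mult coord_def)
next
  case False
  have "koszul n M N * coord U l j M x * u N x = 0" if "admissible n \<beta> L" "M + N = L" for M N
    using that False assms by (auto simp: coord_def keys_add_nat)
  then show ?thesis
    using False by (auto simp: sect_mult intro!: sum.neutral)
qed

text \<open>Hadamard's lemma for sections: modulo its value at \<open>c\<close>, a section lies in the ideal generated by the
  \<open>x\<^sub>i - c\<^sub>i\<close> and the formal generators.\<close>

lemma sect_Hadamard: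
  assumes c: "c \<in> cube (\<beta> 0) c e" and f: "f \<in> carrier (sect n \<beta> (cube (\<beta> 0) c e))"
  obtains G H where
    "\<And>i. i < \<beta> 0 \<Longrightarrow> G i \<in> carrier (sect n \<beta> (cube (\<beta> 0) c e))"
    "\<And>a. a \<in> gens n \<beta> \<Longrightarrow> H a \<in> carrier (sect n \<beta> (cube (\<beta> 0) c e))"
    "f = sscale (f 0 c) \<one>\<^bsub>sect n \<beta> (cube (\<beta> 0) c e)\<^esub> \<oplus>\<^bsub>sect n \<beta> (cube (\<beta> 0) c e)\<^esub>
       (finsum (sect n \<beta> (cube (\<beta> 0) c e)) (\<lambda>i. (coord (cube (\<beta> 0) c e) 0 i \<oplus>\<^bsub>sect n \<beta> (cube (\<beta> 0) c e)\<^esub>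
          sscale (- c i) \<one>\<^bsub>sect n \<beta> (cube (\<beta> 0) c e)\<^esub>) \<otimes>\<^bsub>sect n \<beta> (cube (\<beta> 0) c e)\<^esub> G i) {..<\<beta> 0}
        \<oplus>\<^bsub>sect n \<beta> (cube (\<beta> 0) c e)\<^esub>
        finsum (sect n \<beta> (cube (\<beta> 0) c e)) (\<lambda>a. coord (cube (\<beta> 0) c e) (fst a) (snd a)
          \<otimes>\<^bsub>sect n \<beta> (cube (\<beta> 0) c e)\<^esub> H a) (gens n \<beta>))"
proof -
  let ?B = "cube (\<beta> 0) c e"
  let ?R = "sect n \<beta> ?B"
  note B = openin_cube[of "\<beta> 0" c e]
  interpret ring ?R
    by (rule ring_sect[of \<beta>, OF B])
  have "smooth_on (\<beta> 0) ?B (f 0)"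
    using f by (simp add: sect_mem_iff)
  from Hadamard_lemma[OF c this] obtain g where
    g: "\<And>i. i < \<beta> 0 \<Longrightarrow> smooth_on (\<beta> 0) ?B (g i)"
      "\<And>x. x \<in> ?B \<Longrightarrow> f 0 x = f 0 c + (\<Sum>i<\<beta> 0. (x i - c i) * g i x)"
    by blast
  \<comment> \<open>Only the coefficient at 0 is expanded in the base variables; all others carry a
    formal generator already and go into \<open>H\<close>.\<close>
  define G where "G i = (\<lambda>M x. if M = (0 :: mindex) \<and> x \<in> ?B then g i x else 0)" for i
  have G: "G i \<in> carrier ?R" if "i < \<beta> 0" for i
  proof (rule sect_memI)
    fix L
    show "smooth_on (\<beta> 0) ?B (G i L)"
      using smooth_on_cong[OF B, of "G i 0" "g i"] g(1)[OF that] smooth_on_const[OF B]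
      by (cases "L = 0") (simp_all add: G_def)
  qed (auto simp: G_def)
  \<comment> \<open>A monomial may be divisible by several generators. \<open>ch\<close> selects one
    of them, so that each coefficient of \<open>f\<close> enters exactly one summand.\<close>
  define ch where "ch L = (SOME a. a \<in> Poly_Mapping.keys L)" for L :: mindex
  have ch: "ch L \<in> Poly_Mapping.keys L" if "L \<noteq> 0" for L
    unfolding ch_def using that some_in_eq[of "Poly_Mapping.keys L"] by simp
  \<comment> \<open>The sign is the one produced by multiplying with the generator \<open>a\<close>
    again; the two cancel by \<open>koszul_square\<close>.\<close>
  define H where "H a = (\<lambda>M x. if ch (M + Poly_Mapping.single a 1) = a
      then koszul n (Poly_Mapping.single a 1) M * f (M + Poly_Mapping.single a 1) x else 0)" for a
  have H: "H a \<in> carrier ?R" if "a \<in> gens n \<beta>" for a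
  proof (rule sect_memI)
    fix L
    have "smooth_on (\<beta> 0) ?B (f (L + Poly_Mapping.single a 1))"
    proof (cases "admissible n \<beta> (L + Poly_Mapping.single a 1)")
      case False
      then have "f (L + Poly_Mapping.single a 1) = (\<lambda>x. 0)"
        using f by (auto simp: sect_mem_iff)
      then show ?thesis
        using smooth_on_const[OF B] by simp
    qed (use f in \<open>simp add: sect_mem_iff\<close>)
    then show "smooth_on (\<beta> 0) ?B (H a L)"
      by (cases "ch (L + Poly_Mapping.single a 1) = a")
         (simp_all add: H_def smooth_on_mult[OF B] smooth_on_const[OF B] del: One_nat_def)
  next
    fix L x assume "\<not> admissible n \<beta> L"
    then have "\<not> admissible n \<beta> (L + Poly_Mapping.single a 1)"
      using admissible_add by blast
    then show "H a L x = 0"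
      using f by (simp add: H_def sect_mem_iff)
  qed (use f in \<open>simp add: H_def sect_mem_iff\<close>)
  let ?y = "\<lambda>i. coord ?B 0 i \<oplus>\<^bsub>?R\<^esub> sscale (- c i) \<one>\<^bsub>?R\<^esub>"
  have y: "?y i \<in> carrier ?R" if "i < \<beta> 0" for i
    using that coord_closed[of \<beta>, OF B] sect_scale_closed[of \<beta>, OF B] by auto
  have y_val: "?y i M x = (if M = 0 \<and> x \<in> ?B then x i - c i else 0)" for i M x
    by (simp add: sect_add coord_def sscale_def sect_one)
  have gen: "coord ?B (fst a) (snd a) \<in> carrier ?R" if "a \<in> gens n \<beta>" for a
    using that coord_closed[of \<beta>, OF B] by (auto simp: gens_def)
  have "f = sscale (f 0 c) \<one>\<^bsub>?R\<^esub> \<oplus>\<^bsub>?R\<^esub> (finsum ?R (\<lambda>i. ?y i \<otimes>\<^bsub>?R\<^esub> G i) {..<\<beta> 0} \<oplus>\<^bsub>?R\<^esub>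
      finsum ?R (\<lambda>a. coord ?B (fst a) (snd a) \<otimes>\<^bsub>?R\<^esub> H a) (gens n \<beta>))" (is "f = ?F")
  proof (intro ext)
    fix L x
    show "f L x = ?F L x"
    proof (cases "admissible n \<beta> L \<and> x \<in> ?B")
      case True
      have s1: "finsum ?R (\<lambda>i. ?y i \<otimes>\<^bsub>?R\<^esub> G i) {..<\<beta> 0} L x = (\<Sum>i<\<beta> 0. (x i - c i) * G i L x)"
      proof -
        have "finsum ?R (\<lambda>i. ?y i \<otimes>\<^bsub>?R\<^esub> G i) {..<\<beta> 0} L x = (\<Sum>i<\<beta> 0. (?y i \<otimes>\<^bsub>?R\<^esub> G i) L x)"
          using y G by (subst sect_finsum[where \<beta> = \<beta>, OF B]) auto
        also have "\<dots> = (\<Sum>i<\<beta> 0. ?y i 0 x * G i L x)"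
          using G by (intro sum.cong sect_mult_concentrated) (auto simp: y_val)
        finally show ?thesis
          using True by (simp add: y_val)
      qed
      have s2: "finsum ?R (\<lambda>a. coord ?B (fst a) (snd a) \<otimes>\<^bsub>?R\<^esub> H a) (gens n \<beta>) L x
          = (\<Sum>a\<in>gens n \<beta>. if a \<in> Poly_Mapping.keys L \<and> a = ch L then f L x else 0)"
      proof -
        have "(coord ?B (fst a) (snd a) \<otimes>\<^bsub>?R\<^esub> H a) L x = (if a \<in> Poly_Mapping.keys L \<and> a = ch L then f L x else 0)"
          if "a \<in> gens n \<beta>" for a
        proof -
          have nz: "fst a \<noteq> 0"
            using that by (auto simp: gens_def)
          have "L - Poly_Mapping.single a 1 + Poly_Mapping.single a 1 = L" if "a \<in> Poly_Mapping.keys L"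
            using that by (intro poly_mapping_eqI) (auto simp: lookup_add lookup_minus lookup_single when_def in_keys_iff)
          then show ?thesis
            using True koszul_square[of n "Poly_Mapping.single a 1"]
            by (auto simp: sect_mult_generator[OF nz] H_def mult.assoc[symmetric])
        qed
        then have "(\<Sum>a\<in>gens n \<beta>. (coord ?B (fst a) (snd a) \<otimes>\<^bsub>?R\<^esub> H a) L x)
            = (\<Sum>a\<in>gens n \<beta>. if a \<in> Poly_Mapping.keys L \<and> a = ch L then f L x else 0)"
          by (intro sum.cong) auto
        then show ?thesis
          using gen H by (subst sect_finsum[where \<beta> = \<beta>, OF B finite_gens]) auto
      qed
      show ?thesis
      proof (cases "L = 0")
        case L: True
        then show ?thesis
          using True g(2)[of x] s1 s2 by (simp add: sect_add sscale_def sect_one G_def)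
      next
        case L: False
        have "ch L \<in> gens n \<beta>"
          using ch[OF L] True by (auto simp: admissible_def)
        then have "finsum ?R (\<lambda>a. coord ?B (fst a) (snd a) \<otimes>\<^bsub>?R\<^esub> H a) (gens n \<beta>) L x = f L x"
          unfolding s2 using ch[OF L] sum.delta[OF finite_gens[of n \<beta>], of "ch L" "\<lambda>_. f L x"]
          by (simp add: conj_commute[of "_ \<in> _"] cong: conj_cong)
        then show ?thesis
          using L s1 by (simp add: sect_add sscale_def sect_one G_def)
      qed
    next
      case False
      have "?F \<in> carrier ?R"
        using y G gen H sect_scale_closed[of \<beta>, OF B] by auto
      then show ?thesis
        using f False by (auto simp: sect_mem_iff)
    qed
  qed
  then show ?thesis
    using that G H by blast
qed

lemma morphism_fixing_coords:
  assumes P: "openin (Euclidean_space (\<beta> 0)) P" and g: "morphism n \<beta> P \<beta> P g"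
    and fix_coord: "\<And>l j. l < 2 ^ n \<Longrightarrow> j < \<beta> l \<Longrightarrow> pull g P (coord P l j) = coord P l j"
  shows "\<And>x. x \<in> P \<Longrightarrow> base g x = x"
    and "\<And>W f. openin (Euclidean_space (\<beta> 0)) W \<Longrightarrow> W \<subseteq> P \<Longrightarrow> f \<in> carrier (sect n \<beta> W) \<Longrightarrow> pull g W f = f"
proof -
  show base_id: "base g x = x" if x: "x \<in> P" for x
  proof
    fix i
    have gx: "base g x \<in> P"
      by (rule morphism_base_mem[OF g P x])
    show "base g x i = x i"
    proof (cases "i < \<beta> 0")
      case True
      have "x \<in> preim g P P"
        using x gx by (simp add: preim_def)
      then have "sval (pull g P (coord P 0 i)) x = sval (coord P 0 i) (base g x)"
        using sval_pull[OF g P P order.refl coord_closed[of \<beta>, OF P]] True by simp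
      then have "sval (coord P 0 i) x = sval (coord P 0 i) (base g x)"
        using True by (simp add: fix_coord)
      then show ?thesis
        using x gx by (simp add: sval_def coord_def)
    next
      case False
      then show ?thesis
        using openin_Euclidean_space_zero[OF P x, of i] openin_Euclidean_space_zero[OF P gx, of i] by simp
    qed
  qed
  have preim_id: "preim g P W = W" if "W \<subseteq> P" for W
    using that base_id by (auto simp: preim_def)
  \<comment> \<open>The hypothesis concerns the coordinates over \<open>P\<close>; compatibility
    with restriction carries it to smaller open sets.\<close>
  have fix_coord': "pull g W (coord W l j) = coord W l j"
    if "openin (Euclidean_space (\<beta> 0)) W" "W \<subseteq> P" "l < 2 ^ n" "j < \<beta> l" for W l j
    using morphismD(4)[OF g P order.refl that(1,2) coord_closed[of \<beta>, OF P that(3,4)]] that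
    by (simp add: srestrict_coord preim_id fix_coord)
  \<comment> \<open>\<open>W\<close> and \<open>f\<close> have to vary in the induction, since the
    hypothesis will be applied to the coefficients \<open>H a\<close>, which are sections over a
    cube around \<open>c\<close> only.\<close>
  have main: "pull g W f L c = f L c"
    if "openin (Euclidean_space (\<beta> 0)) W" "W \<subseteq> P" "f \<in> carrier (sect n \<beta> W)" "c \<in> W" for W f L c
    using that
  proof (induction "total_deg L" arbitrary: L W f c rule: less_induct)
    case less
    note W = less.prems(1,2) and f = less.prems(3) and c = less.prems(4)
    obtain e where e: "e > 0" "cube (\<beta> 0) c e \<subseteq> W"
      using cube_subset_openin[OF W(1) c] by blast
    let ?B = "cube (\<beta> 0) c e"
    let ?R = "sect n \<beta> ?B"
    have B: "openin (Euclidean_space (\<beta> 0)) ?B" "?B \<subseteq> P"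
      using openin_cube e(2) W(2) by auto
    have cB: "c \<in> ?B"
      using e(1) openin_Euclidean_space_zero[OF W(1) c] by (simp add: cube_def)
    interpret ring ?R
      by (rule ring_sect[of \<beta>, OF B(1)])
    define f' where "f' = srestrict ?B f"
    have f': "f' \<in> carrier ?R"
      unfolding f'_def by (rule srestrict_closed[OF f e(2) B(1)])
    let ?h = "pull g ?B"
    have hom: "?h \<in> Ring.ring_hom ?R ?R"
      using morphismD(1)[OF g B] by (simp add: preim_id[OF B(2)])
    obtain G H where GH: "\<And>i. i < \<beta> 0 \<Longrightarrow> G i \<in> carrier ?R" "\<And>a. a \<in> gens n \<beta> \<Longrightarrow> H a \<in> carrier ?R"
      and f'_eq: "f' = sscale (f' 0 c) \<one>\<^bsub>?R\<^esub> \<oplus>\<^bsub>?R\<^esub>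
        (finsum ?R (\<lambda>i. (coord ?B 0 i \<oplus>\<^bsub>?R\<^esub> sscale (- c i) \<one>\<^bsub>?R\<^esub>) \<otimes>\<^bsub>?R\<^esub> G i) {..<\<beta> 0}
        \<oplus>\<^bsub>?R\<^esub> finsum ?R (\<lambda>a. coord ?B (fst a) (snd a) \<otimes>\<^bsub>?R\<^esub> H a) (gens n \<beta>))"
      by (rule sect_Hadamard[OF cB f']) blast
    let ?y = "\<lambda>i. coord ?B 0 i \<oplus>\<^bsub>?R\<^esub> sscale (- c i) \<one>\<^bsub>?R\<^esub>"
    let ?x = "\<lambda>a. coord ?B (fst a) (snd a)"
    have scale: "sscale t \<one>\<^bsub>?R\<^esub> \<in> carrier ?R" "?h (sscale t \<one>\<^bsub>?R\<^esub>) = sscale t \<one>\<^bsub>?R\<^esub>" for t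
      using sect_scale_closed[of \<beta>, OF B(1)] morphismD(2)[OF g B] ring_hom_one[OF hom] by auto
    have co: "coord ?B 0 i \<in> carrier ?R" if "i < \<beta> 0" for i
      using coord_closed[of \<beta>, OF B(1)] that by simp
    have y: "?y i \<in> carrier ?R" "?h (?y i) = ?y i" if "i < \<beta> 0" for i
      using co[OF that] scale fix_coord'[OF B] that by (auto simp: ring_hom_add[OF hom])
    have x: "?x a \<in> carrier ?R" "?h (?x a) = ?x a" if "a \<in> gens n \<beta>" for a
      using coord_closed[of \<beta>, OF B(1)] fix_coord'[OF B] that by (auto simp: gens_def)
    have hG: "?h (G i) \<in> carrier ?R" if "i < \<beta> 0" for i
      using ring_hom_closed[OF hom GH(1)[OF that]] .
    have hH: "?h (H a) \<in> carrier ?R" if "a \<in> gens n \<beta>" for a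
      using ring_hom_closed[OF hom GH(2)[OF that]] .
    \<comment> \<open>The families \<open>G'\<close> and \<open>H'\<close> are arbitrary because
      this serves twice, for the decomposition of \<open>f'\<close> and for its image under the
      pullback. The factors \<open>?y i\<close> vanish at \<open>c\<close>, so the first sum drops
      out whatever the \<open>G' i\<close> are.\<close>
    have expand: "u = sscale (f' 0 c) \<one>\<^bsub>?R\<^esub> \<oplus>\<^bsub>?R\<^esub>
        (finsum ?R (\<lambda>i. ?y i \<otimes>\<^bsub>?R\<^esub> G' i) {..<\<beta> 0} \<oplus>\<^bsub>?R\<^esub> finsum ?R (\<lambda>a. ?x a \<otimes>\<^bsub>?R\<^esub> H' a) (gens n \<beta>)) \<Longrightarrow>
      u L c = sscale (f' 0 c) \<one>\<^bsub>?R\<^esub> L c + (\<Sum>a\<in>gens n \<beta>. (?x a \<otimes>\<^bsub>?R\<^esub> H' a) L c)"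
      if G': "\<And>i. i < \<beta> 0 \<Longrightarrow> G' i \<in> carrier ?R" and H': "\<And>a. a \<in> gens n \<beta> \<Longrightarrow> H' a \<in> carrier ?R" for u G' H'
    proof -
      have "finsum ?R (\<lambda>i. ?y i \<otimes>\<^bsub>?R\<^esub> G' i) {..<\<beta> 0} L c = (\<Sum>i<\<beta> 0. (?y i \<otimes>\<^bsub>?R\<^esub> G' i) L c)"
        using y G' by (subst sect_finsum[where \<beta> = \<beta>, OF B(1)]) auto
      also have "\<dots> = 0"
      proof (intro sum.neutral ballI)
        fix i assume "i \<in> {..<\<beta> 0}"
        then have "(?y i \<otimes>\<^bsub>?R\<^esub> G' i) L c = ?y i 0 c * G' i L c"
          by (intro sect_mult_concentrated G') (auto simp: sect_add coord_def sscale_def sect_one)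
        then show "(?y i \<otimes>\<^bsub>?R\<^esub> G' i) L c = 0"
          using cB by (simp add: sect_add coord_def sscale_def sect_one)
      qed
      finally have "finsum ?R (\<lambda>i. ?y i \<otimes>\<^bsub>?R\<^esub> G' i) {..<\<beta> 0} L c = 0" .
      moreover have "finsum ?R (\<lambda>a. ?x a \<otimes>\<^bsub>?R\<^esub> H' a) (gens n \<beta>) L c = (\<Sum>a\<in>gens n \<beta>. (?x a \<otimes>\<^bsub>?R\<^esub> H' a) L c)"
        using x H' by (subst sect_finsum[where \<beta> = \<beta>, OF B(1) finite_gens]) auto
      ultimately show "u = sscale (f' 0 c) \<one>\<^bsub>?R\<^esub> \<oplus>\<^bsub>?R\<^esub>
          (finsum ?R (\<lambda>i. ?y i \<otimes>\<^bsub>?R\<^esub> G' i) {..<\<beta> 0} \<oplus>\<^bsub>?R\<^esub> finsum ?R (\<lambda>a. ?x a \<otimes>\<^bsub>?R\<^esub> H' a) (gens n \<beta>)) \<Longrightarrow>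
        u L c = sscale (f' 0 c) \<one>\<^bsub>?R\<^esub> L c + (\<Sum>a\<in>gens n \<beta>. (?x a \<otimes>\<^bsub>?R\<^esub> H' a) L c)"
        by (simp add: sect_add)
    qed
    have fin1: "?h (finsum ?R (\<lambda>i. ?y i \<otimes>\<^bsub>?R\<^esub> G i) {..<\<beta> 0}) = finsum ?R (\<lambda>i. ?y i \<otimes>\<^bsub>?R\<^esub> ?h (G i)) {..<\<beta> 0}"
    proof -
      have "?h (finsum ?R (\<lambda>i. ?y i \<otimes>\<^bsub>?R\<^esub> G i) {..<\<beta> 0}) = finsum ?R (\<lambda>i. ?h (?y i \<otimes>\<^bsub>?R\<^esub> G i)) {..<\<beta> 0}"
        using y GH by (intro ring_hom_finsum[OF ring_axioms ring_axioms hom]) auto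
      also have "\<dots> = finsum ?R (\<lambda>i. ?y i \<otimes>\<^bsub>?R\<^esub> ?h (G i)) {..<\<beta> 0}"
        using y GH hG by (intro finsum_cong') (auto simp: ring_hom_mult[OF hom])
      finally show ?thesis .
    qed
    have fin2: "?h (finsum ?R (\<lambda>a. ?x a \<otimes>\<^bsub>?R\<^esub> H a) (gens n \<beta>)) = finsum ?R (\<lambda>a. ?x a \<otimes>\<^bsub>?R\<^esub> ?h (H a)) (gens n \<beta>)"
    proof -
      have "?h (finsum ?R (\<lambda>a. ?x a \<otimes>\<^bsub>?R\<^esub> H a) (gens n \<beta>)) = finsum ?R (\<lambda>a. ?h (?x a \<otimes>\<^bsub>?R\<^esub> H a)) (gens n \<beta>)"
        using x GH by (intro ring_hom_finsum[OF ring_axioms ring_axioms hom finite_gens]) auto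
      also have "\<dots> = finsum ?R (\<lambda>a. ?x a \<otimes>\<^bsub>?R\<^esub> ?h (H a)) (gens n \<beta>)"
        using x GH hH by (intro finsum_cong') (auto simp: ring_hom_mult[OF hom])
      finally show ?thesis .
    qed
    have cl: "finsum ?R (\<lambda>i. ?y i \<otimes>\<^bsub>?R\<^esub> G i) {..<\<beta> 0} \<in> carrier ?R"
      "finsum ?R (\<lambda>a. ?x a \<otimes>\<^bsub>?R\<^esub> H a) (gens n \<beta>) \<in> carrier ?R"
      using x y GH by (auto intro!: finsum_closed)
    have "?h f' = sscale (f' 0 c) \<one>\<^bsub>?R\<^esub> \<oplus>\<^bsub>?R\<^esub>
        (finsum ?R (\<lambda>i. ?y i \<otimes>\<^bsub>?R\<^esub> ?h (G i)) {..<\<beta> 0} \<oplus>\<^bsub>?R\<^esub> finsum ?R (\<lambda>a. ?x a \<otimes>\<^bsub>?R\<^esub> ?h (H a)) (gens n \<beta>))"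
      by (subst f'_eq) (simp only: ring_hom_add[OF hom] scale cl add.m_closed fin1 fin2)
    from expand[OF hG hH this]
    have "?h f' L c = sscale (f' 0 c) \<one>\<^bsub>?R\<^esub> L c + (\<Sum>a\<in>gens n \<beta>. (?x a \<otimes>\<^bsub>?R\<^esub> ?h (H a)) L c)"
      by simp
    also have "(\<Sum>a\<in>gens n \<beta>. (?x a \<otimes>\<^bsub>?R\<^esub> ?h (H a)) L c) = (\<Sum>a\<in>gens n \<beta>. (?x a \<otimes>\<^bsub>?R\<^esub> H a) L c)"
    proof (rule sum.cong[OF refl])
      fix a assume a: "a \<in> gens n \<beta>"
      then have nz: "fst a \<noteq> 0"
        by (auto simp: gens_def)
      let ?s = "Poly_Mapping.single a 1 :: mindex"
      \<comment> \<open>The generator consumes one step of \<open>L\<close>, so the induction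
        hypothesis applies to \<open>H a\<close>. If \<open>a\<close> does not occur in
        \<open>L\<close>, both products have coefficient 0 there.\<close>
      have "?h (H a) (L - ?s) c = H a (L - ?s) c" if "a \<in> Poly_Mapping.keys L"
      proof (rule less.hyps[OF _ B GH(2)[OF a] cB])
        have "?s + (L - ?s) = L"
          using that by (intro poly_mapping_eqI) (auto simp: lookup_add lookup_minus lookup_single when_def in_keys_iff)
        then show "total_deg (L - ?s) < total_deg L"
          by (rule total_deg_summand_less) (metis lookup_single_eq lookup_zero zero_neq_one)
      qed
      then show "(?x a \<otimes>\<^bsub>?R\<^esub> ?h (H a)) L c = (?x a \<otimes>\<^bsub>?R\<^esub> H a) L c"
        by (simp add: sect_mult_generator[OF nz])
    qed
    also have "sscale (f' 0 c) \<one>\<^bsub>?R\<^esub> L c + (\<Sum>a\<in>gens n \<beta>. (?x a \<otimes>\<^bsub>?R\<^esub> H a) L c) = f' L c"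
      using expand[OF GH f'_eq] by simp
    finally have "?h f' L c = f' L c" .
    moreover have "?h f' = srestrict ?B (pull g W f)"
      using morphismD(4)[OF g W B(1) e(2) f] by (simp add: preim_id[OF B(2)] f'_def)
    ultimately show ?case
      using cB by (simp add: f'_def srestrict_def)
  qed
  fix W f assume W: "openin (Euclidean_space (\<beta> 0)) W" "W \<subseteq> P" and f: "f \<in> carrier (sect n \<beta> W)"
  show "pull g W f = f"
  proof (intro ext)
    fix L x
    have "pull g W f \<in> carrier (sect n \<beta> W)"
      using ring_hom_closed[OF morphismD(1)[OF g W] f] by (simp add: preim_id[OF W(2)])
    then show "pull g W f L x = f L x"
      using main[OF W f] f by (cases "x \<in> W") (auto simp: sect_mem_iff)
  qed
qed

section \<open>The enumeration of the coordinates\<close>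

lemma set_gammas: "set (gammas n) = {a. length a = n}"
proof -
  have "list_all2 (\<lambda>x ys. x \<in> set ys) a (replicate n [0, 1 :: bit]) \<longleftrightarrow> length a = n" for a :: "bit list"
    by (auto simp: list_all2_conv_all_nth)
  then have "set (product_lists (replicate n [0, 1 :: bit])) = {a. length a = n}"
    by (simp add: product_lists_set)
  moreover have "pairing a a = 0 \<or> pairing a a = 1" for a
    by (cases "pairing a a") auto
  ultimately show ?thesis
    by (auto simp: gammas_def Let_def)
qed

lemma distinct_gammas: "distinct (gammas n)"
  by (auto simp: gammas_def Let_def intro!: distinct_product_lists distinct_filter)

lemma length_gammas: "length (gammas n) = 2 ^ n"
proof -
  have "x \<in> {0, 1}" for x :: bit
    by (cases x) auto
  then have "set a \<subseteq> {0, 1}" for a :: "bit list"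
    by blast
  then have "length (gammas n) = card {a :: bit list. set a \<subseteq> {0, 1} \<and> length a = n}"
    using distinct_card[OF distinct_gammas[of n]] by (simp add: set_gammas)
  also have "\<dots> = card {0, 1 :: bit} ^ n"
    by (rule card_lists_length_eq) simp
  finally show ?thesis
    by (simp add: numeral_2_eq_2)
qed

lemma length_gam: "i < 2 ^ n \<Longrightarrow> length (gam n i) = n"
  using nth_mem[of i "gammas n"] by (simp add: length_gammas set_gammas gam_def)

lemma gam_inj: "i < 2 ^ n \<Longrightarrow> j < 2 ^ n \<Longrightarrow> gam n i = gam n j \<longleftrightarrow> i = j"
  by (simp add: gam_def nth_eq_iff_index_eq distinct_gammas length_gammas)

lemma gam_surj:
  assumes "length a = n"
  obtains l where "l < 2 ^ n" "gam n l = a"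
proof -
  have "a \<in> set (gammas n)"
    using assms by (simp add: set_gammas)
  then show ?thesis
    using that by (auto simp: in_set_conv_nth length_gammas gam_def)
qed

text \<open>The number of predecessors is strictly increasing, hence injective, and takes values in
  a set of the same size. \<open>coord_matrix\<close> numbers the positions of each degree by this
  rank.\<close>

lemma bij_betw_rank:
  assumes S: "finite S" and r: "trans r" "irrefl r" "total_on S r"
  shows "bij_betw (\<lambda>z. card {y \<in> S. (y, z) \<in> r}) S {..<card S}"
proof -
  let ?f = "\<lambda>z. card {y \<in> S. (y, z) \<in> r}"
  have less: "?f y < ?f z" if "y \<in> S" "z \<in> S" "(y, z) \<in> r" for y z
  proof (rule psubset_card_mono)
    have "y \<notin> {u \<in> S. (u, y) \<in> r}"
      using r(2) by (simp add: irrefl_def)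
    then show "{u \<in> S. (u, y) \<in> r} \<subset> {u \<in> S. (u, z) \<in> r}"
      using that transD[OF r(1)] by blast
  qed (use S in auto)
  have inj: "inj_on ?f S"
  proof (rule inj_onI)
    fix y z assume yz: "y \<in> S" "z \<in> S" "?f y = ?f z"
    then have "(y, z) \<notin> r" "(z, y) \<notin> r"
      using less[of y z] less[of z y] by auto
    then show "y = z"
      using r(3) yz(1,2) by (auto simp: total_on_def)
  qed
  have "?f z < card S" if "z \<in> S" for z
  proof (rule psubset_card_mono[OF S])
    have "z \<notin> {y \<in> S. (y, z) \<in> r}"
      using r(2) by (simp add: irrefl_def)
    then show "{y \<in> S. (y, z) \<in> r} \<subset> S"
      using that by blast
  qed
  then have "?f ` S \<subseteq> {..<card S}"
    by blast
  then have "?f ` S = {..<card S}"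
    using card_image[OF inj] by (intro card_subset_eq) auto
  then show ?thesis
    using inj by (simp add: bij_betw_def)
qed

lemma finite_positions: "finite (positions n k m l)"
  by (rule finite_subset[of _ "block_ix n k \<times> block_ix n (\<lambda>j. m j - k j)"])
     (auto simp: positions_def finite_block_ix)

text \<open>\<open>beta\<close> counts the entries block by block, \<open>positions\<close> collects
  them one by one. The equality guarantees that the ranks exhaust exactly the numbers of the
  coordinates of that degree.\<close>

lemma card_positions: "card (positions n k m l) = beta n k m l"
proof -
  let ?S = "{(i, j). i < 2 ^ n \<and> j < 2 ^ n \<and> gadd (gam n i) (gam n j) = gam n l}"
  let ?T = "SIGMA z:?S. {..<k (fst z)} \<times> {..<m (snd z) - k (snd z)}"
  have "finite ?S"
    by (rule finite_subset[of _ "{..<2 ^ n} \<times> {..<2 ^ n}"]) auto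
  then have "card ?T = (\<Sum>z\<in>?S. card ({..<k (fst z)} \<times> {..<m (snd z) - k (snd z)}))"
    by (intro card_SigmaI) auto
  also have "\<dots> = beta n k m l"
    by (simp add: beta_def case_prod_beta)
  finally have card_T: "card ?T = beta n k m l" .
  have "bij_betw (\<lambda>(z, w). ((fst z, fst w), (snd z, snd w))) ?T (positions n k m l)"
  proof (rule bij_betw_byWitness[where f' = "\<lambda>(p, q). ((fst p, fst q), (snd p, snd q))"])
    show "(\<lambda>(z, w). ((fst z, fst w), (snd z, snd w))) ` ?T \<subseteq> positions n k m l"
      by (rule image_subsetI, elim SigmaE) (simp add: positions_def block_ix_def case_prod_beta mem_Times_iff)
    show "(\<lambda>(p, q). ((fst p, fst q), (snd p, snd q))) ` positions n k m l \<subseteq> ?T"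
      by (rule image_subsetI) (simp add: positions_def block_ix_def case_prod_beta mem_Sigma_iff)
  qed auto
  from bij_betw_same_card[OF this] show ?thesis
    by (simp only: card_T)
qed

abbreviation position_less :: "(((nat \<times> nat) \<times> (nat \<times> nat)) \<times> ((nat \<times> nat) \<times> (nat \<times> nat))) set" where
  "position_less \<equiv> (less_than <*lex*> less_than) <*lex*> (less_than <*lex*> less_than)"

lemma bij_betw_position_rank:
  "bij_betw (\<lambda>z. card {y \<in> positions n k m l. (y, z) \<in> position_less}) (positions n k m l) {..<beta n k m l}"
proof -
  have "trans position_less"
    by (intro trans_lex_prod trans_less_than)
  moreover have "irrefl position_less"
    by (auto simp: irrefl_def)
  moreover have "total_on (positions n k m l) position_less"
    by (auto simp: total_on_def)
  ultimately show ?thesis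
    using bij_betw_rank[OF finite_positions] by (simp flip: card_positions)
qed

lemma coord_matrix_eq:
  assumes "l < 2 ^ n" "(p, q) \<in> positions n k m l"
  shows "coord_matrix n k m U p q = coord U l (card {y \<in> positions n k m l. (y, (p, q)) \<in> position_less})"
proof -
  have "(THE l. l < 2 ^ n \<and> gam n l = gadd (gam n (fst p)) (gam n (fst q))) = l"
    using assms by (intro the_equality) (auto simp: positions_def gam_inj)
  then show ?thesis
    by (simp add: coord_matrix_def Let_def)
qed

lemma positions_cover:
  assumes "p \<in> block_ix n k" "q \<in> block_ix n (\<lambda>j. m j - k j)"
  obtains l where "l < 2 ^ n" "(p, q) \<in> positions n k m l"
proof -
  have "length (gadd (gam n (fst p)) (gam n (fst q))) = n"
    using assms by (auto simp: gadd_def length_gam block_ix_def)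
  then obtain l where "l < 2 ^ n" "gam n l = gadd (gam n (fst p)) (gam n (fst q))"
    by (rule gam_surj)
  then show ?thesis
    using that assms by (simp add: positions_def)
qed

lemma coord_matrix_is_coord:
  assumes "p \<in> block_ix n k" "q \<in> block_ix n (\<lambda>j. m j - k j)"
  obtains l j where "l < 2 ^ n" "j < beta n k m l" "\<And>U. coord_matrix n k m U p q = coord U l j"
proof -
  obtain l where l: "l < 2 ^ n" "(p, q) \<in> positions n k m l"
    using positions_cover[OF assms] by blast
  then have "card {y \<in> positions n k m l. (y, (p, q)) \<in> position_less} < beta n k m l"
    using bij_betwE[OF bij_betw_position_rank] by blast
  then show ?thesis
    using that l coord_matrix_eq by blast
qed

text \<open>Surjectivity of the labelling, through which control over the entries of a chart matrix
  becomes control over all coordinates. The position found does not depend on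
  \<open>U\<close>.\<close>

lemma coord_is_coord_matrix:
  assumes "l < 2 ^ n" "j < beta n k m l"
  obtains p q where "p \<in> block_ix n k" "q \<in> block_ix n (\<lambda>j. m j - k j)" "\<And>U. coord_matrix n k m U p q = coord U l j"
proof -
  have "j \<in> (\<lambda>z. card {y \<in> positions n k m l. (y, z) \<in> position_less}) ` positions n k m l"
    using bij_betw_position_rank[of n k m l] assms(2) by (simp add: bij_betw_def)
  then obtain p q where pq: "(p, q) \<in> positions n k m l"
      "j = card {y \<in> positions n k m l. (y, (p, q)) \<in> position_less}"
    by auto
  then have "p \<in> block_ix n k" "q \<in> block_ix n (\<lambda>j. m j - k j)"
    by (simp_all add: positions_def)
  moreover have "coord_matrix n k m U p q = coord U l j" for U
    using coord_matrix_eq[OF assms(1) pq(1)] pq(2) by simp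
  ultimately show ?thesis
    by (rule that)
qed

section \<open>The matrices of the charts\<close>

lemma nth_sorted_rank_in:
  assumes "finite S" "b \<in> S"
  shows "rank_in S b < card S" "sorted_list_of_set S ! rank_in S b = b"
proof -
  obtain c where "c < card S" "sorted_list_of_set S ! c = b"
    using assms by (metis in_set_conv_nth length_sorted_list_of_set set_sorted_list_of_set)
  then show "rank_in S b < card S" "sorted_list_of_set S ! rank_in S b = b"
    using nth_sorted_rank(2)[OF assms(1)] by auto
qed

lemma k_index_finite:
  assumes "k_index n k m I"
  shows "finite (I j)"
proof (cases "j < 2 ^ n")
  case True
  then have "I j \<subseteq> {..<m j}"
    using assms by (simp add: k_index_def)
  then show ?thesis
    by (rule finite_subset) simp
qed (use assms in \<open>simp add: k_index_def\<close>)

lemma sel_index_mem: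
  assumes "k_index n k m I" "(j, c) \<in> block_ix n k"
  shows "(j, sorted_list_of_set (I j) ! c) \<in> block_ix n m"
proof -
  have "I j \<subseteq> {..<m j}" "c < card (I j)" "j < 2 ^ n"
    using assms by (auto simp: k_index_def block_ix_def)
  then show ?thesis
    using nth_sorted_rank(1)[OF k_index_finite[OF assms(1)], of c j] by (auto simp: block_ix_def)
qed

lemma del_index_mem:
  assumes "k_index n k m I" "(j, c) \<in> block_ix n (\<lambda>j. m j - k j)"
  shows "(j, sorted_list_of_set ({..<m j} - I j) ! c) \<in> block_ix n m"
proof -
  have "I j \<subseteq> {..<m j}" "card (I j) = k j" "j < 2 ^ n" "c < m j - k j"
    using assms by (auto simp: k_index_def block_ix_def)
  then have "c < card ({..<m j} - I j)"
    by (simp add: card_Diff_subset finite_subset)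
  from nth_sorted_rank(1)[OF _ this] show ?thesis
    using \<open>j < 2 ^ n\<close> by (auto simp: block_ix_def)
qed

lemma del_rank_mem:
  assumes "k_index n k m I" "(j, b) \<in> block_ix n m" "b \<notin> I j"
  shows "(j, rank_in ({..<m j} - I j) b) \<in> block_ix n (\<lambda>j. m j - k j)"
    "sorted_list_of_set ({..<m j} - I j) ! rank_in ({..<m j} - I j) b = b"
proof -
  have "I j \<subseteq> {..<m j}" "card (I j) = k j" "j < 2 ^ n" "b \<in> {..<m j} - I j"
    using assms by (auto simp: k_index_def block_ix_def)
  then show "(j, rank_in ({..<m j} - I j) b) \<in> block_ix n (\<lambda>j. m j - k j)"
    "sorted_list_of_set ({..<m j} - I j) ! rank_in ({..<m j} - I j) b = b"
    using nth_sorted_rank_in[of "{..<m j} - I j" b]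
    by (simp_all add: block_ix_def card_Diff_subset finite_subset)
qed

lemma sel_rank_mem:
  assumes "k_index n k m I" "(j, b) \<in> block_ix n m" "b \<in> I j"
  shows "(j, rank_in (I j) b) \<in> block_ix n k" "sorted_list_of_set (I j) ! rank_in (I j) b = b"
proof -
  have "card (I j) = k j" "j < 2 ^ n"
    using assms by (auto simp: k_index_def block_ix_def)
  then show "(j, rank_in (I j) b) \<in> block_ix n k" "sorted_list_of_set (I j) ! rank_in (I j) b = b"
    using nth_sorted_rank_in[OF k_index_finite[OF assms(1)] assms(3)] by (simp_all add: block_ix_def)
qed

lemma chart_matrix_closed:
  assumes I: "k_index n k m I" and U: "openin (Euclidean_space (beta n k m 0)) U"
    and p: "p \<in> block_ix n k" and q: "q \<in> block_ix n m"
  shows "chart_matrix n k m I U p q \<in> carrier (sect n (beta n k m) U)"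
proof -
  obtain j b where jb: "q = (j, b)"
    by force
  show ?thesis
  proof (cases "b \<in> I j")
    case True
    then show ?thesis
      using sect_one_closed[of "beta n k m", OF U] sect_zero_closed[of "beta n k m", OF U]
      by (simp add: jb chart_matrix_def bone_def)
  next
    case False
    obtain l i where "l < 2 ^ n" "i < beta n k m l"
      "coord_matrix n k m U p (j, rank_in ({..<m j} - I j) b) = coord U l i"
      using coord_matrix_is_coord[OF p del_rank_mem(1)[OF I q[unfolded jb] False]] by metis
    then show ?thesis
      using False coord_closed[of "beta n k m", OF U] by (simp add: jb chart_matrix_def)
  qed
qed

lemma srestrict_bone: "V \<subseteq> U \<Longrightarrow> srestrict V (bone (sect n \<beta> U) p q) = bone (sect n \<beta> V) p q"
  by (auto simp: bone_def srestrict_def sect_one sect_zero fun_eq_iff)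

lemma srestrict_chart_matrix:
  "V \<subseteq> U \<Longrightarrow> srestrict V (chart_matrix n k m I U p q) = chart_matrix n k m I V p q"
  by (cases q) (simp add: chart_matrix_def coord_matrix_def Let_def srestrict_bone srestrict_coord)

lemma sval_chart_matrix:
  assumes "V \<subseteq> U" "x \<in> V"
  shows "sval (chart_matrix n k m I V p q) x = sval (chart_matrix n k m I U p q) x"
  using srestrict_chart_matrix[OF assms(1), of n k m I p q] assms(2)
  by (metis (no_types, lifting) srestrict_def sval_def)

section \<open>Restriction, evaluation and the transport of inverse matrices\<close>

lemma srestrict_ring_hom:
  assumes "openin (Euclidean_space (\<beta> 0)) V" "V \<subseteq> U"
  shows "srestrict V \<in> Ring.ring_hom (sect n \<beta> U) (sect n \<beta> V)"
proof (rule ring_hom_memI)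
  show "srestrict V (f \<otimes>\<^bsub>sect n \<beta> U\<^esub> g) = srestrict V f \<otimes>\<^bsub>sect n \<beta> V\<^esub> srestrict V g" for f g
    by (auto simp: sect_mult srestrict_def fun_eq_iff case_prod_beta)
  show "srestrict V f \<in> carrier (sect n \<beta> V)" if "f \<in> carrier (sect n \<beta> U)" for f
    using srestrict_closed that assms by blast
qed (use assms in \<open>auto simp: sect_add sect_one srestrict_def fun_eq_iff\<close>)

lemma sval_ring_hom:
  assumes "x \<in> U"
  shows "(\<lambda>f. sval f x) \<in> Ring.ring_hom (sect n \<beta> U) real_ring"
  using assms by (intro ring_hom_memI) (auto simp: sval_def sect_mult_0 sect_add sect_one real_ring_def)

context ring
begin

lemma is_binvD:
  assumes "is_binv R K A X" "p \<in> K" "q \<in> K"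
  shows "X p q \<in> carrier R" "bmult R K A X p q = bone R p q" "bmult R K X A p q = bone R p q"
  using assms by (auto simp: is_binv_def)

lemma is_binv_sym:
  assumes "is_binv R K A X" "\<And>p q. p \<in> K \<Longrightarrow> q \<in> K \<Longrightarrow> A p q \<in> carrier R"
  shows "is_binv R K X A"
  using assms by (auto simp: is_binv_def)

text \<open>\<open>C\<close> is given through its entries on \<open>K\<close> because a block matrix
  is a function on all pairs of indices, while the available equations hold on \<open>K\<close>
  only.\<close>

lemma is_binv_bmult:
  assumes K: "finite K"
    and A: "\<And>p q. p \<in> K \<Longrightarrow> q \<in> K \<Longrightarrow> A p q \<in> carrier R" "is_binv R K A X"
    and B: "\<And>p q. p \<in> K \<Longrightarrow> q \<in> K \<Longrightarrow> B p q \<in> carrier R" "is_binv R K B Y"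
    and C: "\<And>p q. p \<in> K \<Longrightarrow> q \<in> K \<Longrightarrow> C p q = bmult R K A B p q"
  shows "is_binv R K C (bmult R K Y X)"
proof -
  note X = is_binvD[OF A(2)] and Y = is_binvD[OF B(2)]
  \<comment> \<open>Stated for arbitrary matrices, because the second application exchanges the
    roles and yields \<open>(Y X) (A B) = 1\<close>.\<close>
  have main: "bmult R K (bmult R K A B) (bmult R K Y X) p q = bone R p q"
    if K: "finite K" "p \<in> K" "q \<in> K"
      and A: "\<And>p q. p \<in> K \<Longrightarrow> q \<in> K \<Longrightarrow> A p q \<in> carrier R" "\<And>p q. p \<in> K \<Longrightarrow> q \<in> K \<Longrightarrow> X p q \<in> carrier R"
        "\<And>p q. p \<in> K \<Longrightarrow> q \<in> K \<Longrightarrow> bmult R K A X p q = bone R p q"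
      and B: "\<And>p q. p \<in> K \<Longrightarrow> q \<in> K \<Longrightarrow> B p q \<in> carrier R" "\<And>p q. p \<in> K \<Longrightarrow> q \<in> K \<Longrightarrow> Y p q \<in> carrier R"
        "\<And>p q. p \<in> K \<Longrightarrow> q \<in> K \<Longrightarrow> bmult R K B Y p q = bone R p q"
    for p q A B X Y
  proof -
    have "bmult R K B (bmult R K Y X) r q = X r q" if "r \<in> K" for r
    proof -
      have "bmult R K B (bmult R K Y X) r q = bmult R K (bmult R K B Y) X r q"
        by (rule bmult_assoc[symmetric]) (simp_all add: K A B that)
      also have "\<dots> = bmult R K (bone R) X r q"
        by (rule bmult_cong) (simp_all add: K A B that)
      also have "\<dots> = X r q"
        by (rule bmult_one_left) (simp_all add: K A B that)
      finally show ?thesis .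
    qed
    then have "bmult R K A (bmult R K B (bmult R K Y X)) p q = bmult R K A X p q"
      by (intro bmult_cong) (simp_all add: K A B)
    moreover have "bmult R K (bmult R K A B) (bmult R K Y X) p q = bmult R K A (bmult R K B (bmult R K Y X)) p q"
      by (rule bmult_assoc) (simp_all add: K A B bmult_closed)
    ultimately show ?thesis
      using A K by simp
  qed
  have "bmult R K C (bmult R K Y X) p q = bone R p q" if "p \<in> K" "q \<in> K" for p q
  proof -
    have "bmult R K C (bmult R K Y X) p q = bmult R K (bmult R K A B) (bmult R K Y X) p q"
      by (rule bmult_cong) (simp_all add: that A B C X Y bmult_closed)
    then show ?thesis
      using main[OF K that A(1) X(1,2) B(1) Y(1,2)] by simp
  qed
  moreover have "bmult R K (bmult R K Y X) C p q = bone R p q" if "p \<in> K" "q \<in> K" for p q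
  proof -
    have "bmult R K (bmult R K Y X) C p q = bmult R K (bmult R K Y X) (bmult R K A B) p q"
      by (rule bmult_cong) (simp_all add: that A B C X Y bmult_closed)
    then show ?thesis
      using main[OF K that Y(1) B(1) Y(3) X(1) A(1) X(3)] by simp
  qed
  moreover have "bmult R K Y X p q \<in> carrier R" if "p \<in> K" "q \<in> K" for p q
    using that X Y by (intro bmult_closed) auto
  ultimately show ?thesis
    by (simp add: is_binv_def)
qed

end

lemma ring_hom_is_binv:
  assumes "ring R" "ring S" "h \<in> Ring.ring_hom R S" "finite K"
    and A: "\<And>p q. p \<in> K \<Longrightarrow> q \<in> K \<Longrightarrow> A p q \<in> carrier R" and X: "is_binv R K A X"
  shows "is_binv S K (\<lambda>p q. h (A p q)) (\<lambda>p q. h (X p q))"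
proof -
  note X' = ring.is_binvD[OF assms(1) X]
  have "bmult S K (\<lambda>p q. h (A p q)) (\<lambda>p q. h (X p q)) p q = bone S p q"
    and "bmult S K (\<lambda>p q. h (X p q)) (\<lambda>p q. h (A p q)) p q = bone S p q" if "p \<in> K" "q \<in> K" for p q
    using ring_hom_bmult[OF assms(1-4), of A p X q] ring_hom_bmult[OF assms(1-4), of X p A q]
      A X' that ring_hom_bone[OF assms(1-3), of p q] by auto
  then show ?thesis
    using ring_hom_closed[OF assms(3)] X'(1) by (simp add: is_binv_def)
qed

section \<open>Transition maps\<close>

lemma openin_overlap:
  assumes I: "k_index n k m I" and J: "k_index n k m J"
  shows "openin (Euclidean_space (beta n k m 0)) (overlap n k m I J)"
proof -
  let ?E = "topspace (Euclidean_space (beta n k m 0))"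
  have "smooth_on (beta n k m 0) ?E (\<lambda>x. sval (sel_cols J (chart_matrix n k m I ?E) p q) x)"
    if "p \<in> block_ix n k" "q \<in> block_ix n k" for p q
    using chart_matrix_closed[OF I openin_topspace that(1) sel_index_mem[OF J, of "fst q" "snd q"]] that(2)
    by (simp add: sel_cols_def case_prod_beta sval_def[abs_def] sect_mem_iff)
  from smooth_invertible_matrices(1)[OF openin_topspace finite_block_ix this]
  show ?thesis
    by (simp add: overlap_def)
qed

text \<open>The equation covers all columns of the chart matrix, those of the identity included.
  Forgetting that \<open>C\<close> arises as an inverse gives a property that passes directly to
  open subsets and to composites.\<close>

definition chart_multiple ::
    "nat \<Rightarrow> (nat \<Rightarrow> nat) \<Rightarrow> (nat \<Rightarrow> nat) \<Rightarrow> (nat \<Rightarrow> nat set) \<Rightarrow> (nat \<Rightarrow> nat set) \<Rightarrow>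
     (nat \<Rightarrow> real) set \<Rightarrow> (nat \<Rightarrow> real) set \<Rightarrow> morph \<Rightarrow> bool" where
  "chart_multiple n k m I J U V g \<longleftrightarrow> (\<exists>C.
     (\<forall>p\<in>block_ix n k. \<forall>q\<in>block_ix n k. C p q \<in> carrier (sect n (beta n k m) U)) \<and>
     (\<forall>p\<in>block_ix n k. \<forall>q\<in>block_ix n m. pull g V (chart_matrix n k m I V p q) =
        bmult (sect n (beta n k m) U) (block_ix n k) C (chart_matrix n k m J U) p q))"

locale transition =
  fixes n :: nat and k m :: "nat \<Rightarrow> nat" and I J :: "nat \<Rightarrow> nat set" and g :: morph
  assumes I: "k_index n k m I" and J: "k_index n k m J" and g: "transition_morphism n k m I J g"
begin

abbreviation "\<beta> \<equiv> beta n k m"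
abbreviation "K \<equiv> block_ix n k"
abbreviation "U \<equiv> overlap n k m J I"
abbreviation "V \<equiv> overlap n k m I J"

lemma U: "openin (Euclidean_space (\<beta> 0)) U" and V: "openin (Euclidean_space (\<beta> 0)) V"
  by (rule openin_overlap[OF J I], rule openin_overlap[OF I J])

lemma morphism_g: "morphism n \<beta> U \<beta> V g"
  using g by (simp add: transition_morphism_def Let_def)

lemma sel_closed: "p \<in> K \<Longrightarrow> q \<in> K \<Longrightarrow> sel_cols I (chart_matrix n k m J U) p q \<in> carrier (sect n \<beta> U)"
  using chart_matrix_closed[OF J U, of p "(fst q, sorted_list_of_set (I (fst q)) ! snd q)"]
    sel_index_mem[OF I, of "fst q" "snd q"]
  by (simp add: sel_cols_def case_prod_beta)

abbreviation "sel_inverse \<equiv> binv (sect n \<beta> U) K (sel_cols I (chart_matrix n k m J U))"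

text \<open>The transition morphism is prescribed on the deleted columns only. On the columns in
  \<open>I\<close> the same formula holds by itself: the pullback preserves 0 and 1, and
  \<open>(M_I A_J)^-1 M_I A_J = 1\<close>.\<close>

lemma is_binv_sel_inverse: "is_binv (sect n \<beta> U) K (sel_cols I (chart_matrix n k m J U)) sel_inverse"
  and pull_chart_matrix: "\<And>p q. p \<in> K \<Longrightarrow> q \<in> block_ix n m \<Longrightarrow>
    pull g V (chart_matrix n k m I V p q) = bmult (sect n \<beta> U) K sel_inverse (chart_matrix n k m J U) p q"
proof -
  let ?R = "sect n \<beta> U"
  let ?A = "sel_cols I (chart_matrix n k m J U)"
  let ?X = sel_inverse
  interpret R: ring ?R
    by (rule ring_sect[of \<beta>, OF U])
  have "\<exists>X. is_binv ?R K ?A X"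
  proof (rule sect_matrix_invertible[where \<beta> = \<beta>, OF U finite_block_ix sel_closed])
    fix x assume x: "x \<in> U"
    let ?E = "topspace (Euclidean_space (\<beta> 0))"
    have "sval (?A p q) x = sval (sel_cols I (chart_matrix n k m J ?E) p q) x" for p q
      using sval_chart_matrix[OF openin_subset[OF U] x] by (simp add: sel_cols_def case_prod_beta)
    then show "\<exists>X. is_binv real_ring K (\<lambda>p q. sval (?A p q) x) X"
      using x by (simp add: overlap_def)
  qed
  \<comment> \<open>\<open>binv\<close> is a choice; it is an inverse because one exists, the values
    being invertible at every point of the overlap.\<close>
  then show inv: "is_binv ?R K ?A ?X"
    unfolding binv_def by (rule someI_ex)
  show "pull g V (chart_matrix n k m I V p q) = bmult ?R K ?X (chart_matrix n k m J U) p q"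
    if p: "p \<in> K" and q: "q \<in> block_ix n m" for p q
  proof -
    obtain j b where jb: "q = (j, b)"
      by force
    note hom = morphismD(1)[OF morphism_g V order.refl]
    have preim_V: "preim g U V = U"
      using morphism_base_mem[OF morphism_g U] by (auto simp: preim_def)
    show ?thesis
    proof (cases "b \<in> I j")
      case True
      note sel = sel_rank_mem[OF I q[unfolded jb] True]
      have "pull g V (chart_matrix n k m I V p q) = bone ?R p (j, rank_in (I j) b)"
        using True ring_hom_bone[OF ring_sect[of \<beta>, OF V] R.ring_axioms hom[unfolded preim_V]]
        by (simp add: jb chart_matrix_def)
      also have "\<dots> = bmult ?R K ?X ?A p (j, rank_in (I j) b)"
        using R.is_binvD(3)[OF inv p sel(1)] by simp
      also have "\<dots> = bmult ?R K ?X (chart_matrix n k m J U) p q"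
        by (simp add: bmult_def sel_cols_def sel(2) jb)
      finally show ?thesis .
    next
      case False
      note del = del_rank_mem[OF I q[unfolded jb] False]
      have "pull g V (del_cols m I (chart_matrix n k m I V) p (j, rank_in ({..<m j} - I j) b))
          = del_cols m I (bmult ?R K ?X (chart_matrix n k m J U)) p (j, rank_in ({..<m j} - I j) b)"
        using g p del(1) by (simp add: transition_morphism_def Let_def)
      then show ?thesis
        by (simp add: del_cols_def del(2) jb)
    qed
  qed
qed

lemma chart_multiple_g: "chart_multiple n k m I J U V g"
  unfolding chart_multiple_def
  by (intro exI[of _ sel_inverse]) (use is_binv_sel_inverse pull_chart_matrix in \<open>auto simp: is_binv_def\<close>)

text \<open>At the level of values, \<open>M\<^sub>S A\<^sub>I = (M\<^sub>I A\<^sub>J)\<^sup>-\<^sup>1 M\<^sub>S A\<^sub>J\<close>, so both sides are invertible at the same points.\<close>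

lemma overlap_iff:
  assumes S: "k_index n k m S" and y: "y \<in> U"
  shows "base g y \<in> overlap n k m I S \<longleftrightarrow> y \<in> overlap n k m J S"
proof -
  let ?E = "topspace (Euclidean_space (\<beta> 0))"
  let ?x = "base g y"
  interpret real: ring real_ring
    by (rule ring_real_ring)
  have carrier_real [simp]: "a \<in> carrier real_ring" for a
    by (simp add: real_ring_def)
  have x: "?x \<in> V"
    by (rule morphism_base_mem[OF morphism_g U y])
  define AI where "AI T p q = sval (sel_cols T (chart_matrix n k m I ?E) p q) ?x" for T p q
  define AJ where "AJ T p q = sval (sel_cols T (chart_matrix n k m J ?E) p q) y" for T p q
  note X = is_binv_sel_inverse and eq = pull_chart_matrix
  define Y where "Y p q = sval (sel_inverse p q) y" for p q
  note ring_U = ring_sect[of \<beta>, OF U] and hom = sval_ring_hom[OF y, of n \<beta>]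
  have AJ_U: "AJ T p q = sval (sel_cols T (chart_matrix n k m J U) p q) y" for T p q
    using sval_chart_matrix[OF openin_subset[OF U] y] by (simp add: AJ_def sel_cols_def case_prod_beta)
  have "is_binv real_ring K (\<lambda>p q. sval (sel_cols I (chart_matrix n k m J U) p q) y)
      (\<lambda>p q. sval (sel_inverse p q) y)"
    by (rule ring_hom_is_binv[OF ring_U ring_real_ring hom finite_block_ix sel_closed X])
  then have AJY: "is_binv real_ring K (AJ I) Y"
    by (simp add: AJ_U[abs_def] Y_def[abs_def])
  have AI_eq: "AI S p q = bmult real_ring K Y (AJ S) p q" if "p \<in> K" "q \<in> K" for p q
  proof -
    let ?q = "(fst q, sorted_list_of_set (S (fst q)) ! snd q)"
    have q: "?q \<in> block_ix n m"
      using sel_index_mem[OF S, of "fst q" "snd q"] that(2) by simp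
    have "AI S p q = sval (chart_matrix n k m I V p ?q) ?x"
      using sval_chart_matrix[OF openin_subset[OF V] x] by (simp add: AI_def sel_cols_def case_prod_beta)
    also have "\<dots> = sval (pull g V (chart_matrix n k m I V p ?q)) y"
      by (rule sval_pull[OF morphism_g U V order.refl, symmetric])
         (use chart_matrix_closed[OF I V that(1) q] x y in \<open>auto simp: preim_def\<close>)
    also have "\<dots> = sval (bmult (sect n \<beta> U) K sel_inverse (chart_matrix n k m J U) p ?q) y"
      using eq[OF that(1) q] by simp
    also have "\<dots> = bmult real_ring K (\<lambda>p q. sval (sel_inverse p q) y) (\<lambda>p q. sval (chart_matrix n k m J U p q) y) p ?q"
      by (rule ring_hom_bmult[OF ring_U ring_real_ring hom finite_block_ix])
         (use ring.is_binvD(1)[OF ring_U X that(1)] chart_matrix_closed[OF J U _ q] in auto)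
    also have "\<dots> = bmult real_ring K Y (AJ S) p q"
      by (simp add: bmult_def Y_def AJ_U sel_cols_def case_prod_beta)
    finally show ?thesis .
  qed
  \<comment> \<open>With the equation solved back for \<open>J\<close>, invertibility passes in both
    directions, each time as that of a product of invertible matrices.\<close>
  have AJ_eq: "AJ S p q = bmult real_ring K (AJ I) (AI S) p q" if "p \<in> K" "q \<in> K" for p q
  proof -
    have "bmult real_ring K (AJ I) (AI S) p q = bmult real_ring K (AJ I) (bmult real_ring K Y (AJ S)) p q"
      by (rule real.bmult_cong) (use that AI_eq in auto)
    also have "\<dots> = bmult real_ring K (bmult real_ring K (AJ I) Y) (AJ S) p q"
      by (rule real.bmult_assoc[symmetric]) (auto simp: finite_block_ix)
    also have "\<dots> = bmult real_ring K (bone real_ring) (AJ S) p q"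
      by (rule real.bmult_cong) (use that real.is_binvD[OF AJY] in auto)
    also have "\<dots> = AJ S p q"
      by (rule real.bmult_one_left) (use that finite_block_ix in auto)
    finally show ?thesis
      by simp
  qed
  have "(\<exists>Z. is_binv real_ring K (AI S) Z) \<longleftrightarrow> (\<exists>Z. is_binv real_ring K (AJ S) Z)"
  proof
    assume "\<exists>Z. is_binv real_ring K (AI S) Z"
    then show "\<exists>Z. is_binv real_ring K (AJ S) Z"
      using real.is_binv_bmult[OF finite_block_ix _ AJY _ _ AJ_eq] carrier_real by blast
  next
    assume "\<exists>Z. is_binv real_ring K (AJ S) Z"
    then show "\<exists>Z. is_binv real_ring K (AI S) Z"
      using real.is_binv_bmult[OF finite_block_ix _ real.is_binv_sym[OF AJY] _ _ AI_eq] carrier_real by blast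
  qed
  moreover have "?x \<in> ?E" "y \<in> ?E"
    using x y openin_subset[OF U] openin_subset[OF V] by auto
  ultimately show ?thesis
    by (simp add: overlap_def AI_def[abs_def] AJ_def[abs_def])
qed

end

lemma chart_multiple_restrict:
  assumes g: "morphism n (beta n k m) U (beta n k m) V g"
    and U: "openin (Euclidean_space (beta n k m 0)) U" and V: "openin (Euclidean_space (beta n k m 0)) V"
    and W: "openin (Euclidean_space (beta n k m 0)) W" "W \<subseteq> V"
    and I: "k_index n k m I" and J: "k_index n k m J"
    and mult: "chart_multiple n k m I J U V g"
  shows "chart_multiple n k m I J (preim g U W) W g"
proof -
  let ?\<beta> = "beta n k m" and ?K = "block_ix n k" and ?P = "preim g U W"
  have P: "openin (Euclidean_space (?\<beta> 0)) ?P" "?P \<subseteq> U"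
    using openin_preim[OF g U W] by (auto simp: preim_def)
  obtain C where C: "\<And>p q. p \<in> ?K \<Longrightarrow> q \<in> ?K \<Longrightarrow> C p q \<in> carrier (sect n ?\<beta> U)"
    and eq: "\<And>p q. p \<in> ?K \<Longrightarrow> q \<in> block_ix n m \<Longrightarrow> pull g V (chart_matrix n k m I V p q) =
        bmult (sect n ?\<beta> U) ?K C (chart_matrix n k m J U) p q"
    using mult unfolding chart_multiple_def by blast
  have "pull g W (chart_matrix n k m I W p q) =
      bmult (sect n ?\<beta> ?P) ?K (\<lambda>p q. srestrict ?P (C p q)) (chart_matrix n k m J ?P) p q"
    if "p \<in> ?K" "q \<in> block_ix n m" for p q
  proof -
    have "pull g W (chart_matrix n k m I W p q) = srestrict ?P (pull g V (chart_matrix n k m I V p q))"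
      using morphismD(4)[OF g V order.refl W chart_matrix_closed[OF I V that]]
      by (simp add: srestrict_chart_matrix[OF W(2)])
    also have "\<dots> = srestrict ?P (bmult (sect n ?\<beta> U) ?K C (chart_matrix n k m J U) p q)"
      by (simp add: eq[OF that])
    also have "\<dots> = bmult (sect n ?\<beta> ?P) ?K (\<lambda>p q. srestrict ?P (C p q))
        (\<lambda>p q. srestrict ?P (chart_matrix n k m J U p q)) p q"
      by (rule ring_hom_bmult[OF ring_sect[of ?\<beta>, OF U] ring_sect[of ?\<beta>, OF P(1)]
            srestrict_ring_hom[of ?\<beta>, OF P] finite_block_ix])
         (use C chart_matrix_closed[OF J U] that in auto)
    finally show ?thesis
      by (simp add: srestrict_chart_matrix[OF P(2)])
  qed
  moreover have "srestrict ?P (C p q) \<in> carrier (sect n ?\<beta> ?P)" if "p \<in> ?K" "q \<in> ?K" for p q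
    by (rule srestrict_closed[OF C[OF that] P(2,1)])
  ultimately show ?thesis
    unfolding chart_multiple_def by (intro exI[of _ "\<lambda>p q. srestrict ?P (C p q)"]) blast
qed

text \<open>The factors multiply: \<open>h^*(C A_J) = h^*(C) D A_S\<close>, as \<open>h^*\<close> is
  a ring homomorphism applied entry by entry.\<close>

lemma chart_multiple_comp:
  assumes h: "morphism n (beta n k m) T (beta n k m) U h" and g: "morphism n (beta n k m) U (beta n k m) V g"
    and T: "openin (Euclidean_space (beta n k m 0)) T" and U: "openin (Euclidean_space (beta n k m 0)) U"
    and V: "openin (Euclidean_space (beta n k m 0)) V"
    and J: "k_index n k m J" and S: "k_index n k m S"
    and mult_h: "chart_multiple n k m J S T U h" and mult_g: "chart_multiple n k m I J U V g"
  shows "chart_multiple n k m I S T V (comp_morph U g h)"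
proof -
  let ?\<beta> = "beta n k m" and ?K = "block_ix n k"
  let ?RU = "sect n ?\<beta> U" and ?RT = "sect n ?\<beta> T"
  obtain C where C: "\<And>p q. p \<in> ?K \<Longrightarrow> q \<in> ?K \<Longrightarrow> C p q \<in> carrier ?RU"
    and eqC: "\<And>p q. p \<in> ?K \<Longrightarrow> q \<in> block_ix n m \<Longrightarrow> pull g V (chart_matrix n k m I V p q) =
        bmult ?RU ?K C (chart_matrix n k m J U) p q"
    using mult_g unfolding chart_multiple_def by blast
  obtain D where D: "\<And>p q. p \<in> ?K \<Longrightarrow> q \<in> ?K \<Longrightarrow> D p q \<in> carrier ?RT"
    and eqD: "\<And>p q. p \<in> ?K \<Longrightarrow> q \<in> block_ix n m \<Longrightarrow> pull h U (chart_matrix n k m J U p q) =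
        bmult ?RT ?K D (chart_matrix n k m S T) p q"
    using mult_h unfolding chart_multiple_def by blast
  interpret RT: ring ?RT
    by (rule ring_sect[of ?\<beta>, OF T])
  have "preim h T U = T" and preim_V: "preim g U V = U"
    using morphism_base_mem[OF h T] morphism_base_mem[OF g U] by (auto simp: preim_def)
  then have hom: "pull h U \<in> Ring.ring_hom ?RU ?RT"
    using morphismD(1)[OF h U order.refl] by simp
  define C' where "C' p q = pull h U (C p q)" for p q
  have C'_eq: "(\<lambda>p q. pull h U (C p q)) = C'"
    by (simp add: fun_eq_iff C'_def)
  have C': "C' p q \<in> carrier ?RT" if "p \<in> ?K" "q \<in> ?K" for p q
    unfolding C'_def by (rule ring_hom_closed[OF hom C[OF that]])
  have "pull (comp_morph U g h) V (chart_matrix n k m I V p q) =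
      bmult ?RT ?K (bmult ?RT ?K C' D) (chart_matrix n k m S T) p q"
    if p: "p \<in> ?K" and q: "q \<in> block_ix n m" for p q
  proof -
    have "pull (comp_morph U g h) V (chart_matrix n k m I V p q) = pull h U (bmult ?RU ?K C (chart_matrix n k m J U) p q)"
      by (simp add: comp_morph_def preim_V eqC[OF p q])
    also have "\<dots> = bmult ?RT ?K C' (\<lambda>p q. pull h U (chart_matrix n k m J U p q)) p q"
      unfolding C'_eq[symmetric]
      by (rule ring_hom_bmult[OF ring_sect[of ?\<beta>, OF U] RT.ring_axioms hom finite_block_ix])
         (use C chart_matrix_closed[OF J U] p q in auto)
    also have "\<dots> = bmult ?RT ?K C' (bmult ?RT ?K D (chart_matrix n k m S T)) p q"
      by (rule RT.bmult_cong)
         (simp_all add: C' D eqD p q chart_matrix_closed[OF S T] RT.bmult_closed)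
    also have "\<dots> = bmult ?RT ?K (bmult ?RT ?K C' D) (chart_matrix n k m S T) p q"
      by (rule RT.bmult_assoc[symmetric]) (simp_all add: C' D p q chart_matrix_closed[OF S T] finite_block_ix)
    finally show ?thesis .
  qed
  moreover have "bmult ?RT ?K C' D p q \<in> carrier ?RT" if "p \<in> ?K" "q \<in> ?K" for p q
    using C' D that by (intro RT.bmult_closed) auto
  ultimately show ?thesis
    unfolding chart_multiple_def by (intro exI[of _ "bmult ?RT ?K C' D"]) blast
qed

text \<open>If \<open>g\<^sup>*A\<^sub>I = C A\<^sub>I\<close>, then selecting the columns of \<open>I\<close> gives \<open>C = 1\<close>.\<close>

lemma chart_multiple_self:
  assumes g: "morphism n (beta n k m) P (beta n k m) P g"
    and P: "openin (Euclidean_space (beta n k m 0)) P" and I: "k_index n k m I"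
    and mult: "chart_multiple n k m I I P P g"
  shows "\<And>W. openin (Euclidean_space (beta n k m 0)) W \<Longrightarrow> W \<subseteq> P \<Longrightarrow> preim g P W = W"
    and "\<And>W f. openin (Euclidean_space (beta n k m 0)) W \<Longrightarrow> W \<subseteq> P \<Longrightarrow>
      f \<in> carrier (sect n (beta n k m) W) \<Longrightarrow> pull g W f = f"
proof -
  let ?\<beta> = "beta n k m" and ?K = "block_ix n k"
  let ?R = "sect n ?\<beta> P" and ?A = "chart_matrix n k m I P"
  obtain C where C: "\<And>p q. p \<in> ?K \<Longrightarrow> q \<in> ?K \<Longrightarrow> C p q \<in> carrier ?R"
    and eq: "\<And>p q. p \<in> ?K \<Longrightarrow> q \<in> block_ix n m \<Longrightarrow> pull g P (?A p q) = bmult ?R ?K C ?A p q"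
    using mult unfolding chart_multiple_def by blast
  interpret ring ?R
    by (rule ring_sect[of ?\<beta>, OF P])
  have "preim g P P = P"
    using morphism_base_mem[OF g P] by (auto simp: preim_def)
  then have hom: "pull g P \<in> Ring.ring_hom ?R ?R"
    using morphismD(1)[OF g P order.refl] by simp
  have C_one: "C p q = bone ?R p q" if p: "p \<in> ?K" and q: "q \<in> ?K" for p q
  proof -
    obtain j c where jc: "q = (j, c)"
      by force
    let ?q = "(j, sorted_list_of_set (I j) ! c)"
    have q': "?q \<in> block_ix n m"
      using sel_index_mem[OF I q[unfolded jc]] .
    have A_q: "?A r ?q = bone ?R r q" for r
      using sel_cols_chart_matrix[OF I q, of P r] by (simp add: sel_cols_def jc)
    have "bone ?R p q = pull g P (?A p ?q)"
      using ring_hom_bone[OF ring_axioms ring_axioms hom, of p q] by (simp add: A_q)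
    also have "\<dots> = bmult ?R ?K C (bone ?R) p q"
      using eq[OF p q'] by (simp add: bmult_def A_q)
    also have "\<dots> = C p q"
      by (rule bmult_one_right) (use C p q finite_block_ix in auto)
    finally show ?thesis
      by simp
  qed
  have A_fixed: "pull g P (?A p q) = ?A p q" if p: "p \<in> ?K" and q: "q \<in> block_ix n m" for p q
  proof -
    have "bmult ?R ?K C ?A p q = bmult ?R ?K (bone ?R) ?A p q"
      by (rule bmult_cong) (use C_one p q chart_matrix_closed[OF I P] in auto)
    also have "\<dots> = ?A p q"
      by (rule bmult_one_left) (use p q chart_matrix_closed[OF I P] finite_block_ix in auto)
    finally show ?thesis
      using eq[OF p q] by simp
  qed
  \<comment> \<open>Every coordinate of the domain occurs among the deleted columns, so fixing the
    matrix fixes all coordinates.\<close>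
  have coord_fixed: "pull g P (coord P l i) = coord P l i" if li: "l < 2 ^ n" "i < ?\<beta> l" for l i
  proof -
    obtain p q where pq: "p \<in> ?K" "q \<in> block_ix n (\<lambda>j. m j - k j)" "coord_matrix n k m P p q = coord P l i"
      using coord_is_coord_matrix[OF li] by metis
    obtain j c where jc: "q = (j, c)"
      by force
    have "?A p (j, sorted_list_of_set ({..<m j} - I j) ! c) = coord P l i"
      using del_cols_chart_matrix[OF I pq(2), of P p] pq(3) by (simp add: del_cols_def jc)
    then show ?thesis
      using A_fixed[OF pq(1) del_index_mem[OF I pq(2)[unfolded jc]]] by simp
  qed
  note fixed = morphism_fixing_coords[of ?\<beta>, OF P g coord_fixed]
  show "preim g P W = W" if "openin (Euclidean_space (?\<beta> 0)) W" "W \<subseteq> P" for W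
    using fixed(1) that(2) by (auto simp: preim_def)
  show "pull g W f = f" if "openin (Euclidean_space (?\<beta> 0)) W" "W \<subseteq> P" "f \<in> carrier (sect n ?\<beta> W)" for W f
    using fixed(2) that by blast
qed

text \<open>Identities of sheaf morphisms are stated over every open \<open>W\<close>. The equality
  of the iterated preimage with \<open>W\<close> belongs to them: it says that the composite takes
  sections over \<open>W\<close> to sections over the same set. The inclusions in the third clause
  say that each pullback is taken over an open part of the target of its morphism.\<close>

theorem proposition2p1:
  fixes n :: nat and k m :: "nat \<Rightarrow> nat"
    and g :: "(nat \<Rightarrow> nat set) \<Rightarrow> (nat \<Rightarrow> nat set) \<Rightarrow> morph"
    and I J S :: "nat \<Rightarrow> nat set"
  assumes "n \<ge> 1"
    and "\<And>i. i < 2 ^ n \<Longrightarrow> k i \<le> m i"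
    and "\<And>I J. k_index n k m I \<Longrightarrow> k_index n k m J \<Longrightarrow> transition_morphism n k m I J (g I J)"
    and "k_index n k m I" and "k_index n k m J" and "k_index n k m S"
  shows "(\<forall>W. openin (Euclidean_space (beta n k m 0)) W \<and> W \<subseteq> overlap n k m I I \<longrightarrow>
            preim (g I I) (overlap n k m I I) W = W \<and>
            (\<forall>f \<in> carrier (sect n (beta n k m) W). pull (g I I) W f = f))
       \<and> (\<forall>W. openin (Euclidean_space (beta n k m 0)) W \<and> W \<subseteq> overlap n k m I J \<longrightarrow>
            (let V = preim (g I J) (overlap n k m J I) W in
             preim (g J I) (overlap n k m I J) V = W \<and>
             (\<forall>f \<in> carrier (sect n (beta n k m) W). pull (g J I) V (pull (g I J) W f) = f)))
       \<and> (\<forall>W. openin (Euclidean_space (beta n k m 0)) W \<and> W \<subseteq> overlap n k m I J \<inter> overlap n k m I S \<longrightarrow>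
            (let V = preim (g I J) (overlap n k m J I) W;
                 X = preim (g J S) (overlap n k m S J) V in
             V \<subseteq> overlap n k m J S \<and> X \<subseteq> overlap n k m S I \<and>
             preim (g S I) (overlap n k m I S) X = W \<and>
             (\<forall>f \<in> carrier (sect n (beta n k m) W).
                pull (g S I) X (pull (g J S) V (pull (g I J) W f)) = f)))"
proof -
  let ?\<beta> = "beta n k m"
  let ?O = "overlap n k m"
  note I = assms(4) and J = assms(5) and S = assms(6)
  have tr: "transition n k m I J (g I J)" if "k_index n k m I" "k_index n k m J" for I J
    using that assms(3) by (simp add: transition_def)
  note morph = transition.morphism_g[OF tr] and mult = transition.chart_multiple_g[OF tr]
  have op: "openin (Euclidean_space (?\<beta> 0)) (?O I J)" if "k_index n k m I" "k_index n k m J" for I J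
    by (rule openin_overlap[OF that])
  have base_mem: "base (g I J) y \<in> ?O I J" if "k_index n k m I" "k_index n k m J" "y \<in> ?O J I" for I J y
    using morphism_base_mem[OF morph op] that by blast
  have part1: "preim (g I I) (?O I I) W = W \<and> (\<forall>f \<in> carrier (sect n ?\<beta> W). pull (g I I) W f = f)"
    if "openin (Euclidean_space (?\<beta> 0)) W" "W \<subseteq> ?O I I" for W
    using chart_multiple_self[OF morph[OF I I] op[OF I I] I mult[OF I I]] that by blast
  have part2: "preim (g J I) (?O I J) (preim (g I J) (?O J I) W) = W \<and>
      (\<forall>f \<in> carrier (sect n ?\<beta> W). pull (g J I) (preim (g I J) (?O J I) W) (pull (g I J) W f) = f)"
    if W: "openin (Euclidean_space (?\<beta> 0)) W" "W \<subseteq> ?O I J" for W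
  proof -
    \<comment> \<open>The pullback of this composite is \<open>pull (g J I)\<close> after
      \<open>pull (g I J)\<close>, and its source and target are both \<open>?O I J\<close>.\<close>
    let ?h = "comp_morph (?O J I) (g I J) (g J I)"
    have "morphism n ?\<beta> (?O I J) ?\<beta> (?O I J) ?h"
      by (rule morphism_comp[OF morph[OF J I] morph[OF I J] op[OF I J] op[OF J I]])
    moreover have "chart_multiple n k m I I (?O I J) (?O I J) ?h"
      by (rule chart_multiple_comp[OF morph[OF J I] morph[OF I J] op[OF I J] op[OF J I] op[OF I J] J I
            mult[OF J I] mult[OF I J]])
    ultimately have "preim ?h (?O I J) W = W" "\<And>f. f \<in> carrier (sect n ?\<beta> W) \<Longrightarrow> pull ?h W f = f"
      using chart_multiple_self[OF _ op[OF I J] I] W by blast+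
    then show ?thesis
      unfolding preim_comp_morph[OF morph[OF J I] op[OF I J]] by (simp add: comp_morph_def)
  qed
  have part3: "V \<subseteq> ?O J S \<and> X \<subseteq> ?O S I \<and> preim (g S I) (?O I S) X = W \<and>
      (\<forall>f \<in> carrier (sect n ?\<beta> W). pull (g S I) X (pull (g J S) V (pull (g I J) W f)) = f)"
    if W: "openin (Euclidean_space (?\<beta> 0)) W" "W \<subseteq> ?O I J \<inter> ?O I S"
      and V: "V = preim (g I J) (?O J I) W" and X: "X = preim (g J S) (?O S J) V" for W V X
  proof -
    \<comment> \<open>The transition maps live on different pairwise overlaps. \<open>P\<close>,
      \<open>Q\<close> and \<open>R\<close> are the triple overlap seen in the charts of
      \<open>I\<close>, \<open>J\<close> and \<open>S\<close>, and between these the three maps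
      compose.\<close>
    define P where "P = ?O I J \<inter> ?O I S"
    define Q where "Q = preim (g I J) (?O J I) P"
    define R where "R = preim (g J S) (?O S J) Q"
    have P: "openin (Euclidean_space (?\<beta> 0)) P" "P \<subseteq> ?O I J"
      using op I J S by (auto simp: P_def)
    \<comment> \<open>By \<open>overlap_iff\<close> the base map of \<open>g I J\<close> respects
      the condition on the third index, so the preimage of a triple overlap is a triple
      overlap.\<close>
    have Q_eq: "Q = ?O J I \<inter> ?O J S"
      using transition.overlap_iff[OF tr[OF I J] S] base_mem[OF I J] by (auto simp: Q_def P_def preim_def)
    have Q: "openin (Euclidean_space (?\<beta> 0)) Q" "Q \<subseteq> ?O J S"
      unfolding Q_eq using op I J S by auto
    have R_eq: "R = ?O S J \<inter> ?O S I"
      using transition.overlap_iff[OF tr[OF J S] I] base_mem[OF J S] by (auto simp: R_def Q_eq preim_def)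
    have R: "openin (Euclidean_space (?\<beta> 0)) R" "R \<subseteq> ?O S I"
      unfolding R_eq using op I J S by auto
    \<comment> \<open>Here the cycle closes: the last preimage is \<open>P\<close> again, so the
      composite is an endomorphism of \<open>P\<close>.\<close>
    have P_eq: "preim (g S I) (?O I S) R = P"
      using transition.overlap_iff[OF tr[OF S I] J] base_mem[OF S I] by (auto simp: P_def R_eq preim_def)
    have mIJ: "morphism n ?\<beta> Q ?\<beta> P (g I J)" and cIJ: "chart_multiple n k m I J Q P (g I J)"
      unfolding Q_def using morphism_restrict[OF morph[OF I J] P(2)]
        chart_multiple_restrict[OF morph[OF I J] op[OF J I] op[OF I J] P I J mult[OF I J]] by auto
    have mJS: "morphism n ?\<beta> R ?\<beta> Q (g J S)" and cJS: "chart_multiple n k m J S R Q (g J S)"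
      unfolding R_def using morphism_restrict[OF morph[OF J S] Q(2)]
        chart_multiple_restrict[OF morph[OF J S] op[OF S J] op[OF J S] Q J S mult[OF J S]] by auto
    have mSI: "morphism n ?\<beta> P ?\<beta> R (g S I)" and cSI: "chart_multiple n k m S I P R (g S I)"
      using morphism_restrict[OF morph[OF S I] R(2)]
        chart_multiple_restrict[OF morph[OF S I] op[OF I S] op[OF S I] R S I mult[OF S I]]
      unfolding P_eq by auto
    let ?h1 = "comp_morph R (g J S) (g S I)"
    let ?h = "comp_morph Q (g I J) ?h1"
    have m1: "morphism n ?\<beta> P ?\<beta> Q ?h1" and c1: "chart_multiple n k m J I P Q ?h1"
      using morphism_comp[OF mSI mJS P(1) R(1)] chart_multiple_comp[OF mSI mJS P(1) R(1) Q(1) S I cSI cJS] by auto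
    have m: "morphism n ?\<beta> P ?\<beta> P ?h" and c: "chart_multiple n k m I I P P ?h"
      using morphism_comp[OF m1 mIJ P(1) Q(1)] chart_multiple_comp[OF m1 mIJ P(1) Q(1) P(1) J I c1 cIJ] by auto
    have WP: "W \<subseteq> P"
      using W(2) by (simp add: P_def)
    \<comment> \<open>The claim takes preimages in the full pairwise overlaps; as \<open>W\<close>
      lies in \<open>P\<close>, they agree with those taken in the smaller domains.\<close>
    have VQ: "V \<subseteq> Q" "preim (g I J) Q W = V"
      using WP by (auto simp: V Q_def preim_def)
    have XR: "X \<subseteq> R" "preim (g J S) R V = X"
      using VQ(1) by (auto simp: X R_def preim_def)
    have "preim (g S I) P X = preim (g S I) (?O I S) X"
      using XR(1) by (auto simp: P_eq[symmetric] preim_def)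
    moreover have "preim ?h P W = preim (g S I) P X"
      using preim_comp_morph[OF m1 P(1)] preim_comp_morph[OF mSI P(1)] VQ(2) XR(2) by simp
    moreover have "pull ?h W f = pull (g S I) X (pull (g J S) V (pull (g I J) W f))" for f
      by (simp add: comp_morph_def VQ(2) XR(2))
    moreover have "preim ?h P W = W" "\<And>f. f \<in> carrier (sect n ?\<beta> W) \<Longrightarrow> pull ?h W f = f"
      using chart_multiple_self[OF m P(1) I c] W(1) WP by auto
    ultimately show ?thesis
      using VQ(1) Q(2) XR(1) R(2) by (intro conjI ballI) (blast | simp only:)+
  qed
  show ?thesis
    using part1 part2 part3 by (simp add: Let_def)
qed

end
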